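(* All Hom-Lie algebras are multiplicative Hom-Lie algebras over a field $\mathbb{K}$. (a) If a central extension $0 \to (M, \alpha_M) \stackrel{i}{\to} (K,\alpha_K) \stackrel{\pi}{\to} (L, \alpha_L) \to 0$ is a universal $\alpha$-central extension, then $(K,\alpha_K)$ is a perfect Hom-Lie algebra and every central extension of $(K,\alpha_K)$ is split. (b) Let $0 \to (M, \alpha_M) \stackrel{i}{\to} (K,\alpha_K) \stackrel{\pi}{\to} (L, \alpha_L) \to 0$ be a central extension. If $(K,\alpha_K)$ is a perfect Hom-Lie algebra and every central extension of $(K,\alpha_K)$ is split, then $0 \to (M, \alpha_M) \stackrel{i}{\to} (K,\alpha_K) \stackrel{\pi}{\to} (L, \alpha_L) \to 0$ is a universal central extension. (c) A Hom-Lie algebra $(L, \alpha_L)$ admits a universal central extension if and only if $(L, \alpha_L)$ is perfect. (d) The kernel of the universal central extension of $(L,\alpha_L)$ (for $(L,\alpha_L)$ perfect, as in (c)) is canonically isomorphic to $H_2^{\alpha}(L)$.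
   Context: A (multiplicative) Hom-Lie algebra $(L,[-,-],\alpha_L)$, written $(L,\alpha_L)$, is a $\mathbb{K}$-vector space $L$ with a bilinear bracket $[-,-]:L\times L\to L$ and a linear map $\alpha_L:L\to L$ such that $[x,y]=-[y,x]$, $[\alpha_L(x),[y,z]]+[\alpha_L(z),[x,y]]+[\alpha_L(y),[z,x]]=0$ and $\alpha_L([x,y])=[\alpha_L(x),\alpha_L(y)]$ for all $x,y,z\in L$. A homomorphism $f:(L,\alpha_L)\to(L',\alpha_{L'})$ is a linear map with $f([x,y])=[f(x),f(y)]$ and $f\alpha_L=\alpha_{L'}f$. $(L,\alpha_L)$ is perfect if $L=[L,L]$, the linear span of all brackets. An extension of $(L,\alpha_L)$ is a short exact sequence of Hom-Lie algebras and homomorphisms $0 \to (M, \alpha_M) \stackrel{i}{\to} (K,\alpha_K) \stackrel{\pi}{\to} (L, \alpha_L) \to 0$; identify $M$ with $i(M)\subseteq K$. It is central if $[M,K]=0$, and $\alpha$-central if $[\alpha_M(M),K]=0$. It is split if there is a homomorphism of Hom-Lie algebras $\sigma:(L,\alpha_L)\to(K,\alpha_K)$ with $\pi\sigma=\mathrm{Id}_L$. A central extension $0 \to (M, \alpha_M) \stackrel{i}{\to} (K,\alpha_K) \stackrel{\pi}{\to} (L, \alpha_L) \to 0$ is a universal central (resp. universal $\alpha$-central) extension if for every central (resp. $\alpha$-central) extension $0 \to (M', \alpha_{M'}) \stackrel{i'}{\to} (K',\alpha_{K'}) \stackrel{\pi'}{\to} (L, \alpha_L) \to 0$ there is a unique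 homomorphism of Hom-Lie algebras $h:(K,\alpha_K)\to(K',\alpha_{K'})$ with $\pi'h=\pi$. $H_n^{\alpha}(L)$ denotes the homology of $(L,\alpha_L)$ with trivial coefficients $\mathbb{K}$ (zero action, $\alpha_{\mathbb{K}}=\mathrm{Id}$): the homology of the complex $C_n^{\alpha}(L)=\Lambda^nL$, $n\ge 0$, with differentials $$d_n(x_1\wedge\cdots\wedge x_n)=\sum_{1\le i<j\le n}(-1)^{i+j}[x_i,x_j]\wedge\alpha_L(x_1)\wedge\cdots\wedge\widehat{\alpha_L(x_i)}\wedge\cdots\wedge\widehat{\alpha_L(x_j)}\wedge\cdots\wedge\alpha_L(x_n).$$
   Formalization: In characteristic 2, where d_2 can be ill-defined on the usual exterior power and (d) can fail, Λ^n L is taken as the tensor power modulo skew-symmetry only (x∧x need not vanish); in other characteristics it is the usual Λ^n L. *)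

theory Defs
  imports "HOL-Algebra.Module" "HOL-Algebra.AbelCoset"
begin

section \<open>Linear algebra over a field given by a carrier\<close>

text \<open>
  Vector spaces are modules, in the sense of \<^locale>\<open>module\<close>, over a ring \<open>R\<close> with \<open>field R\<close>.
  As everywhere in HOL-Algebra, the components \<open>mult\<close> and \<open>one\<close> of a module record carry no
  information.
\<close>

definition linear_maps ::
  "'k ring \<Rightarrow> ('k, 'a, 'c) module_scheme \<Rightarrow> ('k, 'b, 'd) module_scheme \<Rightarrow> ('a \<Rightarrow> 'b) set" where
  "linear_maps R V W = {f \<in> carrier V \<rightarrow> carrier W.
     (\<forall>x\<in>carrier V. \<forall>y\<in>carrier V. f (x \<oplus>\<^bsub>V\<^esub> y) = f x \<oplus>\<^bsub>W\<^esub> f y) \<and>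
     (\<forall>a\<in>carrier R. \<forall>x\<in>carrier V. f (a \<odot>\<^bsub>V\<^esub> x) = a \<odot>\<^bsub>W\<^esub> f x)}"

definition lin_span :: "'k ring \<Rightarrow> ('k, 'a, 'c) module_scheme \<Rightarrow> 'a set \<Rightarrow> 'a set" where
  "lin_span R V S = \<Inter>{H. submodule H R V \<and> S \<subseteq> H}"

definition quot_module :: "('k, 'a, 'c) module_scheme \<Rightarrow> 'a set \<Rightarrow> ('k, 'a set) module" where
  "quot_module V H =
     \<lparr>carrier = a_rcosets\<^bsub>V\<^esub> H, mult = undefined, one = undefined,
      zero = H, add = set_add V, smult = (\<lambda>a X. \<Union>x\<in>X. H +>\<^bsub>V\<^esub> (a \<odot>\<^bsub>V\<^esub> x))\<rparr>"

text \<open>The free module on \<open>S\<close>: finitely supported functions, vanishing outside \<open>S\<close>.\<close>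

definition free_module :: "'k ring \<Rightarrow> 'a set \<Rightarrow> ('k, 'a \<Rightarrow> 'k) module" where
  "free_module R S =
     \<lparr>carrier = {f. (\<forall>x. f x \<in> carrier R) \<and> finite {x. f x \<noteq> \<zero>\<^bsub>R\<^esub>} \<and> (\<forall>x. x \<notin> S \<longrightarrow> f x = \<zero>\<^bsub>R\<^esub>)},
      mult = undefined, one = undefined,
      zero = (\<lambda>_. \<zero>\<^bsub>R\<^esub>), add = (\<lambda>f g x. f x \<oplus>\<^bsub>R\<^esub> g x), smult = (\<lambda>a f x. a \<otimes>\<^bsub>R\<^esub> f x)\<rparr>"

definition single :: "'k ring \<Rightarrow> 'a \<Rightarrow> 'a \<Rightarrow> 'k" where
  "single R x = (\<lambda>y. if y = x then \<one>\<^bsub>R\<^esub> else \<zero>\<^bsub>R\<^esub>)"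

section \<open>Exterior powers\<close>

text \<open>
  \<open>\<Lambda>\<^sup>n V\<close> is the free module on the \<open>n\<close>-tuples of vectors modulo multilinearity and
  \<open>\<dots> \<and> x \<and> \<dots> \<and> y \<and> \<dots> = - (\<dots> \<and> y \<and> \<dots> \<and> x \<and> \<dots>)\<close>.  In characteristic other than 2 the last
  relation amounts to the vanishing of every \<open>x\<^sub>1 \<and> \<dots> \<and> x\<^sub>n\<close> with a repeated entry (one direction
  is lemma \<open>wedge_repeated\<close> below).  In characteristic 2 this skew-symmetric form is the one matching
  the axiom \<open>[x,y] = -[y,x]\<close> of Hom-Lie algebras, which there does not force \<open>[x,x] = 0\<close>: dividing
  by \<open>x \<and> x\<close> as well would leave the differential \<open>d\<^sub>2 (x \<and> y) = -[x,y]\<close> ill-defined.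
\<close>

definition words :: "('k, 'a, 'c) module_scheme \<Rightarrow> nat \<Rightarrow> 'a list set" where
  "words V n = {xs. length xs = n \<and> set xs \<subseteq> carrier V}"

definition free_words :: "'k ring \<Rightarrow> ('k, 'a, 'c) module_scheme \<Rightarrow> nat \<Rightarrow> ('k, 'a list \<Rightarrow> 'k) module" where
  "free_words R V n = free_module R (words V n)"

definition ext_relators :: "'k ring \<Rightarrow> ('k, 'a, 'c) module_scheme \<Rightarrow> nat \<Rightarrow> ('a list \<Rightarrow> 'k) set" where
  "ext_relators R V n = (let F = free_words R V n in
     {single R (xs[i := x \<oplus>\<^bsub>V\<^esub> y]) \<ominus>\<^bsub>F\<^esub> (single R (xs[i := x]) \<oplus>\<^bsub>F\<^esub> single R (xs[i := y])) | xs i x y.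
        xs \<in> words V n \<and> i < n \<and> x \<in> carrier V \<and> y \<in> carrier V} \<union>
     {single R (xs[i := a \<odot>\<^bsub>V\<^esub> x]) \<ominus>\<^bsub>F\<^esub> a \<odot>\<^bsub>F\<^esub> single R (xs[i := x]) | xs i a x.
        xs \<in> words V n \<and> i < n \<and> a \<in> carrier R \<and> x \<in> carrier V} \<union>
     {single R xs \<oplus>\<^bsub>F\<^esub> single R (xs[i := xs ! j, j := xs ! i]) | xs i j.
        xs \<in> words V n \<and> i < j \<and> j < n})"

definition ext_kernel :: "'k ring \<Rightarrow> ('k, 'a, 'c) module_scheme \<Rightarrow> nat \<Rightarrow> ('a list \<Rightarrow> 'k) set" where
  "ext_kernel R V n = lin_span R (free_words R V n) (ext_relators R V n)"

definition ext_power ::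
  "'k ring \<Rightarrow> ('k, 'a, 'c) module_scheme \<Rightarrow> nat \<Rightarrow> ('k, ('a list \<Rightarrow> 'k) set) module" where
  "ext_power R V n = quot_module (free_words R V n) (ext_kernel R V n)"

text \<open>\<open>wedge R V [x\<^sub>1, \<dots>, x\<^sub>n]\<close> is \<open>x\<^sub>1 \<and> \<dots> \<and> x\<^sub>n\<close>.\<close>

definition wedge :: "'k ring \<Rightarrow> ('k, 'a, 'c) module_scheme \<Rightarrow> 'a list \<Rightarrow> ('a list \<Rightarrow> 'k) set" where
  "wedge R V xs =
     ext_kernel R V (length xs) +>\<^bsub>free_words R V (length xs)\<^esub> single R xs"

section \<open>Hom-Lie algebras\<close>

record ('k, 'a) hom_lie = "('k, 'a) module" +
  bracket :: "'a \<Rightarrow> 'a \<Rightarrow> 'a"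
  alpha :: "'a \<Rightarrow> 'a"

locale hom_lie_algebra = field R + module R L
  for R :: "'k ring" and L :: "('k, 'a) hom_lie" +
  assumes bracket_linear_right: "x \<in> carrier L \<Longrightarrow> (\<lambda>y. bracket L x y) \<in> linear_maps R L L"
    and bracket_linear_left: "y \<in> carrier L \<Longrightarrow> (\<lambda>x. bracket L x y) \<in> linear_maps R L L"
    and alpha_linear: "alpha L \<in> linear_maps R L L"
    and bracket_skew: "\<lbrakk>x \<in> carrier L; y \<in> carrier L\<rbrakk> \<Longrightarrow> bracket L x y = \<ominus>\<^bsub>L\<^esub> bracket L y x"
    and hom_jacobi: "\<lbrakk>x \<in> carrier L; y \<in> carrier L; z \<in> carrier L\<rbrakk> \<Longrightarrow>
      bracket L (alpha L x) (bracket L y z) \<oplus>\<^bsub>L\<^esub> bracket L (alpha L z) (bracket L x y)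
        \<oplus>\<^bsub>L\<^esub> bracket L (alpha L y) (bracket L z x) = \<zero>\<^bsub>L\<^esub>"
    and alpha_bracket: "\<lbrakk>x \<in> carrier L; y \<in> carrier L\<rbrakk> \<Longrightarrow>
      alpha L (bracket L x y) = bracket L (alpha L x) (alpha L y)"

definition hom_lie_homs ::
  "'k ring \<Rightarrow> ('k, 'a) hom_lie \<Rightarrow> ('k, 'b) hom_lie \<Rightarrow> ('a \<Rightarrow> 'b) set" where
  "hom_lie_homs R L L' = {f \<in> linear_maps R L L'.
     (\<forall>x\<in>carrier L. \<forall>y\<in>carrier L. f (bracket L x y) = bracket L' (f x) (f y)) \<and>
     (\<forall>x\<in>carrier L. f (alpha L x) = alpha L' (f x))}"

definition perfect :: "'k ring \<Rightarrow> ('k, 'a) hom_lie \<Rightarrow> bool" where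
  "perfect R L \<longleftrightarrow>
     carrier L = lin_span R L {bracket L x y | x y. x \<in> carrier L \<and> y \<in> carrier L}"

section \<open>Extensions\<close>

text \<open>In the following, \<open>M i K \<pi> L\<close> stands for the sequence \<open>0 \<rightarrow> M \<rightarrow> K \<rightarrow> L \<rightarrow> 0\<close> with maps \<open>i\<close>
  and \<open>\<pi>\<close>.\<close>

definition extension ::
  "'k ring \<Rightarrow> ('k, 'm) hom_lie \<Rightarrow> ('m \<Rightarrow> 'h) \<Rightarrow> ('k, 'h) hom_lie \<Rightarrow> ('h \<Rightarrow> 'l) \<Rightarrow> ('k, 'l) hom_lie \<Rightarrow> bool"
  where
  "extension R M i K \<pi> L \<longleftrightarrow>
     hom_lie_algebra R M \<and> hom_lie_algebra R K \<and> hom_lie_algebra R L \<and>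
     i \<in> hom_lie_homs R M K \<and> \<pi> \<in> hom_lie_homs R K L \<and>
     inj_on i (carrier M) \<and> i ` carrier M = a_kernel K L \<pi> \<and> \<pi> ` carrier K = carrier L"

definition central_extension ::
  "'k ring \<Rightarrow> ('k, 'm) hom_lie \<Rightarrow> ('m \<Rightarrow> 'h) \<Rightarrow> ('k, 'h) hom_lie \<Rightarrow> ('h \<Rightarrow> 'l) \<Rightarrow> ('k, 'l) hom_lie \<Rightarrow> bool"
  where
  "central_extension R M i K \<pi> L \<longleftrightarrow> extension R M i K \<pi> L \<and>
     (\<forall>m\<in>carrier M. \<forall>k\<in>carrier K. bracket K (i m) k = \<zero>\<^bsub>K\<^esub>)"

definition alpha_central_extension ::
  "'k ring \<Rightarrow> ('k, 'm) hom_lie \<Rightarrow> ('m \<Rightarrow> 'h) \<Rightarrow> ('k, 'h) hom_lie \<Rightarrow> ('h \<Rightarrow> 'l) \<Rightarrow> ('k, 'l) hom_lie \<Rightarrow> bool"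
  where
  "alpha_central_extension R M i K \<pi> L \<longleftrightarrow> extension R M i K \<pi> L \<and>
     (\<forall>m\<in>carrier M. \<forall>k\<in>carrier K. bracket K (i (alpha M m)) k = \<zero>\<^bsub>K\<^esub>)"

definition split_extension ::
  "'k ring \<Rightarrow> ('k, 'm) hom_lie \<Rightarrow> ('m \<Rightarrow> 'h) \<Rightarrow> ('k, 'h) hom_lie \<Rightarrow> ('h \<Rightarrow> 'l) \<Rightarrow> ('k, 'l) hom_lie \<Rightarrow> bool"
  where
  "split_extension R M i K \<pi> L \<longleftrightarrow> extension R M i K \<pi> L \<and>
     (\<exists>\<sigma>\<in>hom_lie_homs R L K. \<forall>x\<in>carrier L. \<pi> (\<sigma> x) = x)"

text \<open>
  A HOL formula cannot quantify over types.  The three notions below, which quantify over all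
  extensions, therefore take a type argument \<open>TYPE('v)\<close>: the extensions tested are those whose two
  algebras have carriers contained in \<open>'v\<close>.  If \<open>'v\<close> is infinite, it also holds copies of all
  algebras built from algebras in \<open>'v\<close> that matter here (products, pullbacks, quotients of
  \<open>L \<otimes> L\<close>), and \<open>'v\<close> serves as a universe.  Maps are compared on carriers only.
\<close>

definition unique_lift ::
  "'k ring \<Rightarrow> ('k, 'h) hom_lie \<Rightarrow> ('h \<Rightarrow> 'l) \<Rightarrow> ('k, 'v) hom_lie \<Rightarrow> ('v \<Rightarrow> 'l) \<Rightarrow> bool" where
  "unique_lift R K \<pi> K' \<pi>' \<longleftrightarrow>
     (let H = {h \<in> hom_lie_homs R K K'. \<forall>x\<in>carrier K. \<pi>' (h x) = \<pi> x}
      in H \<noteq> {} \<and> (\<forall>g\<in>H. \<forall>h\<in>H. \<forall>x\<in>carrier K. g x = h x))"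

definition universal_central_extension ::
  "'v itself \<Rightarrow> 'k ring \<Rightarrow> ('k, 'm) hom_lie \<Rightarrow> ('m \<Rightarrow> 'h) \<Rightarrow> ('k, 'h) hom_lie \<Rightarrow> ('h \<Rightarrow> 'l) \<Rightarrow>
   ('k, 'l) hom_lie \<Rightarrow> bool"
  where
  "universal_central_extension T R M i K \<pi> L \<longleftrightarrow> central_extension R M i K \<pi> L \<and>
     (\<forall>(M' :: ('k, 'v) hom_lie) i' (K' :: ('k, 'v) hom_lie) \<pi>'.
        central_extension R M' i' K' \<pi>' L \<longrightarrow> unique_lift R K \<pi> K' \<pi>')"

definition universal_alpha_central_extension ::
  "'v itself \<Rightarrow> 'k ring \<Rightarrow> ('k, 'm) hom_lie \<Rightarrow> ('m \<Rightarrow> 'h) \<Rightarrow> ('k, 'h) hom_lie \<Rightarrow> ('h \<Rightarrow> 'l) \<Rightarrow>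
   ('k, 'l) hom_lie \<Rightarrow> bool"
  where
  "universal_alpha_central_extension T R M i K \<pi> L \<longleftrightarrow> central_extension R M i K \<pi> L \<and>
     (\<forall>(M' :: ('k, 'v) hom_lie) i' (K' :: ('k, 'v) hom_lie) \<pi>'.
        alpha_central_extension R M' i' K' \<pi>' L \<longrightarrow> unique_lift R K \<pi> K' \<pi>')"

definition every_central_extension_split :: "'v itself \<Rightarrow> 'k ring \<Rightarrow> ('k, 'h) hom_lie \<Rightarrow> bool" where
  "every_central_extension_split T R K \<longleftrightarrow>
     (\<forall>(M' :: ('k, 'v) hom_lie) i' (K' :: ('k, 'v) hom_lie) \<pi>'.
        central_extension R M' i' K' \<pi>' K \<longrightarrow> split_extension R M' i' K' \<pi>' K)"

section \<open>Homology with trivial coefficients\<close>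

text \<open>
  The right-hand side of the formula for \<open>d\<^sub>n (x\<^sub>1 \<and> \<dots> \<and> x\<^sub>n)\<close>.  Positions are counted from 0, which
  does not affect the sign.
\<close>

definition boundary_word :: "'k ring \<Rightarrow> ('k, 'a) hom_lie \<Rightarrow> 'a list \<Rightarrow> ('a list \<Rightarrow> 'k) set" where
  "boundary_word R L xs = (let n = length xs; W = ext_power R L (n - 1) in
     finsum W (\<lambda>(i, j).
       let w = wedge R L (bracket L (xs ! i) (xs ! j) # map (alpha L) (nths xs (- {i, j})))
       in if even (i + j) then w else \<ominus>\<^bsub>W\<^esub> w) {(i, j). i < j \<and> j < n})"

text \<open>The linear map \<open>d\<^sub>n : \<Lambda>\<^sup>n L \<rightarrow> \<Lambda>\<^sup>n\<^sup>-\<^sup>1 L\<close>.  For \<open>n = 0\<close> it is the zero map on \<open>\<Lambda>\<^sup>0 L\<close>, so its kernel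
  is right as well.\<close>

definition differential ::
  "'k ring \<Rightarrow> ('k, 'a) hom_lie \<Rightarrow> nat \<Rightarrow> ('a list \<Rightarrow> 'k) set \<Rightarrow> ('a list \<Rightarrow> 'k) set" where
  "differential R L n = (THE d. d \<in> extensional (carrier (ext_power R L n)) \<and>
     d \<in> linear_maps R (ext_power R L n) (ext_power R L (n - 1)) \<and>
     (\<forall>xs\<in>words L n. d (wedge R L xs) = boundary_word R L xs))"

definition cycles :: "'k ring \<Rightarrow> ('k, 'a) hom_lie \<Rightarrow> nat \<Rightarrow> ('a list \<Rightarrow> 'k) set set" where
  "cycles R L n = a_kernel (ext_power R L n) (ext_power R L (n - 1)) (differential R L n)"

definition boundaries :: "'k ring \<Rightarrow> ('k, 'a) hom_lie \<Rightarrow> nat \<Rightarrow> ('a list \<Rightarrow> 'k) set set" where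
  "boundaries R L n = differential R L (n + 1) ` carrier (ext_power R L (n + 1))"

definition homology ::
  "'k ring \<Rightarrow> ('k, 'a) hom_lie \<Rightarrow> nat \<Rightarrow> ('k, ('a list \<Rightarrow> 'k) set set) module" where
  "homology R L n = quot_module ((ext_power R L n)\<lparr>carrier := cycles R L n\<rparr>) (boundaries R L n)"

definition homology_class ::
  "'k ring \<Rightarrow> ('k, 'a) hom_lie \<Rightarrow> nat \<Rightarrow> ('a list \<Rightarrow> 'k) set \<Rightarrow> ('a list \<Rightarrow> 'k) set set" where
  "homology_class R L n z = boundaries R L n +>\<^bsub>ext_power R L n\<^esub> z"

text \<open>
  The canonical linear isomorphism from \<open>H\<^sub>2 L\<close> to the kernel \<open>M\<close> of a central extension.  As
  \<open>M\<close> is central, \<open>[x,y]\<close> for \<open>x, y\<close> in \<open>K\<close> depends only on \<open>\<pi> x\<close> and \<open>\<pi> y\<close>; so there is a linear map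
  \<open>\<beta> : \<Lambda>\<^sup>2 L \<rightarrow> K\<close> with \<open>\<beta> (\<pi> x \<and> \<pi> y) = [x,y]\<close>, and the isomorphism is the one induced by \<open>\<beta>\<close>.
  These conditions determine \<open>\<phi>\<close> on the carrier of \<open>H\<^sub>2 L\<close>.
\<close>

definition canonical_H2_iso ::
  "'k ring \<Rightarrow> ('k, 'm) hom_lie \<Rightarrow> ('m \<Rightarrow> 'h) \<Rightarrow> ('k, 'h) hom_lie \<Rightarrow> ('h \<Rightarrow> 'l) \<Rightarrow> ('k, 'l) hom_lie \<Rightarrow>
   (('l list \<Rightarrow> 'k) set set \<Rightarrow> 'm) \<Rightarrow> bool" where
  "canonical_H2_iso R M i K \<pi> L \<phi> \<longleftrightarrow>
     \<phi> \<in> linear_maps R (homology R L 2) M \<and>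
     bij_betw \<phi> (carrier (homology R L 2)) (carrier M) \<and>
     (\<exists>\<beta>\<in>linear_maps R (ext_power R L 2) K.
        (\<forall>x\<in>carrier K. \<forall>y\<in>carrier K. \<beta> (wedge R L [\<pi> x, \<pi> y]) = bracket K x y) \<and>
        (\<forall>z\<in>cycles R L 2. i (\<phi> (homology_class R L 2 z)) = \<beta> z))"

section \<open>Repeated entries in characteristic other than 2\<close>

lemma free_module_simps:
  "f \<oplus>\<^bsub>free_module R S\<^esub> g = (\<lambda>x. f x \<oplus>\<^bsub>R\<^esub> g x)"
  "a \<odot>\<^bsub>free_module R S\<^esub> f = (\<lambda>x. a \<otimes>\<^bsub>R\<^esub> f x)"
  by (simp_all add: free_module_def)

lemma wedge_repeated:
  assumes R: "field R" and two: "\<one>\<^bsub>R\<^esub> \<oplus>\<^bsub>R\<^esub> \<one>\<^bsub>R\<^esub> \<noteq> \<zero>\<^bsub>R\<^esub>"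
    and xs: "xs \<in> words V n" "i < j" "j < n" "xs ! i = xs ! j"
  shows "single R xs \<in> ext_kernel R V n"
proof -
  interpret R: field R by fact
  let ?F = "free_words R V n" and ?t = "\<one>\<^bsub>R\<^esub> \<oplus>\<^bsub>R\<^esub> \<one>\<^bsub>R\<^esub>"
  have swap: "xs[i := xs ! j, j := xs ! i] = xs"
    using xs by (metis list_update_id)
  have rel: "single R xs \<oplus>\<^bsub>?F\<^esub> single R xs \<in> ext_relators R V n"
  proof -
    have "single R xs \<oplus>\<^bsub>?F\<^esub> single R (xs[i := xs ! j, j := xs ! i]) \<in> ext_relators R V n"
      unfolding ext_relators_def Let_def using xs(1-3) by blast
    then show ?thesis by (simp only: swap)
  qed
  have unit: "?t \<in> Units R" using two R.field_Units by simp
  then have inv: "inv\<^bsub>R\<^esub> ?t \<in> carrier R" "inv\<^bsub>R\<^esub> ?t \<otimes>\<^bsub>R\<^esub> ?t = \<one>\<^bsub>R\<^esub>"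
    by (auto intro: R.Units_inv_closed R.Units_l_inv)
  have half: "inv\<^bsub>R\<^esub> ?t \<odot>\<^bsub>?F\<^esub> (single R xs \<oplus>\<^bsub>?F\<^esub> single R xs) = single R xs"
    using inv by (auto simp: free_words_def free_module_simps single_def fun_eq_iff)
  have "single R xs \<in> H" if "submodule H R ?F" "ext_relators R V n \<subseteq> H" for H
    using submodule.smult_closed[OF that(1) inv(1)] rel that(2) half by (metis subsetD)
  then show ?thesis
    by (auto simp: ext_kernel_def lin_span_def)
qed

end

theory Submission
  imports Defs
begin

text \<open>
  The proof rests on one explicit algebra.  For a Hom-Lie algebra \<open>L\<close> let \<open>Q = \<Lambda>\<^sup>2 L / d\<^sub>3 (\<Lambda>\<^sup>3 L)\<close>, let
  \<open>u : Q \<rightarrow> L\<close> be induced by \<open>x \<and> y \<mapsto> [x, y]\<close>, and put \<open>[X, Y] = u X \<and> u Y\<close> and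
  \<open>\<alpha> (x \<and> y) = \<alpha> x \<and> \<alpha> y\<close>.  Since \<open>d\<^sub>3 (x \<and> y \<and> z)\<close> is the Hom-Jacobi expression in \<open>x, y, z\<close> with its
  outer bracket replaced by a wedge, \<open>Q\<close> is a Hom-Lie algebra and \<open>u\<close> a homomorphism
  (\<open>exterior_cover_ex\<close>), and the kernel of \<open>u\<close> is \<open>H\<^sub>2 L\<close> by construction.  If \<open>f : L \<rightarrow> K\<close> is a
  homomorphism and \<open>\<rho> : E \<rightarrow> K\<close> a central extension, brackets in \<open>E\<close> depend only on images in \<open>K\<close>, so
  \<open>x \<and> y \<mapsto> [x', y']\<close>, where \<open>x'\<close> and \<open>y'\<close> are any preimages of \<open>f x\<close> and \<open>f y\<close>, defines a homomorphism
  \<open>Q \<rightarrow> E\<close> over \<open>f\<close> (\<open>cover_lift\<close>).  For perfect \<open>L\<close> the map \<open>u\<close> is onto, \<open>Q\<close> is perfect, and lifts from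
  a perfect algebra along a central extension are unique (\<open>perfect_lift_unique\<close>), so \<open>Q\<close> is a
  universal central extension of \<open>L\<close>.

  The source \<open>K\<close> of a universal central extension of \<open>L\<close> is perfect because \<open>0\<close> and the class map
  \<open>K \<rightarrow> K / [K, K]\<close> give two lifts of \<open>K \<rightarrow> L\<close> to \<open>K / [K, K] \<times> L\<close> (\<open>universal_central_perfect\<close>); its image
  \<open>L\<close> is then perfect as well.  If \<open>K \<rightarrow> L\<close> is universal \<open>\<alpha>\<close>-central, the Hom-Jacobi identity shows that
  the composite of the cover \<open>Q \<rightarrow> K\<close> of \<open>K\<close> with \<open>K \<rightarrow> L\<close> is \<open>\<alpha>\<close>-central, so \<open>Q \<rightarrow> K\<close> splits, and with it
  every central extension of \<open>K\<close>, as \<open>Q\<close> maps to all of them.  Conversely, a splitting \<open>K \<rightarrow> Q\<close> followed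
  by lifts from \<open>Q\<close> gives the universal property of \<open>K \<rightarrow> L\<close>.  Finally, a universal central extension
  \<open>K\<close> of \<open>L\<close> maps to the cover of \<open>L\<close>; hence the kernel of \<open>\<beta> : \<Lambda>\<^sup>2 L \<rightarrow> K\<close> consists of boundaries only,
  and \<open>\<beta>\<close> identifies \<open>H\<^sub>2 L\<close> with the kernel of \<open>K \<rightarrow> L\<close>.

  The cover handles the change of universe.  It lifts to extensions with carriers in any type, and
  all of its elements are finite sums of wedges, so if \<open>'u\<close> is infinite and \<open>L\<close> lives in \<open>'u\<close>, a copy
  of \<open>Q\<close> does too (\<open>exterior_cover_same_type\<close>).
\<close>

section \<open>Linear maps, quotients and spans\<close>

lemma linear_mapsI:
  assumes "\<And>x. x \<in> carrier V \<Longrightarrow> f x \<in> carrier W"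
    and "\<And>x y. \<lbrakk>x \<in> carrier V; y \<in> carrier V\<rbrakk> \<Longrightarrow> f (x \<oplus>\<^bsub>V\<^esub> y) = f x \<oplus>\<^bsub>W\<^esub> f y"
    and "\<And>a x. \<lbrakk>a \<in> carrier R; x \<in> carrier V\<rbrakk> \<Longrightarrow> f (a \<odot>\<^bsub>V\<^esub> x) = a \<odot>\<^bsub>W\<^esub> f x"
  shows "f \<in> linear_maps R V W"
  using assms by (auto simp: linear_maps_def)

lemma linear_map_closed: "\<lbrakk>f \<in> linear_maps R V W; x \<in> carrier V\<rbrakk> \<Longrightarrow> f x \<in> carrier W"
  by (auto simp: linear_maps_def)

lemma linear_map_add:
  "\<lbrakk>f \<in> linear_maps R V W; x \<in> carrier V; y \<in> carrier V\<rbrakk> \<Longrightarrow> f (x \<oplus>\<^bsub>V\<^esub> y) = f x \<oplus>\<^bsub>W\<^esub> f y"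
  by (auto simp: linear_maps_def)

lemma linear_map_smult:
  "\<lbrakk>f \<in> linear_maps R V W; a \<in> carrier R; x \<in> carrier V\<rbrakk> \<Longrightarrow> f (a \<odot>\<^bsub>V\<^esub> x) = a \<odot>\<^bsub>W\<^esub> f x"
  by (auto simp: linear_maps_def)

lemma linear_map_zero:
  assumes "module R V" "module R W" "f \<in> linear_maps R V W"
  shows "f \<zero>\<^bsub>V\<^esub> = \<zero>\<^bsub>W\<^esub>"
proof -
  interpret V: module R V by fact
  interpret W: module R W by fact
  have "f (\<zero>\<^bsub>R\<^esub> \<odot>\<^bsub>V\<^esub> \<zero>\<^bsub>V\<^esub>) = \<zero>\<^bsub>R\<^esub> \<odot>\<^bsub>W\<^esub> f \<zero>\<^bsub>V\<^esub>"
    by (rule linear_map_smult[OF assms(3)]) auto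
  then show ?thesis using linear_map_closed[OF assms(3)] by simp
qed

lemma linear_map_minus:
  assumes "module R V" "module R W" "f \<in> linear_maps R V W" "x \<in> carrier V"
  shows "f (\<ominus>\<^bsub>V\<^esub> x) = \<ominus>\<^bsub>W\<^esub> f x"
proof -
  interpret V: module R V by fact
  interpret W: module R W by fact
  have "f ((\<ominus>\<^bsub>R\<^esub> \<one>\<^bsub>R\<^esub>) \<odot>\<^bsub>V\<^esub> x) = (\<ominus>\<^bsub>R\<^esub> \<one>\<^bsub>R\<^esub>) \<odot>\<^bsub>W\<^esub> f x"
    by (rule linear_map_smult[OF assms(3)]) (auto simp: assms)
  then show ?thesis using linear_map_closed[OF assms(3)] assms(4)
    by (simp add: V.smult_l_minus W.smult_l_minus)
qed

lemma linear_map_diff: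
  assumes "module R V" "module R W" "f \<in> linear_maps R V W" "x \<in> carrier V" "y \<in> carrier V"
  shows "f (x \<ominus>\<^bsub>V\<^esub> y) = f x \<ominus>\<^bsub>W\<^esub> f y"
proof -
  interpret V: module R V by fact
  show ?thesis using assms
    by (simp add: a_minus_def linear_map_add[OF assms(3)] linear_map_minus[OF assms(1-3)])
qed

lemma linear_map_comp:
  "\<lbrakk>f \<in> linear_maps R U V; g \<in> linear_maps R V W\<rbrakk> \<Longrightarrow> (\<lambda>x. g (f x)) \<in> linear_maps R U W"
  by (auto simp: linear_maps_def Pi_iff)

lemma linear_map_id: "(\<lambda>x. x) \<in> linear_maps R V V"
  by (auto simp: linear_maps_def)

lemma (in module) diff_zero_iff:
  "\<lbrakk>x \<in> carrier M; y \<in> carrier M\<rbrakk> \<Longrightarrow> x \<ominus>\<^bsub>M\<^esub> y = \<zero>\<^bsub>M\<^esub> \<longleftrightarrow> x = y"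
  by (metis M.minus_unique M.add.inv_closed M.add.m_comm M.minus_minus M.r_neg a_minus_def)

lemma linear_map_ker_cong:
  assumes "module R V" "module R W" "f \<in> linear_maps R V W"
    "\<And>z. \<lbrakk>z \<in> carrier V; c z = \<zero>\<^bsub>Q\<^esub>\<rbrakk> \<Longrightarrow> f z = \<zero>\<^bsub>W\<^esub>"
    "module R Q" "c \<in> linear_maps R V Q" "x \<in> carrier V" "y \<in> carrier V" "c x = c y"
  shows "f x = f y"
proof -
  interpret V: module R V by fact
  interpret W: module R W by fact
  interpret Q: module R Q by fact
  have "c (x \<ominus>\<^bsub>V\<^esub> y) = \<zero>\<^bsub>Q\<^esub>"
    using assms linear_map_closed[OF assms(6)] by (simp add: linear_map_diff Q.diff_zero_iff)
  then have "f (x \<ominus>\<^bsub>V\<^esub> y) = \<zero>\<^bsub>W\<^esub>" using assms by simp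
  then show ?thesis using assms linear_map_closed[OF assms(3)]
    by (simp add: linear_map_diff W.diff_zero_iff)
qed

text \<open>A linear map factors through a surjective linear map whose kernel it kills.\<close>

lemma linear_map_factor:
  assumes V: "module R V" and W: "module R W" and Q: "module R Q"
    and c: "c \<in> linear_maps R V Q" "c ` carrier V = carrier Q"
    and f: "f \<in> linear_maps R V W"
    and ker: "\<And>z. \<lbrakk>z \<in> carrier V; c z = \<zero>\<^bsub>Q\<^esub>\<rbrakk> \<Longrightarrow> f z = \<zero>\<^bsub>W\<^esub>"
  obtains g where "g \<in> linear_maps R Q W" "\<And>x. x \<in> carrier V \<Longrightarrow> g (c x) = f x"
proof -
  interpret V: module R V by fact
  let ?g = "\<lambda>q. f (inv_into (carrier V) c q)"
  have g: "?g (c x) = f x" if "x \<in> carrier V" for x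
    by (rule linear_map_ker_cong[OF V W f ker Q c(1)])
       (use that in \<open>auto simp: f_inv_into_f intro: inv_into_into\<close>)
  have "?g \<in> linear_maps R Q W"
  proof (rule linear_mapsI)
    fix x assume "x \<in> carrier Q"
    then show "?g x \<in> carrier W"
      using c(2) linear_map_closed[OF f] by (metis inv_into_into)
  next
    fix x y assume "x \<in> carrier Q" "y \<in> carrier Q"
    then obtain x' y' where xy: "x' \<in> carrier V" "y' \<in> carrier V" "x = c x'" "y = c y'"
      using c(2) by (metis imageE)
    then have "x \<oplus>\<^bsub>Q\<^esub> y = c (x' \<oplus>\<^bsub>V\<^esub> y')" using linear_map_add[OF c(1)] by simp
    then show "?g (x \<oplus>\<^bsub>Q\<^esub> y) = ?g x \<oplus>\<^bsub>W\<^esub> ?g y"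
      using xy g linear_map_add[OF f] by (metis V.a_closed)
  next
    fix a x assume a: "a \<in> carrier R" and "x \<in> carrier Q"
    then obtain x' where xy: "x' \<in> carrier V" "x = c x'"
      using c(2) by (metis imageE)
    then have "a \<odot>\<^bsub>Q\<^esub> x = c (a \<odot>\<^bsub>V\<^esub> x')" using linear_map_smult[OF c(1)] a by simp
    then show "?g (a \<odot>\<^bsub>Q\<^esub> x) = a \<odot>\<^bsub>W\<^esub> ?g x"
      using xy g linear_map_smult[OF f] a by (metis V.smult_closed)
  qed
  then show thesis using g that by blast
qed

text \<open>The module axioms pass to the target of a surjection that preserves the operations.\<close>

lemma module_image:
  assumes V: "module R V"
    and c: "c \<in> linear_maps R V W" "c ` carrier V = carrier W" "c \<zero>\<^bsub>V\<^esub> = \<zero>\<^bsub>W\<^esub>"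
  shows "module R W"
proof -
  interpret V: module R V by fact
  have add: "c x \<oplus>\<^bsub>W\<^esub> c y = c (x \<oplus>\<^bsub>V\<^esub> y)" if "x \<in> carrier V" "y \<in> carrier V" for x y
    using linear_map_add[OF c(1)] that by simp
  have sm: "a \<odot>\<^bsub>W\<^esub> c x = c (a \<odot>\<^bsub>V\<^esub> x)" if "a \<in> carrier R" "x \<in> carrier V" for a x
    using linear_map_smult[OF c(1)] that by simp
  have "abelian_group W"
  proof (rule abelian_groupI, goal_cases)
    case (1 x y) then show ?case unfolding c(2)[symmetric] by (auto simp: add)
  next
    case 2 then show ?case unfolding c(2)[symmetric] using c(3) by (metis V.zero_closed imageI)
  next
    case (3 x y z) then show ?case unfolding c(2)[symmetric] by (auto simp: add V.a_assoc)
  next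
    case (4 x y) then show ?case unfolding c(2)[symmetric] by (auto simp: add V.a_comm)
  next
    case (5 x) then show ?case unfolding c(2)[symmetric] c(3)[symmetric] by (auto simp: add)
  next
    case (6 x)
    then obtain x' where x': "x' \<in> carrier V" "x = c x'" unfolding c(2)[symmetric] by auto
    then have "c (\<ominus>\<^bsub>V\<^esub> x') \<in> carrier W" "c (\<ominus>\<^bsub>V\<^esub> x') \<oplus>\<^bsub>W\<^esub> x = \<zero>\<^bsub>W\<^esub>"
      using c(2,3) by (auto simp: add V.l_neg)
    then show ?case by blast
  qed
  then show ?thesis
    by (rule moduleI[OF V.R.is_cring])
       (auto simp: c(2)[symmetric] add sm V.smult_l_distr V.smult_r_distr V.smult_assoc1)
qed

lemma kernel_submodule:
  assumes "module R V" "module R W" "f \<in> linear_maps R V W"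
  shows "submodule {x \<in> carrier V. f x = \<zero>\<^bsub>W\<^esub>} R V"
proof -
  interpret V: module R V by fact
  interpret W: module R W by fact
  show ?thesis
    by (rule V.submoduleI)
       (use assms in \<open>auto simp: linear_map_add linear_map_smult linear_map_minus linear_map_zero\<close>)
qed

lemma image_submodule:
  assumes "module R V" "module R W" "f \<in> linear_maps R V W"
  shows "submodule (f ` carrier V) R W"
proof -
  interpret V: module R V by fact
  interpret W: module R W by fact
  have zero: "\<zero>\<^bsub>W\<^esub> = f \<zero>\<^bsub>V\<^esub>" using linear_map_zero[OF assms] by simp
  show ?thesis
    by (rule W.submoduleI)
       (use linear_map_closed[OF assms(3)] in
        \<open>auto simp: linear_map_add[OF assms(3), symmetric] linear_map_smult[OF assms(3), symmetric]
           linear_map_minus[OF assms, symmetric] zero\<close>)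
qed

lemma equalizer_submodule:
  assumes "module R V" "module R W" "f \<in> linear_maps R V W" "g \<in> linear_maps R V W"
  shows "submodule {x \<in> carrier V. f x = g x} R V"
proof -
  interpret V: module R V by fact
  interpret W: module R W by fact
  show ?thesis
    by (rule V.submoduleI)
       (use assms in \<open>auto simp: linear_map_add linear_map_smult linear_map_minus linear_map_zero\<close>)
qed

lemma vimage_submodule:
  assumes "module R V" "module R W" "f \<in> linear_maps R V W" "submodule H R W"
  shows "submodule {x \<in> carrier V. f x \<in> H} R V"
proof -
  interpret V: module R V by fact
  interpret W: module R W by fact
  note H = W.submoduleE[OF assms(4)]
  have "\<zero>\<^bsub>W\<^esub> \<in> H" using submodule.axioms(1)[OF assms(4)] subgroup.one_closed by fastforce
  then show ?thesis
    by (intro V.submoduleI)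
       (use assms H in \<open>auto simp: linear_map_add linear_map_smult linear_map_minus linear_map_zero\<close>)
qed

lemma lin_span_least: "\<lbrakk>submodule H R V; S \<subseteq> H\<rbrakk> \<Longrightarrow> lin_span R V S \<subseteq> H"
  by (auto simp: lin_span_def)

lemma lin_span_superset: "S \<subseteq> lin_span R V S"
  by (auto simp: lin_span_def)

lemma lin_span_submodule:
  assumes "module R V" "S \<subseteq> carrier V"
  shows "submodule (lin_span R V S) R V"
proof -
  interpret V: module R V by fact
  have zero: "\<zero>\<^bsub>V\<^esub> \<in> H" if "submodule H R V" for H
    using submodule.axioms(1)[OF that] subgroup.one_closed by fastforce
  show ?thesis
  proof (rule V.submoduleI)
    show "lin_span R V S \<subseteq> carrier V"
      by (rule lin_span_least[OF V.carrier_is_submodule assms(2)])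
  qed (simp_all add: lin_span_def zero V.submoduleE)
qed

text \<open>The module operations on cosets enter the later arguments only through these four facts.\<close>

lemma quot_module:
  assumes V: "module R V" and H: "submodule H R V"
  shows quot_module_module: "module R (quot_module V H)"
    and quot_class_linear: "(\<lambda>x. H +>\<^bsub>V\<^esub> x) \<in> linear_maps R V (quot_module V H)"
    and quot_class_surj: "(\<lambda>x. H +>\<^bsub>V\<^esub> x) ` carrier V = carrier (quot_module V H)"
    and quot_class_zero_iff: "x \<in> carrier V \<Longrightarrow> H +>\<^bsub>V\<^esub> x = \<zero>\<^bsub>quot_module V H\<^esub> \<longleftrightarrow> x \<in> H"
proof -
  interpret V: module R V by fact
  interpret H: abelian_subgroup H V
    by (rule abelian_subgroupI3)
       (auto intro: additive_subgroupI submodule.axioms(1)[OF H] V.abelian_group_axioms)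
  let ?c = "\<lambda>x. H +>\<^bsub>V\<^esub> x" and ?Q = "quot_module V H"
  have c_eq: "?c x = ?c y" if "x \<in> carrier V" "y \<in> ?c x" for x y
    using H.a_repr_independence' that by blast
  have sm: "a \<odot>\<^bsub>?Q\<^esub> ?c x = ?c (a \<odot>\<^bsub>V\<^esub> x)" if a: "a \<in> carrier R" and x: "x \<in> carrier V" for a x
  proof -
    have "?c (a \<odot>\<^bsub>V\<^esub> y) = ?c (a \<odot>\<^bsub>V\<^esub> x)" if y: "y \<in> ?c x" for y
    proof -
      have yV: "y \<in> carrier V" using H.a_elemrcos_carrier[OF x y] .
      have "y \<oplus>\<^bsub>V\<^esub> \<ominus>\<^bsub>V\<^esub> x \<in> H" using H.a_rcos_module_imp[OF x y] .
      then have "a \<odot>\<^bsub>V\<^esub> (y \<oplus>\<^bsub>V\<^esub> \<ominus>\<^bsub>V\<^esub> x) \<in> H" using submodule.smult_closed[OF H a] by blast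
      then have "a \<odot>\<^bsub>V\<^esub> y \<oplus>\<^bsub>V\<^esub> \<ominus>\<^bsub>V\<^esub> (a \<odot>\<^bsub>V\<^esub> x) \<in> H"
        using a x yV by (simp add: V.smult_r_distr V.smult_r_minus)
      then have "a \<odot>\<^bsub>V\<^esub> y \<in> ?c (a \<odot>\<^bsub>V\<^esub> x)"
        using a x yV by (simp add: H.a_rcos_module)
      then show ?thesis using c_eq a x by (metis V.smult_closed)
    qed
    then have "(\<Union>y\<in>?c x. ?c (a \<odot>\<^bsub>V\<^esub> y)) = (\<Union>y\<in>?c x. ?c (a \<odot>\<^bsub>V\<^esub> x))"
      by (intro SUP_cong) simp_all
    moreover have "?c x \<noteq> {}" using H.a_rcos_self[OF x] by blast
    ultimately show ?thesis by (simp add: quot_module_def)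
  qed
  show lin: "?c \<in> linear_maps R V ?Q"
  proof (rule linear_mapsI)
    fix x assume "x \<in> carrier V" then show "?c x \<in> carrier ?Q"
      using V.a_rcosetsI[OF H.a_subset] by (simp add: quot_module_def)
  next
    fix x y assume "x \<in> carrier V" "y \<in> carrier V"
    then show "?c (x \<oplus>\<^bsub>V\<^esub> y) = ?c x \<oplus>\<^bsub>?Q\<^esub> ?c y"
      using H.a_rcos_sum by (simp add: quot_module_def)
  next
    fix a x assume "a \<in> carrier R" "x \<in> carrier V"
    then show "?c (a \<odot>\<^bsub>V\<^esub> x) = a \<odot>\<^bsub>?Q\<^esub> ?c x" using sm by simp
  qed
  show surj: "?c ` carrier V = carrier ?Q"
    unfolding quot_module_def A_RCOSETS_def' by auto
  have z: "\<zero>\<^bsub>?Q\<^esub> = H" by (simp add: quot_module_def)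
  have c0: "?c \<zero>\<^bsub>V\<^esub> = \<zero>\<^bsub>?Q\<^esub>" unfolding z using H.a_rcos_const by simp
  show "module R ?Q" by (rule module_image[OF V lin surj c0])
  show "?c x = \<zero>\<^bsub>?Q\<^esub> \<longleftrightarrow> x \<in> H" if "x \<in> carrier V"
    unfolding z using that H.a_rcos_const H.a_rcos_self by metis
qed

section \<open>Free modules and exterior powers\<close>

lemma free_module_module:
  assumes "field R"
  shows "module R (free_module R S)"
proof -
  interpret R: field R by fact
  have fin: "finite {x. f x \<oplus>\<^bsub>R\<^esub> g x \<noteq> \<zero>\<^bsub>R\<^esub>}"
    if "finite {x. f x \<noteq> \<zero>\<^bsub>R\<^esub>}" "finite {x. g x \<noteq> \<zero>\<^bsub>R\<^esub>}" for f g
    by (rule finite_subset[OF _ finite_UnI[OF that]]) auto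
  have fin2: "finite {x. a \<otimes>\<^bsub>R\<^esub> f x \<noteq> \<zero>\<^bsub>R\<^esub>}"
    if "finite {x. f x \<noteq> \<zero>\<^bsub>R\<^esub>}" "a \<in> carrier R" for f a
    by (rule finite_subset[OF _ that(1)]) (use that(2) in auto)
  have fin3: "finite {x. \<ominus>\<^bsub>R\<^esub> f x \<noteq> \<zero>\<^bsub>R\<^esub>}"
    if "finite {x. f x \<noteq> \<zero>\<^bsub>R\<^esub>}" for f
    by (rule finite_subset[OF _ that(1)]) (auto)
  have "abelian_group (free_module R S)"
  proof (rule abelian_groupI, goal_cases)
    case (1 x y) then show ?case by (simp add: free_module_def fin)
  next
    case 2 then show ?case by (simp add: free_module_def)
  next
    case (3 x y z) then show ?case by (simp add: free_module_def R.a_assoc)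
  next
    case (4 x y) then show ?case by (simp add: free_module_def R.a_comm)
  next
    case (5 x) then show ?case by (simp add: free_module_def)
  next
    case (6 x)
    then show ?case
      by (intro bexI[of _ "\<lambda>s. \<ominus>\<^bsub>R\<^esub> x s"])
         (auto simp: free_module_def fin3 R.l_neg)
  qed
  then show ?thesis
    by (rule moduleI[OF R.is_cring])
       (auto simp: free_module_def fin2 R.l_distr R.r_distr R.m_assoc)
qed

lemma single_in_free_module:
  assumes "field R" "x \<in> S" shows "single R x \<in> carrier (free_module R S)"
proof -
  interpret R: field R by fact
  show ?thesis using assms(2)
    by (auto simp: free_module_def single_def)
qed

lemma free_module_span:
  assumes R: "field R" and H: "submodule H R (free_module R S)"
    and single: "\<And>x. x \<in> S \<Longrightarrow> single R x \<in> H"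
  shows "carrier (free_module R S) \<subseteq> H"
proof
  interpret R: field R by fact
  let ?F = "free_module R S"
  interpret F: module R ?F by (rule free_module_module[OF R])
  fix f assume "f \<in> carrier ?F"
  then show "f \<in> H"
  proof (induction "card {x. f x \<noteq> \<zero>\<^bsub>R\<^esub>}" arbitrary: f)
    case 0
    then have "f = \<zero>\<^bsub>?F\<^esub>" by (auto simp: free_module_def)
    then show ?case using F.submoduleE[OF H] F.submoduleE(2)[OF H]
      by (metis H subgroup.one_closed submodule.axioms(1) monoid.select_convs(2))
  next
    case (Suc n)
    have finf: "finite {x. f x \<noteq> \<zero>\<^bsub>R\<^esub>}" using Suc(3) by (simp add: free_module_def)
    obtain x where x: "f x \<noteq> \<zero>\<^bsub>R\<^esub>"
      using Suc(2) by (metis (mono_tags, lifting) Collect_empty_eq card.empty nat.distinct(1))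
    let ?g = "f(x := \<zero>\<^bsub>R\<^esub>)"
    have sup: "{y. ?g y \<noteq> \<zero>\<^bsub>R\<^esub>} = {y. f y \<noteq> \<zero>\<^bsub>R\<^esub>} - {x}" by auto
    have xS: "x \<in> S" and fx: "f x \<in> carrier R" using x Suc(3) by (auto simp: free_module_def)
    have "?g \<in> H"
    proof (rule Suc(1))
      show "n = card {y. ?g y \<noteq> \<zero>\<^bsub>R\<^esub>}" unfolding sup using Suc(2) finf x by simp
      show "?g \<in> carrier ?F" using Suc(3) finf sup by (auto simp: free_module_def)
    qed
    moreover have "f x \<odot>\<^bsub>?F\<^esub> single R x \<in> H"
      using single[OF xS] F.submoduleE(4)[OF H fx] by blast
    moreover have "f = ?g \<oplus>\<^bsub>?F\<^esub> f x \<odot>\<^bsub>?F\<^esub> single R x"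
      using Suc(3) by (auto simp: free_module_def single_def fun_eq_iff)
    ultimately show ?case using F.submoduleE(5)[OF H] by metis
  qed
qed

lemma free_module_lift:
  assumes R: "field R" and W: "module R W" and \<phi>: "\<And>x. x \<in> S \<Longrightarrow> \<phi> x \<in> carrier W"
  obtains g where "g \<in> linear_maps R (free_module R S) W" "\<And>x. x \<in> S \<Longrightarrow> g (single R x) = \<phi> x"
proof -
  interpret R: field R by fact
  interpret W: module R W by fact
  let ?F = "free_module R S"
  let ?s = "\<lambda>f. {x. f x \<noteq> \<zero>\<^bsub>R\<^esub>}"
  let ?g = "\<lambda>f. finsum W (\<lambda>x. f x \<odot>\<^bsub>W\<^esub> \<phi> x) (?s f)"
  interpret F: module R ?F by (rule free_module_module[OF R])
  have fin: "finite (?s f)" and car: "\<And>x. f x \<in> carrier R" and sub: "?s f \<subseteq> S"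
    if "f \<in> carrier ?F" for f
    using that by (auto simp: free_module_def)
  \<comment> \<open>Enlarging the summation range to a common finite set is what makes additivity visible.\<close>
  have big: "?g f = finsum W (\<lambda>x. f x \<odot>\<^bsub>W\<^esub> \<phi> x) T"
    if "f \<in> carrier ?F" "finite T" "?s f \<subseteq> T" "T \<subseteq> S" for f T
    by (rule W.add.finprod_mono_neutral_cong_left)
       (use that car[OF that(1)] \<phi> in \<open>auto simp: subset_iff\<close>)
  have "?g \<in> linear_maps R ?F W"
  proof (rule linear_mapsI)
    fix f assume f: "f \<in> carrier ?F"
    show "?g f \<in> carrier W"
      by (rule W.finsum_closed) (use car[OF f] sub[OF f] \<phi> in \<open>auto simp: subset_iff\<close>)
  next
    fix f h assume f: "f \<in> carrier ?F" and h: "h \<in> carrier ?F"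
    let ?T = "?s f \<union> ?s h"
    have T: "finite ?T" "?T \<subseteq> S" using fin sub f h by auto
    have st: "?s (f \<oplus>\<^bsub>?F\<^esub> h) \<subseteq> ?T" by (auto simp: free_module_def)
    have "?g (f \<oplus>\<^bsub>?F\<^esub> h) = finsum W (\<lambda>x. (f \<oplus>\<^bsub>?F\<^esub> h) x \<odot>\<^bsub>W\<^esub> \<phi> x) ?T"
      by (rule big) (use f h T st in auto)
    also have "\<dots> = finsum W (\<lambda>x. f x \<odot>\<^bsub>W\<^esub> \<phi> x \<oplus>\<^bsub>W\<^esub> h x \<odot>\<^bsub>W\<^esub> \<phi> x) ?T"
      by (rule W.finsum_cong')
         (use T(2) car[OF f] car[OF h] \<phi> in
           \<open>auto simp: free_module_simps subset_iff W.smult_l_distr\<close>)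
    also have "\<dots> = finsum W (\<lambda>x. f x \<odot>\<^bsub>W\<^esub> \<phi> x) ?T \<oplus>\<^bsub>W\<^esub> finsum W (\<lambda>x. h x \<odot>\<^bsub>W\<^esub> \<phi> x) ?T"
      by (rule W.finsum_addf) (use T(2) car[OF f] car[OF h] \<phi> in \<open>auto simp: subset_iff\<close>)
    also have "\<dots> = ?g f \<oplus>\<^bsub>W\<^esub> ?g h"
      using big[OF f T(1)] big[OF h T(1)] T(2) by auto
    finally show "?g (f \<oplus>\<^bsub>?F\<^esub> h) = ?g f \<oplus>\<^bsub>W\<^esub> ?g h" .
  next
    fix a f assume a: "a \<in> carrier R" and f: "f \<in> carrier ?F"
    have st: "?s (a \<odot>\<^bsub>?F\<^esub> f) \<subseteq> ?s f" using a by (auto simp: free_module_def)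
    have "?g (a \<odot>\<^bsub>?F\<^esub> f) = finsum W (\<lambda>x. (a \<odot>\<^bsub>?F\<^esub> f) x \<odot>\<^bsub>W\<^esub> \<phi> x) (?s f)"
      by (rule big) (use f a fin[OF f] sub[OF f] st in auto)
    also have "\<dots> = finsum W (\<lambda>x. a \<odot>\<^bsub>W\<^esub> (f x \<odot>\<^bsub>W\<^esub> \<phi> x)) (?s f)"
      by (rule W.finsum_cong')
         (use sub[OF f] car[OF f] \<phi> a in
           \<open>auto simp: free_module_simps subset_iff W.smult_assoc1\<close>)
    also have "\<dots> = a \<odot>\<^bsub>W\<^esub> ?g f"
      by (rule W.finsum_smult_ldistr[symmetric])
         (use sub[OF f] car[OF f] \<phi> a fin[OF f] in \<open>auto simp: subset_iff\<close>)
    finally show "?g (a \<odot>\<^bsub>?F\<^esub> f) = a \<odot>\<^bsub>W\<^esub> ?g f" .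
  qed
  moreover have "?g (single R x) = \<phi> x" if x: "x \<in> S" for x
  proof -
    have s: "?s (single R x) = {x}" by (auto simp: single_def)
    have "finsum W (\<lambda>y. single R x y \<odot>\<^bsub>W\<^esub> \<phi> y) {x} = single R x x \<odot>\<^bsub>W\<^esub> \<phi> x"
      using \<phi>[OF x] by (subst W.finsum_insert) (auto simp: single_def)
    then show ?thesis unfolding s using \<phi>[OF x] by (simp add: single_def)
  qed
  ultimately show thesis using that by blast
qed

lemma words_update: "\<lbrakk>xs \<in> words V n; x \<in> carrier V\<rbrakk> \<Longrightarrow> xs[i := x] \<in> words V n"
  using set_update_subset_insert[of xs i x] by (auto simp: words_def)

lemma words_swap:
  assumes "xs \<in> words V n" "i < n" "j < n"
  shows "xs[i := xs ! j, j := xs ! i] \<in> words V n"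
proof -
  have "xs ! i \<in> carrier V" "xs ! j \<in> carrier V" using assms by (auto simp: words_def)
  then show ?thesis using assms by (simp add: words_update)
qed

lemma free_words_module: "field R \<Longrightarrow> module R (free_words R V n)"
  unfolding free_words_def by (rule free_module_module)

lemma single_in_free_words:
  "\<lbrakk>field R; xs \<in> words V n\<rbrakk> \<Longrightarrow> single R xs \<in> carrier (free_words R V n)"
  unfolding free_words_def by (rule single_in_free_module)

lemma ext_relators_closed:
  assumes R: "field R" and V: "module R V"
  shows "ext_relators R V n \<subseteq> carrier (free_words R V n)"
proof -
  interpret V: module R V by fact
  interpret F: module R "free_words R V n" by (rule free_words_module[OF R])
  note [simp] = single_in_free_words[OF R] words_update words_swap
  show ?thesis unfolding ext_relators_def Let_def by auto
qed

lemma ext_kernel_submodule: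
  assumes "field R" "module R V"
  shows "submodule (ext_kernel R V n) R (free_words R V n)"
  unfolding ext_kernel_def
  by (rule lin_span_submodule[OF free_words_module[OF assms(1)] ext_relators_closed[OF assms]])

lemma ext_power_module: "\<lbrakk>field R; module R V\<rbrakk> \<Longrightarrow> module R (ext_power R V n)"
  unfolding ext_power_def
  by (rule quot_module_module[OF free_words_module ext_kernel_submodule])

lemma ext_class_linear:
  assumes "field R" "module R V"
  shows "(\<lambda>f. ext_kernel R V n +>\<^bsub>free_words R V n\<^esub> f)
           \<in> linear_maps R (free_words R V n) (ext_power R V n)"
  unfolding ext_power_def
  by (rule quot_class_linear[OF free_words_module[OF assms(1)] ext_kernel_submodule[OF assms]])

lemma ext_class_surj:
  assumes "field R" "module R V"
  shows "(\<lambda>f. ext_kernel R V n +>\<^bsub>free_words R V n\<^esub> f) ` carrier (free_words R V n)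
           = carrier (ext_power R V n)"
  unfolding ext_power_def
  by (rule quot_class_surj[OF free_words_module[OF assms(1)] ext_kernel_submodule[OF assms]])

lemma ext_class_zero_iff:
  assumes "field R" "module R V" "f \<in> carrier (free_words R V n)"
  shows "ext_kernel R V n +>\<^bsub>free_words R V n\<^esub> f = \<zero>\<^bsub>ext_power R V n\<^esub> \<longleftrightarrow> f \<in> ext_kernel R V n"
  unfolding ext_power_def
  by (rule quot_class_zero_iff[OF free_words_module[OF assms(1)] ext_kernel_submodule[OF assms(1,2)]
        assms(3)])

lemma ext_class_relator:
  assumes "field R" "module R V" "f \<in> ext_relators R V n"
  shows "ext_kernel R V n +>\<^bsub>free_words R V n\<^esub> f = \<zero>\<^bsub>ext_power R V n\<^esub>"
proof -
  have "f \<in> carrier (free_words R V n)" using ext_relators_closed[OF assms(1,2)] assms(3) by blast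
  moreover have "f \<in> ext_kernel R V n"
    unfolding ext_kernel_def by (rule subsetD[OF lin_span_superset assms(3)])
  ultimately show ?thesis using ext_class_zero_iff[OF assms(1,2)] by blast
qed

lemma wedge_eq_class:
  "xs \<in> words V n \<Longrightarrow> wedge R V xs = ext_kernel R V n +>\<^bsub>free_words R V n\<^esub> single R xs"
  by (simp add: wedge_def words_def)

lemma wedge_closed:
  assumes "field R" "module R V" "xs \<in> words V n"
  shows "wedge R V xs \<in> carrier (ext_power R V n)"
  unfolding wedge_eq_class[OF assms(3)]
  by (rule linear_map_closed[OF ext_class_linear single_in_free_words]) (use assms in auto)

lemma wedge_update_add:
  assumes R: "field R" and V: "module R V"
    and xs: "xs \<in> words V n" "i < n" and x: "x \<in> carrier V" and y: "y \<in> carrier V"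
  shows "wedge R V (xs[i := x \<oplus>\<^bsub>V\<^esub> y])
    = wedge R V (xs[i := x]) \<oplus>\<^bsub>ext_power R V n\<^esub> wedge R V (xs[i := y])"
proof -
  interpret V: module R V by fact
  let ?F = "free_words R V n" and ?E = "ext_power R V n"
  interpret F: module R ?F by (rule free_words_module[OF R])
  interpret E: module R ?E by (rule ext_power_module[OF R V])
  note cl = ext_class_linear[OF R V, of n]
  note w = words_update[OF xs(1) V.a_closed[OF x y]] words_update[OF xs(1) x] words_update[OF xs(1) y]
  note s = w[THEN single_in_free_words[OF R]]
  have "single R (xs[i := x \<oplus>\<^bsub>V\<^esub> y]) \<ominus>\<^bsub>?F\<^esub> (single R (xs[i := x]) \<oplus>\<^bsub>?F\<^esub> single R (xs[i := y]))
     \<in> ext_relators R V n"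
    unfolding ext_relators_def Let_def using xs x y by blast
  from ext_class_relator[OF R V this] show ?thesis
    using s by (simp add: linear_map_diff[OF F.module_axioms E.module_axioms cl] linear_map_add[OF cl]
        E.diff_zero_iff linear_map_closed[OF cl] w[THEN wedge_eq_class])
qed

lemma wedge_update_smult:
  assumes R: "field R" and V: "module R V"
    and xs: "xs \<in> words V n" "i < n" and a: "a \<in> carrier R" and x: "x \<in> carrier V"
  shows "wedge R V (xs[i := a \<odot>\<^bsub>V\<^esub> x]) = a \<odot>\<^bsub>ext_power R V n\<^esub> wedge R V (xs[i := x])"
proof -
  interpret V: module R V by fact
  let ?F = "free_words R V n" and ?E = "ext_power R V n"
  interpret F: module R ?F by (rule free_words_module[OF R])
  interpret E: module R ?E by (rule ext_power_module[OF R V])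
  note cl = ext_class_linear[OF R V, of n]
  note w = words_update[OF xs(1) V.smult_closed[OF a x]] words_update[OF xs(1) x]
  note s = w[THEN single_in_free_words[OF R]]
  have "single R (xs[i := a \<odot>\<^bsub>V\<^esub> x]) \<ominus>\<^bsub>?F\<^esub> a \<odot>\<^bsub>?F\<^esub> single R (xs[i := x]) \<in> ext_relators R V n"
    unfolding ext_relators_def Let_def using xs x a by blast
  from ext_class_relator[OF R V this] show ?thesis
    using s a by (simp add: linear_map_diff[OF F.module_axioms E.module_axioms cl]
        linear_map_smult[OF cl] E.diff_zero_iff linear_map_closed[OF cl] w[THEN wedge_eq_class])
qed

lemma wedge_swap:
  assumes R: "field R" and V: "module R V"
    and xs: "xs \<in> words V n" "i < j" "j < n"
  shows "wedge R V xs \<oplus>\<^bsub>ext_power R V n\<^esub> wedge R V (xs[i := xs ! j, j := xs ! i])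
    = \<zero>\<^bsub>ext_power R V n\<^esub>"
proof -
  let ?F = "free_words R V n"
  note cl = ext_class_linear[OF R V, of n]
  have w: "xs[i := xs ! j, j := xs ! i] \<in> words V n" by (rule words_swap) (use xs in auto)
  have "single R xs \<oplus>\<^bsub>?F\<^esub> single R (xs[i := xs ! j, j := xs ! i]) \<in> ext_relators R V n"
    unfolding ext_relators_def Let_def using xs by blast
  from ext_class_relator[OF R V this] show ?thesis
    by (simp add: linear_map_add[OF cl] wedge_eq_class[OF xs(1)] wedge_eq_class[OF w]
        single_in_free_words[OF R xs(1)] single_in_free_words[OF R w])
qed

lemma ext_power_span:
  assumes R: "field R" and V: "module R V" and H: "submodule H R (ext_power R V n)"
    and wedge: "\<And>xs. xs \<in> words V n \<Longrightarrow> wedge R V xs \<in> H"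
  shows "carrier (ext_power R V n) \<subseteq> H"
proof -
  let ?F = "free_words R V n" and ?E = "ext_power R V n"
  let ?c = "\<lambda>f. ext_kernel R V n +>\<^bsub>?F\<^esub> f"
  have "submodule {f \<in> carrier ?F. ?c f \<in> H} R ?F"
    by (rule vimage_submodule[OF free_words_module[OF R] ext_power_module[OF R V]
          ext_class_linear[OF R V] H])
  then have "carrier ?F \<subseteq> {f \<in> carrier ?F. ?c f \<in> H}"
    unfolding free_words_def
    by (rule free_module_span[OF R])
       (use wedge single_in_free_words[OF R] in
         \<open>auto simp: wedge_eq_class free_words_def[symmetric]\<close>)
  then show ?thesis unfolding ext_class_surj[OF R V, of n, symmetric] by blast
qed

lemma ext_power_maps_eq:
  assumes R: "field R" and V: "module R V" and W: "module R W"
    and f: "f \<in> linear_maps R (ext_power R V n) W" and g: "g \<in> linear_maps R (ext_power R V n) W"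
    and eq: "\<And>xs. xs \<in> words V n \<Longrightarrow> f (wedge R V xs) = g (wedge R V xs)"
    and z: "z \<in> carrier (ext_power R V n)"
  shows "f z = g z"
  using ext_power_span[OF R V equalizer_submodule[OF ext_power_module[OF R V] W f g]]
    eq wedge_closed[OF R V] z by blast

text \<open>The universal property of \<open>\<Lambda>\<^sup>n V\<close>.\<close>

lemma ext_power_lift:
  assumes R: "field R" and V: "module R V" and W: "module R W"
    and \<phi>: "\<And>xs. xs \<in> words V n \<Longrightarrow> \<phi> xs \<in> carrier W"
    and add: "\<And>xs i x y. \<lbrakk>xs \<in> words V n; i < n; x \<in> carrier V; y \<in> carrier V\<rbrakk> \<Longrightarrow>
      \<phi> (xs[i := x \<oplus>\<^bsub>V\<^esub> y]) = \<phi> (xs[i := x]) \<oplus>\<^bsub>W\<^esub> \<phi> (xs[i := y])"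
    and smult: "\<And>xs i a x. \<lbrakk>xs \<in> words V n; i < n; a \<in> carrier R; x \<in> carrier V\<rbrakk> \<Longrightarrow>
      \<phi> (xs[i := a \<odot>\<^bsub>V\<^esub> x]) = a \<odot>\<^bsub>W\<^esub> \<phi> (xs[i := x])"
    and swap: "\<And>xs i j. \<lbrakk>xs \<in> words V n; i < j; j < n\<rbrakk> \<Longrightarrow>
      \<phi> xs \<oplus>\<^bsub>W\<^esub> \<phi> (xs[i := xs ! j, j := xs ! i]) = \<zero>\<^bsub>W\<^esub>"
  obtains f where "f \<in> linear_maps R (ext_power R V n) W"
    "\<And>xs. xs \<in> words V n \<Longrightarrow> f (wedge R V xs) = \<phi> xs"
proof -
  let ?F = "free_words R V n" and ?E = "ext_power R V n"
  let ?c = "\<lambda>f. ext_kernel R V n +>\<^bsub>?F\<^esub> f"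
  interpret V: module R V by fact
  interpret W: module R W by fact
  interpret F: module R ?F by (rule free_words_module[OF R])
  obtain g where g: "g \<in> linear_maps R ?F W" "\<And>xs. xs \<in> words V n \<Longrightarrow> g (single R xs) = \<phi> xs"
    using free_module_lift[of R W "words V n" \<phi>, OF R W \<phi>] unfolding free_words_def by blast
  note [simp] = single_in_free_words[OF R] words_update words_swap g(2) \<phi>
    linear_map_diff[OF F.module_axioms W g(1)] linear_map_add[OF g(1)] linear_map_smult[OF g(1)]
  have "ext_relators R V n \<subseteq> {f \<in> carrier ?F. g f = \<zero>\<^bsub>W\<^esub>}"
    unfolding ext_relators_def Let_def
    by (auto simp: add smult swap W.diff_zero_iff)
  then have ker: "ext_kernel R V n \<subseteq> {f \<in> carrier ?F. g f = \<zero>\<^bsub>W\<^esub>}"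
    unfolding ext_kernel_def
    by (rule lin_span_least[OF kernel_submodule[OF F.module_axioms W g(1)]])
  have ker': "g f = \<zero>\<^bsub>W\<^esub>" if "f \<in> carrier ?F" "?c f = \<zero>\<^bsub>?E\<^esub>" for f
    using that ext_class_zero_iff[OF R V that(1)] ker by auto
  obtain h where h: "h \<in> linear_maps R ?E W" "\<And>f. f \<in> carrier ?F \<Longrightarrow> h (?c f) = g f"
    using linear_map_factor[OF F.module_axioms W ext_power_module[OF R V]
        ext_class_linear[OF R V] ext_class_surj[OF R V] g(1) ker'] by blast
  then have "h (wedge R V xs) = \<phi> xs" if "xs \<in> words V n" for xs
    using that by (simp add: wedge_eq_class)
  with h(1) show thesis using that by blast
qed

section \<open>Exterior powers of low degree\<close>

lemma words_1: "xs \<in> words V (Suc 0) \<longleftrightarrow> (\<exists>x\<in>carrier V. xs = [x])"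
  by (auto simp: words_def length_Suc_conv)

lemma words_2: "xs \<in> words V 2 \<longleftrightarrow> (\<exists>x\<in>carrier V. \<exists>y\<in>carrier V. xs = [x, y])"
  by (auto simp: words_def length_Suc_conv numeral_2_eq_2)

lemma words_3:
  "xs \<in> words V 3 \<longleftrightarrow> (\<exists>x\<in>carrier V. \<exists>y\<in>carrier V. \<exists>z\<in>carrier V. xs = [x, y, z])"
  by (auto simp: words_def length_Suc_conv numeral_3_eq_3)

lemma less_2_cases: "i < (2::nat) \<longleftrightarrow> i = 0 \<or> i = 1"
  by auto

lemma less_3_cases: "i < (3::nat) \<longleftrightarrow> i = 0 \<or> i = 1 \<or> i = 2"
  by auto

text \<open>The exterior square of \<open>V\<close> as the target of the universal skew bilinear map.\<close>

locale ext_square = field R + module R V for R :: "'k ring" and V :: "('k, 'a, 'c) module_scheme"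
begin

abbreviation "E2 \<equiv> ext_power R V 2"
abbreviation "w2 x y \<equiv> wedge R V [x, y]"

lemma R_field: "field R" ..

lemma V_module: "module R V" ..

lemma E2_module: "module R E2"
  by (rule ext_power_module[OF R_field V_module])

lemma w2_closed [simp]: "\<lbrakk>x \<in> carrier V; y \<in> carrier V\<rbrakk> \<Longrightarrow> w2 x y \<in> carrier E2"
  by (rule wedge_closed[OF R_field V_module]) (auto simp: words_2)

lemma w2_add_left:
  "\<lbrakk>x \<in> carrier V; x' \<in> carrier V; y \<in> carrier V\<rbrakk> \<Longrightarrow>
     w2 (x \<oplus>\<^bsub>V\<^esub> x') y = w2 x y \<oplus>\<^bsub>E2\<^esub> w2 x' y"
  using wedge_update_add[OF R_field V_module, of "[x, y]" 2 0 x x'] by (auto simp: words_2)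

lemma w2_add_right:
  "\<lbrakk>x \<in> carrier V; y \<in> carrier V; y' \<in> carrier V\<rbrakk> \<Longrightarrow>
     w2 x (y \<oplus>\<^bsub>V\<^esub> y') = w2 x y \<oplus>\<^bsub>E2\<^esub> w2 x y'"
  using wedge_update_add[OF R_field V_module, of "[x, y]" 2 1 y y'] by (auto simp: words_2)

lemma w2_smult_left:
  "\<lbrakk>a \<in> carrier R; x \<in> carrier V; y \<in> carrier V\<rbrakk> \<Longrightarrow> w2 (a \<odot>\<^bsub>V\<^esub> x) y = a \<odot>\<^bsub>E2\<^esub> w2 x y"
  using wedge_update_smult[OF R_field V_module, of "[x, y]" 2 0 a x] by (auto simp: words_2)

lemma w2_smult_right:
  "\<lbrakk>a \<in> carrier R; x \<in> carrier V; y \<in> carrier V\<rbrakk> \<Longrightarrow> w2 x (a \<odot>\<^bsub>V\<^esub> y) = a \<odot>\<^bsub>E2\<^esub> w2 x y"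
  using wedge_update_smult[OF R_field V_module, of "[x, y]" 2 1 a y] by (auto simp: words_2)

lemma w2_skew:
  assumes "x \<in> carrier V" "y \<in> carrier V"
  shows "w2 x y = \<ominus>\<^bsub>E2\<^esub> w2 y x"
proof -
  interpret E: module R E2 by (rule E2_module)
  show ?thesis
    using wedge_swap[OF R_field V_module, of "[x, y]" 2 0 1] assms
    by (simp add: words_2 E.minus_equality)
qed

lemma w2_zero_left [simp]: "x \<in> carrier V \<Longrightarrow> w2 \<zero>\<^bsub>V\<^esub> x = \<zero>\<^bsub>E2\<^esub>"
  using w2_smult_left[of "\<zero>\<^bsub>R\<^esub>" "\<zero>\<^bsub>V\<^esub>" x] E2_module
  by (simp add: module.smult_l_null)

lemma w2_zero_right [simp]: "x \<in> carrier V \<Longrightarrow> w2 x \<zero>\<^bsub>V\<^esub> = \<zero>\<^bsub>E2\<^esub>"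
  using w2_smult_right[of "\<zero>\<^bsub>R\<^esub>" x "\<zero>\<^bsub>V\<^esub>"] E2_module
  by (simp add: module.smult_l_null)

lemma E2_span:
  assumes "submodule H R E2" "\<And>x y. \<lbrakk>x \<in> carrier V; y \<in> carrier V\<rbrakk> \<Longrightarrow> w2 x y \<in> H"
  shows "carrier E2 \<subseteq> H"
  by (rule ext_power_span[OF R_field V_module assms(1)]) (auto simp: words_2 assms(2))

lemma E2_maps_eq:
  assumes "module R W" "f \<in> linear_maps R E2 W" "g \<in> linear_maps R E2 W"
    "\<And>x y. \<lbrakk>x \<in> carrier V; y \<in> carrier V\<rbrakk> \<Longrightarrow> f (w2 x y) = g (w2 x y)"
    "z \<in> carrier E2"
  shows "f z = g z"
  by (rule ext_power_maps_eq[OF R_field V_module assms(1-3) _ assms(5)])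
     (auto simp: words_2 assms(4))

text \<open>Bilinearity in the second argument follows from bilinearity in the first by skew-symmetry.\<close>

lemma E2_lift:
  assumes W: "module R W"
    and \<phi>: "\<And>x y. \<lbrakk>x \<in> carrier V; y \<in> carrier V\<rbrakk> \<Longrightarrow> \<phi> x y \<in> carrier W"
    and add: "\<And>x x' y. \<lbrakk>x \<in> carrier V; x' \<in> carrier V; y \<in> carrier V\<rbrakk> \<Longrightarrow>
      \<phi> (x \<oplus>\<^bsub>V\<^esub> x') y = \<phi> x y \<oplus>\<^bsub>W\<^esub> \<phi> x' y"
    and smult: "\<And>a x y. \<lbrakk>a \<in> carrier R; x \<in> carrier V; y \<in> carrier V\<rbrakk> \<Longrightarrow>
      \<phi> (a \<odot>\<^bsub>V\<^esub> x) y = a \<odot>\<^bsub>W\<^esub> \<phi> x y"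
    and skew: "\<And>x y. \<lbrakk>x \<in> carrier V; y \<in> carrier V\<rbrakk> \<Longrightarrow> \<phi> x y = \<ominus>\<^bsub>W\<^esub> \<phi> y x"
  obtains f where "f \<in> linear_maps R E2 W"
    "\<And>x y. \<lbrakk>x \<in> carrier V; y \<in> carrier V\<rbrakk> \<Longrightarrow> f (w2 x y) = \<phi> x y"
proof -
  interpret W: module R W by fact
  have add2: "\<phi> x (y \<oplus>\<^bsub>V\<^esub> y') = \<phi> x y \<oplus>\<^bsub>W\<^esub> \<phi> x y'"
    if "x \<in> carrier V" "y \<in> carrier V" "y' \<in> carrier V" for x y y'
    using that by (simp add: skew[of x] add \<phi> W.minus_add)
  have smult2: "\<phi> x (a \<odot>\<^bsub>V\<^esub> y) = a \<odot>\<^bsub>W\<^esub> \<phi> x y"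
    if "a \<in> carrier R" "x \<in> carrier V" "y \<in> carrier V" for a x y
    using that by (simp add: skew[of x] smult \<phi> W.smult_r_minus)
  have sk0: "\<phi> x y \<oplus>\<^bsub>W\<^esub> \<phi> y x = \<zero>\<^bsub>W\<^esub>" if "x \<in> carrier V" "y \<in> carrier V" for x y
    using that skew[of x y] \<phi> by (simp add: W.l_neg)
  obtain f where f: "f \<in> linear_maps R E2 W"
    "\<And>xs. xs \<in> words V 2 \<Longrightarrow> f (wedge R V xs) = \<phi> (xs ! 0) (xs ! 1)"
  proof (rule ext_power_lift[OF R_field V_module W])
    fix xs i j assume "xs \<in> words V 2" "i < j" "j < (2::nat)"
    then show "\<phi> (xs ! 0) (xs ! 1) \<oplus>\<^bsub>W\<^esub> \<phi> (xs[i := xs ! j, j := xs ! i] ! 0)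
      (xs[i := xs ! j, j := xs ! i] ! 1) = \<zero>\<^bsub>W\<^esub>"
      by (auto simp: words_2 less_2_cases sk0)
  qed (auto simp: words_2 less_2_cases \<phi> add smult add2 smult2)
  show thesis by (rule that[OF f(1)]) (auto simp: f(2) words_2)
qed

text \<open>As \<open>a (x \<and> y) = (a x) \<and> y\<close>, every element of \<open>\<Lambda>\<^sup>2 V\<close> is a sum of wedges without coefficients.\<close>

lemma E2_sum_of_wedges:
  assumes "z \<in> carrier E2"
  obtains ps where "set ps \<subseteq> carrier V \<times> carrier V"
    "z = foldr (\<lambda>p s. w2 (fst p) (snd p) \<oplus>\<^bsub>E2\<^esub> s) ps \<zero>\<^bsub>E2\<^esub>"
proof -
  interpret E: module R E2 by (rule E2_module)
  let ?s = "\<lambda>ps. foldr (\<lambda>p s. w2 (fst p) (snd p) \<oplus>\<^bsub>E2\<^esub> s) ps \<zero>\<^bsub>E2\<^esub>"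
  let ?H = "?s ` {ps. set ps \<subseteq> carrier V \<times> carrier V}"
  have cl: "?s ps \<in> carrier E2" if "set ps \<subseteq> carrier V \<times> carrier V" for ps
    using that by (induction ps) auto
  have app: "?s (ps @ qs) = ?s ps \<oplus>\<^bsub>E2\<^esub> ?s qs"
    if "set ps \<subseteq> carrier V \<times> carrier V" "set qs \<subseteq> carrier V \<times> carrier V" for ps qs
    using that by (induction ps) (auto simp: cl E.a_assoc)
  have sm: "a \<odot>\<^bsub>E2\<^esub> ?s ps = ?s (map (\<lambda>(x, y). (a \<odot>\<^bsub>V\<^esub> x, y)) ps)"
    if "set ps \<subseteq> carrier V \<times> carrier V" "a \<in> carrier R" for a ps
    using that by (induction ps) (auto simp: cl E.smult_r_distr w2_smult_left)
  have smH: "a \<odot>\<^bsub>E2\<^esub> h \<in> ?H" if "a \<in> carrier R" "h \<in> ?H" for a h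
  proof -
    obtain ps where ps: "h = ?s ps" "set ps \<subseteq> carrier V \<times> carrier V" using \<open>h \<in> ?H\<close> by blast
    then show ?thesis
      by (intro image_eqI[of _ _ "map (\<lambda>(x, y). (a \<odot>\<^bsub>V\<^esub> x, y)) ps"])
         (use sm that(1) in auto)
  qed
  have "submodule ?H R E2"
  proof (rule E.submoduleI)
    show "?H \<subseteq> carrier E2" using cl by blast
    show "\<zero>\<^bsub>E2\<^esub> \<in> ?H" by (rule image_eqI[of _ _ "[]"]) auto
    show "a \<oplus>\<^bsub>E2\<^esub> b \<in> ?H" if ab: "a \<in> ?H" "b \<in> ?H" for a b
    proof -
      obtain ps qs where "a = ?s ps" "b = ?s qs" "set ps \<subseteq> carrier V \<times> carrier V"
        "set qs \<subseteq> carrier V \<times> carrier V" using ab by blast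
      then show ?thesis by (intro image_eqI[of _ _ "ps @ qs"]) (simp_all add: app del: foldr_append)
    qed
    show "\<ominus>\<^bsub>E2\<^esub> a \<in> ?H" if a: "a \<in> ?H" for a
    proof -
      have "a \<in> carrier E2" using a cl by blast
      then have "(\<ominus>\<^bsub>R\<^esub> \<one>\<^bsub>R\<^esub>) \<odot>\<^bsub>E2\<^esub> a = \<ominus>\<^bsub>E2\<^esub> a" by (simp add: E.smult_l_minus)
      then show ?thesis using smH[OF _ a, of "\<ominus>\<^bsub>R\<^esub> \<one>\<^bsub>R\<^esub>"] by simp
    qed
  qed (rule smH)
  moreover have "w2 x y \<in> ?H" if "x \<in> carrier V" "y \<in> carrier V" for x y
    by (rule image_eqI[of _ _ "[(x, y)]"]) (use that in auto)
  ultimately have "carrier E2 \<subseteq> ?H" by (rule E2_span)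
  then show thesis using assms that by blast
qed

end

section \<open>Hom-Lie algebras\<close>

sublocale hom_lie_algebra \<subseteq> ext_square R L ..

context hom_lie_algebra
begin

lemma self: "hom_lie_algebra R L" ..

lemma bracket_closed [simp]: "\<lbrakk>x \<in> carrier L; y \<in> carrier L\<rbrakk> \<Longrightarrow> bracket L x y \<in> carrier L"
  using linear_map_closed[OF bracket_linear_right] .

lemma alpha_closed [simp]: "x \<in> carrier L \<Longrightarrow> alpha L x \<in> carrier L"
  using linear_map_closed[OF alpha_linear] .

lemma bracket_add_left:
  "\<lbrakk>x \<in> carrier L; x' \<in> carrier L; y \<in> carrier L\<rbrakk> \<Longrightarrow>
     bracket L (x \<oplus>\<^bsub>L\<^esub> x') y = bracket L x y \<oplus>\<^bsub>L\<^esub> bracket L x' y"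
  using linear_map_add[OF bracket_linear_left] .

lemma bracket_add_right:
  "\<lbrakk>x \<in> carrier L; y \<in> carrier L; y' \<in> carrier L\<rbrakk> \<Longrightarrow>
     bracket L x (y \<oplus>\<^bsub>L\<^esub> y') = bracket L x y \<oplus>\<^bsub>L\<^esub> bracket L x y'"
  using linear_map_add[OF bracket_linear_right] .

lemma bracket_smult_left:
  "\<lbrakk>a \<in> carrier R; x \<in> carrier L; y \<in> carrier L\<rbrakk> \<Longrightarrow>
     bracket L (a \<odot>\<^bsub>L\<^esub> x) y = a \<odot>\<^bsub>L\<^esub> bracket L x y"
  using linear_map_smult[OF bracket_linear_left] .

lemma bracket_smult_right:
  "\<lbrakk>a \<in> carrier R; x \<in> carrier L; y \<in> carrier L\<rbrakk> \<Longrightarrow>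
     bracket L x (a \<odot>\<^bsub>L\<^esub> y) = a \<odot>\<^bsub>L\<^esub> bracket L x y"
  using linear_map_smult[OF bracket_linear_right] .

lemma bracket_zero_left [simp]: "y \<in> carrier L \<Longrightarrow> bracket L \<zero>\<^bsub>L\<^esub> y = \<zero>\<^bsub>L\<^esub>"
  using linear_map_zero[OF V_module V_module bracket_linear_left] .

lemma bracket_zero_right [simp]: "x \<in> carrier L \<Longrightarrow> bracket L x \<zero>\<^bsub>L\<^esub> = \<zero>\<^bsub>L\<^esub>"
  using linear_map_zero[OF V_module V_module bracket_linear_right] .

lemma alpha_add:
  "\<lbrakk>x \<in> carrier L; y \<in> carrier L\<rbrakk> \<Longrightarrow> alpha L (x \<oplus>\<^bsub>L\<^esub> y) = alpha L x \<oplus>\<^bsub>L\<^esub> alpha L y"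
  using linear_map_add[OF alpha_linear] .

lemma alpha_smult:
  "\<lbrakk>a \<in> carrier R; x \<in> carrier L\<rbrakk> \<Longrightarrow> alpha L (a \<odot>\<^bsub>L\<^esub> x) = a \<odot>\<^bsub>L\<^esub> alpha L x"
  using linear_map_smult[OF alpha_linear] .

lemma alpha_zero: "alpha L \<zero>\<^bsub>L\<^esub> = \<zero>\<^bsub>L\<^esub>"
  using linear_map_zero[OF V_module V_module alpha_linear] .

lemma w2_minus_right:
  "\<lbrakk>x \<in> carrier L; y \<in> carrier L\<rbrakk> \<Longrightarrow> w2 x (\<ominus>\<^bsub>L\<^esub> y) = \<ominus>\<^bsub>E2\<^esub> w2 x y"
proof -
  assume x: "x \<in> carrier L" and y: "y \<in> carrier L"
  have "(\<lambda>y. w2 x y) \<in> linear_maps R L E2"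
    using x by (intro linear_mapsI) (simp_all add: w2_add_right w2_smult_right)
  from linear_map_minus[OF V_module E2_module this y] show ?thesis .
qed

section \<open>The differentials of degree two and three\<close>

text \<open>Any linear map with the prescribed values on wedges is the differential, as the wedges span.\<close>

lemma differential_spec:
  assumes f: "f \<in> linear_maps R (ext_power R L n) (ext_power R L (n - 1))"
    and w: "\<And>xs. xs \<in> words L n \<Longrightarrow> f (wedge R L xs) = boundary_word R L xs"
    and z: "z \<in> carrier (ext_power R L n)"
  shows "differential R L n z = f z"
proof -
  let ?E = "ext_power R L n" and ?E' = "ext_power R L (n - 1)"
  interpret E: module R ?E by (rule ext_power_module[OF R_field V_module])
  have E': "module R ?E'" by (rule ext_power_module[OF R_field V_module])
  have "differential R L n = restrict f (carrier ?E)"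
    unfolding differential_def
  proof (rule the_equality)
    have "restrict f (carrier ?E) \<in> linear_maps R ?E ?E'"
      using f by (auto simp: linear_maps_def)
    then show "restrict f (carrier ?E) \<in> extensional (carrier ?E) \<and>
      restrict f (carrier ?E) \<in> linear_maps R ?E ?E' \<and>
      (\<forall>xs\<in>words L n. restrict f (carrier ?E) (wedge R L xs) = boundary_word R L xs)"
      using w wedge_closed[OF R_field V_module] by auto
  next
    fix d assume d: "d \<in> extensional (carrier ?E) \<and> d \<in> linear_maps R ?E ?E' \<and>
      (\<forall>xs\<in>words L n. d (wedge R L xs) = boundary_word R L xs)"
    show "d = restrict f (carrier ?E)"
    proof (rule extensionalityI)
      fix x assume "x \<in> carrier ?E"
      then show "d x = restrict f (carrier ?E) x"
        using ext_power_maps_eq[OF R_field V_module E' _ f, of d x] d w by auto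
    qed (use d in auto)
  qed
  then show ?thesis using z by simp
qed

lemma wedge1_linear: "(\<lambda>x. wedge R L [x]) \<in> linear_maps R L (ext_power R L (Suc 0))"
proof (rule linear_mapsI)
  fix x assume "x \<in> carrier L"
  then show "wedge R L [x] \<in> carrier (ext_power R L (Suc 0))"
    by (intro wedge_closed[OF R_field V_module]) (auto simp: words_1)
next
  fix x y assume "x \<in> carrier L" "y \<in> carrier L"
  then show "wedge R L [x \<oplus>\<^bsub>L\<^esub> y] = wedge R L [x] \<oplus>\<^bsub>ext_power R L (Suc 0)\<^esub> wedge R L [y]"
    using wedge_update_add[OF R_field V_module, of "[x]" "Suc 0" 0 x y] by (auto simp: words_1)
next
  fix a x assume "a \<in> carrier R" "x \<in> carrier L"
  then show "wedge R L [a \<odot>\<^bsub>L\<^esub> x] = a \<odot>\<^bsub>ext_power R L (Suc 0)\<^esub> wedge R L [x]"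
    using wedge_update_smult[OF R_field V_module, of "[x]" "Suc 0" 0 a x] by (auto simp: words_1)
qed

lemma wedge1_zero_iff:
  assumes "x \<in> carrier L"
  shows "wedge R L [x] = \<zero>\<^bsub>ext_power R L (Suc 0)\<^esub> \<longleftrightarrow> x = \<zero>\<^bsub>L\<^esub>"
proof -
  have E: "module R (ext_power R L (Suc 0))" by (rule ext_power_module[OF R_field V_module])
  obtain f where f: "f \<in> linear_maps R (ext_power R L (Suc 0)) L"
    "\<And>xs. xs \<in> words L (Suc 0) \<Longrightarrow> f (wedge R L xs) = xs ! 0"
    by (rule ext_power_lift[OF R_field V_module V_module, of "Suc 0" "\<lambda>xs. xs ! 0"])
       (auto simp: words_1)
  have "f (wedge R L [x]) = x" using f(2)[of "[x]"] assms by (auto simp: words_1)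
  then show ?thesis
    using linear_map_zero[OF E V_module f(1)] linear_map_zero[OF V_module E wedge1_linear] by metis
qed

lemma bracket_map:
  obtains v where "v \<in> linear_maps R E2 L"
    "\<And>x y. \<lbrakk>x \<in> carrier L; y \<in> carrier L\<rbrakk> \<Longrightarrow> v (w2 x y) = bracket L x y"
proof (rule E2_lift[OF V_module, of "bracket L"])
  fix v assume "v \<in> linear_maps R E2 L"
    "\<And>x y. \<lbrakk>x \<in> carrier L; y \<in> carrier L\<rbrakk> \<Longrightarrow> v (w2 x y) = bracket L x y"
  then show thesis by (rule that)
qed (simp_all add: bracket_add_left bracket_smult_left bracket_skew[symmetric])

lemma boundary_word_2:
  assumes "x \<in> carrier L" "y \<in> carrier L"
  shows "boundary_word R L [x, y] = \<ominus>\<^bsub>ext_power R L (Suc 0)\<^esub> wedge R L [bracket L x y]"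
proof -
  let ?E = "ext_power R L (Suc 0)"
  interpret E: module R ?E by (rule ext_power_module[OF R_field V_module])
  have "wedge R L [bracket L x y] \<in> carrier ?E"
    using linear_map_closed[OF wedge1_linear] assms by simp
  moreover have "{(i, j). i < j \<and> j < Suc (Suc 0)} = {(0, 1)}" by auto
  ultimately show ?thesis
    by (simp add: boundary_word_def Let_def nths_Cons)
qed

text \<open>Here \<open>d\<^sub>2 (x \<and> y) = - [x, y]\<close> in \<open>\<Lambda>\<^sup>1 L\<close>, into which \<open>L\<close> embeds.\<close>

lemma cycles_2:
  assumes v: "v \<in> linear_maps R E2 L"
    "\<And>x y. \<lbrakk>x \<in> carrier L; y \<in> carrier L\<rbrakk> \<Longrightarrow> v (w2 x y) = bracket L x y"
  shows "cycles R L 2 = {z \<in> carrier E2. v z = \<zero>\<^bsub>L\<^esub>}"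
proof -
  let ?E = "ext_power R L (Suc 0)"
  interpret E: module R ?E by (rule ext_power_module[OF R_field V_module])
  let ?f = "\<lambda>z. \<ominus>\<^bsub>?E\<^esub> wedge R L [v z]"
  have vc: "v z \<in> carrier L" if "z \<in> carrier E2" for z using linear_map_closed[OF v(1) that] .
  have w: "(\<lambda>z. wedge R L [v z]) \<in> linear_maps R E2 ?E"
    by (rule linear_map_comp[OF v(1) wedge1_linear])
  have f: "?f \<in> linear_maps R E2 ?E"
    by (rule linear_mapsI)
       (simp_all add: linear_map_closed[OF w] linear_map_add[OF w] linear_map_smult[OF w]
         E.minus_add E.smult_r_minus)
  have "differential R L 2 z = ?f z" if "z \<in> carrier E2" for z
    by (rule differential_spec) (use f that in \<open>auto simp: words_2 boundary_word_2 v(2)\<close>)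
  then have "differential R L 2 z = \<zero>\<^bsub>?E\<^esub> \<longleftrightarrow> v z = \<zero>\<^bsub>L\<^esub>" if "z \<in> carrier E2" for z
    using that linear_map_closed[OF w that] wedge1_zero_iff[OF vc[OF that]] by simp
  then show ?thesis
    by (simp add: cycles_def a_kernel_def' cong: conj_cong)
qed

text \<open>The value \<open>d\<^sub>3 (x \<and> y \<and> z)\<close>, rearranged so that it has the shape of the Hom-Jacobi identity.\<close>

definition jacobi_wedge where
  "jacobi_wedge x y z =
     w2 (alpha L x) (bracket L y z) \<oplus>\<^bsub>E2\<^esub> w2 (alpha L z) (bracket L x y)
       \<oplus>\<^bsub>E2\<^esub> w2 (alpha L y) (bracket L z x)"

lemma jacobi_wedge_closed [simp]:
  "\<lbrakk>x \<in> carrier L; y \<in> carrier L; z \<in> carrier L\<rbrakk> \<Longrightarrow> jacobi_wedge x y z \<in> carrier E2"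
proof -
  interpret E: module R E2 by (rule E2_module)
  show "\<lbrakk>x \<in> carrier L; y \<in> carrier L; z \<in> carrier L\<rbrakk> \<Longrightarrow> jacobi_wedge x y z \<in> carrier E2"
    by (simp add: jacobi_wedge_def)
qed

lemma jacobi_wedge_cyclic:
  assumes "x \<in> carrier L" "y \<in> carrier L" "z \<in> carrier L"
  shows "jacobi_wedge x y z = jacobi_wedge y z x"
proof -
  interpret E: module R E2 by (rule E2_module)
  show ?thesis using assms by (simp add: jacobi_wedge_def E.a_ac)
qed

lemma boundary_word_3:
  assumes "x \<in> carrier L" "y \<in> carrier L" "z \<in> carrier L"
  shows "boundary_word R L [x, y, z] = jacobi_wedge x y z"
proof -
  interpret E: module R E2 by (rule E2_module)
  have pairs: "{(i, j). i < j \<and> j < (3::nat)} = {(0, 1), (0, 2), (1, 2)}" by auto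
  have rest: "nths [x, y, z] (- {0, 1}) = [z]" "nths [x, y, z] (- {0, 2}) = [y]"
    "nths [x, y, z] (- {1, 2}) = [x]"
    by (simp_all add: nths_Cons numeral_2_eq_2)
  have len: "length [x, y, z] = 3" "3 - 1 = (2::nat)" by simp_all
  have neg: "\<ominus>\<^bsub>E2\<^esub> w2 (bracket L a b) c = w2 c (bracket L a b)"
    if "a \<in> carrier L" "b \<in> carrier L" "c \<in> carrier L" for a b c
    using that w2_skew[of c "bracket L a b"] by simp
  have "boundary_word R L [x, y, z] = \<ominus>\<^bsub>E2\<^esub> w2 (bracket L x y) (alpha L z)
      \<oplus>\<^bsub>E2\<^esub> (w2 (bracket L x z) (alpha L y) \<oplus>\<^bsub>E2\<^esub> \<ominus>\<^bsub>E2\<^esub> w2 (bracket L y z) (alpha L x))"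
    unfolding boundary_word_def Let_def len pairs
    using assms by (simp add: rest[unfolded One_nat_def])
  also have "w2 (bracket L x z) (alpha L y) = w2 (alpha L y) (bracket L z x)"
  proof -
    have "w2 (bracket L x z) (alpha L y) = \<ominus>\<^bsub>E2\<^esub> w2 (alpha L y) (bracket L x z)"
      by (rule w2_skew) (use assms in simp_all)
    then show ?thesis using assms by (simp add: bracket_skew[of x z] w2_minus_right)
  qed
  finally show ?thesis using assms by (simp add: neg jacobi_wedge_def E.a_ac)
qed

lemma jacobi_wedge_add:
  assumes "x \<in> carrier L" "x' \<in> carrier L" "y \<in> carrier L" "z \<in> carrier L"
  shows "jacobi_wedge (x \<oplus>\<^bsub>L\<^esub> x') y z = jacobi_wedge x y z \<oplus>\<^bsub>E2\<^esub> jacobi_wedge x' y z"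
proof -
  interpret E: module R E2 by (rule E2_module)
  show ?thesis using assms
    by (simp add: jacobi_wedge_def alpha_add bracket_add_left bracket_add_right w2_add_left
        w2_add_right E.a_ac)
qed

lemma jacobi_wedge_smult:
  assumes "a \<in> carrier R" "x \<in> carrier L" "y \<in> carrier L" "z \<in> carrier L"
  shows "jacobi_wedge (a \<odot>\<^bsub>L\<^esub> x) y z = a \<odot>\<^bsub>E2\<^esub> jacobi_wedge x y z"
proof -
  interpret E: module R E2 by (rule E2_module)
  show ?thesis using assms
    by (simp add: jacobi_wedge_def alpha_smult bracket_smult_left bracket_smult_right w2_smult_left
        w2_smult_right E.smult_r_distr)
qed

lemma jacobi_wedge_skew:
  assumes "x \<in> carrier L" "y \<in> carrier L" "z \<in> carrier L"
  shows "jacobi_wedge y x z = \<ominus>\<^bsub>E2\<^esub> jacobi_wedge x y z"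
proof -
  interpret E: module R E2 by (rule E2_module)
  have neg: "w2 c (bracket L a b) = \<ominus>\<^bsub>E2\<^esub> w2 c (bracket L b a)"
    if "a \<in> carrier L" "b \<in> carrier L" "c \<in> carrier L" for a b c
    using that by (simp add: bracket_skew[of a b] w2_minus_right)
  show ?thesis using assms
    by (simp add: jacobi_wedge_def neg[of x z] neg[of y x] neg[of z y] E.minus_add E.a_ac)
qed

text \<open>By cyclic symmetry of \<^const>\<open>jacobi_wedge\<close>, linearity is needed only in its first argument and
  skew-symmetry only in its first two.\<close>

lemma boundaries_2:
  obtains d where "d \<in> linear_maps R (ext_power R L 3) E2"
    "\<And>x y z. \<lbrakk>x \<in> carrier L; y \<in> carrier L; z \<in> carrier L\<rbrakk> \<Longrightarrow>
       d (wedge R L [x, y, z]) = jacobi_wedge x y z"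
    "boundaries R L 2 = d ` carrier (ext_power R L 3)"
proof -
  interpret E: module R E2 by (rule E2_module)
  let ?J = "\<lambda>xs. jacobi_wedge (xs ! 0) (xs ! 1) (xs ! 2)"
  note cyc = jacobi_wedge_cyclic
  have add2: "jacobi_wedge y (x \<oplus>\<^bsub>L\<^esub> x') z = jacobi_wedge y x z \<oplus>\<^bsub>E2\<^esub> jacobi_wedge y x' z"
    if "x \<in> carrier L" "x' \<in> carrier L" "y \<in> carrier L" "z \<in> carrier L" for x x' y z
    using that by (simp add: cyc[of y] jacobi_wedge_add)
  have add3: "jacobi_wedge y z (x \<oplus>\<^bsub>L\<^esub> x') = jacobi_wedge y z x \<oplus>\<^bsub>E2\<^esub> jacobi_wedge y z x'"
    if "x \<in> carrier L" "x' \<in> carrier L" "y \<in> carrier L" "z \<in> carrier L" for x x' y z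
    using that by (simp add: cyc[of x, symmetric] cyc[of x', symmetric]
        cyc[of "x \<oplus>\<^bsub>L\<^esub> x'", symmetric] jacobi_wedge_add)
  have smult2: "jacobi_wedge y (a \<odot>\<^bsub>L\<^esub> x) z = a \<odot>\<^bsub>E2\<^esub> jacobi_wedge y x z"
    if "a \<in> carrier R" "x \<in> carrier L" "y \<in> carrier L" "z \<in> carrier L" for a x y z
    using that by (simp add: cyc[of y] jacobi_wedge_smult)
  have smult3: "jacobi_wedge y z (a \<odot>\<^bsub>L\<^esub> x) = a \<odot>\<^bsub>E2\<^esub> jacobi_wedge y z x"
    if "a \<in> carrier R" "x \<in> carrier L" "y \<in> carrier L" "z \<in> carrier L" for a x y z
    using that by (simp add: cyc[of x, symmetric] cyc[of "a \<odot>\<^bsub>L\<^esub> x", symmetric] jacobi_wedge_smult)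
  have sk1: "jacobi_wedge x y z \<oplus>\<^bsub>E2\<^esub> jacobi_wedge y x z = \<zero>\<^bsub>E2\<^esub>"
    if "x \<in> carrier L" "y \<in> carrier L" "z \<in> carrier L" for x y z
    using that by (simp add: jacobi_wedge_skew[of x y z] E.r_neg)
  have sk2: "jacobi_wedge x y z \<oplus>\<^bsub>E2\<^esub> jacobi_wedge x z y = \<zero>\<^bsub>E2\<^esub>"
    if "x \<in> carrier L" "y \<in> carrier L" "z \<in> carrier L" for x y z
    using that sk1[of y z x] cyc[of x y z] cyc[of x z y] by simp
  have sk3: "jacobi_wedge x y z \<oplus>\<^bsub>E2\<^esub> jacobi_wedge z y x = \<zero>\<^bsub>E2\<^esub>"
    if "x \<in> carrier L" "y \<in> carrier L" "z \<in> carrier L" for x y z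
    using that sk2[of y z x] cyc[of x y z] cyc[of z y x] by simp
  obtain d where d: "d \<in> linear_maps R (ext_power R L 3) E2"
    "\<And>xs. xs \<in> words L 3 \<Longrightarrow> d (wedge R L xs) = ?J xs"
  proof (rule ext_power_lift[OF R_field V_module E2_module, of 3 ?J])
    fix xs i j assume "xs \<in> words L 3" and ij: "i < j" "j < (3::nat)"
    then obtain x y z where xs: "xs = [x, y, z]" "x \<in> carrier L" "y \<in> carrier L" "z \<in> carrier L"
      unfolding words_3 by blast
    consider "i = 0" "j = 1" | "i = 0" "j = 2" | "i = 1" "j = 2" using ij by linarith
    then show "?J xs \<oplus>\<^bsub>E2\<^esub> ?J (xs[i := xs ! j, j := xs ! i]) = \<zero>\<^bsub>E2\<^esub>"
      by cases (simp_all add: xs sk1 sk2 sk3)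
  qed (auto simp: words_3 less_3_cases jacobi_wedge_add add2 add3 jacobi_wedge_smult smult2 smult3)
  have dw: "d (wedge R L [x, y, z]) = jacobi_wedge x y z"
    if "x \<in> carrier L" "y \<in> carrier L" "z \<in> carrier L" for x y z
    using d(2)[of "[x, y, z]"] that by (auto simp: words_3)
  have "differential R L 3 z = d z" if "z \<in> carrier (ext_power R L 3)" for z
    by (rule differential_spec) (use d(1) that in \<open>auto simp: words_3 boundary_word_3 dw\<close>)
  then have "boundaries R L 2 = d ` carrier (ext_power R L 3)"
    by (simp add: boundaries_def)
  from that[OF d(1) dw this] show thesis by simp
qed

lemma boundaries_submodule: "submodule (boundaries R L 2) R E2"
proof -
  obtain d where d: "d \<in> linear_maps R (ext_power R L 3) E2"
    "\<And>x y z. \<lbrakk>x \<in> carrier L; y \<in> carrier L; z \<in> carrier L\<rbrakk> \<Longrightarrow>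
       d (wedge R L [x, y, z]) = jacobi_wedge x y z"
    "boundaries R L 2 = d ` carrier (ext_power R L 3)"
    by (rule boundaries_2) (rule that; assumption)
  show ?thesis unfolding d(3)
    by (rule image_submodule[OF ext_power_module[OF R_field V_module] E2_module d(1)])
qed

lemma jacobi_wedge_boundary:
  assumes "x \<in> carrier L" "y \<in> carrier L" "z \<in> carrier L"
  shows "jacobi_wedge x y z \<in> boundaries R L 2"
proof -
  obtain d where d: "d \<in> linear_maps R (ext_power R L 3) E2"
    "\<And>x y z. \<lbrakk>x \<in> carrier L; y \<in> carrier L; z \<in> carrier L\<rbrakk> \<Longrightarrow>
       d (wedge R L [x, y, z]) = jacobi_wedge x y z"
    "boundaries R L 2 = d ` carrier (ext_power R L 3)"
    by (rule boundaries_2) blast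
  have "wedge R L [x, y, z] \<in> carrier (ext_power R L 3)"
    by (rule wedge_closed[OF R_field V_module]) (use assms in \<open>auto simp: words_3\<close>)
  then show ?thesis unfolding d(3) d(2)[OF assms, symmetric] by (rule imageI)
qed

lemma boundaries_least:
  assumes H: "submodule H R E2"
    and J: "\<And>x y z. \<lbrakk>x \<in> carrier L; y \<in> carrier L; z \<in> carrier L\<rbrakk> \<Longrightarrow> jacobi_wedge x y z \<in> H"
  shows "boundaries R L 2 \<subseteq> H"
proof -
  obtain d where d: "d \<in> linear_maps R (ext_power R L 3) E2"
    "\<And>x y z. \<lbrakk>x \<in> carrier L; y \<in> carrier L; z \<in> carrier L\<rbrakk> \<Longrightarrow>
       d (wedge R L [x, y, z]) = jacobi_wedge x y z"
    "boundaries R L 2 = d ` carrier (ext_power R L 3)"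
    by (rule boundaries_2) blast
  have "carrier (ext_power R L 3) \<subseteq> {z \<in> carrier (ext_power R L 3). d z \<in> H}"
    by (rule ext_power_span[OF R_field V_module
          vimage_submodule[OF ext_power_module[OF R_field V_module] E2_module d(1) H]])
       (auto simp: words_3 d(2) J intro!: wedge_closed[OF R_field V_module])
  then show ?thesis unfolding d(3) by blast
qed

end

section \<open>Homomorphisms and central kernels\<close>

lemma hom_linear: "f \<in> hom_lie_homs R L L' \<Longrightarrow> f \<in> linear_maps R L L'"
  by (simp add: hom_lie_homs_def)

lemma hom_closed: "\<lbrakk>f \<in> hom_lie_homs R L L'; x \<in> carrier L\<rbrakk> \<Longrightarrow> f x \<in> carrier L'"
  using linear_map_closed[OF hom_linear] .

lemma hom_bracket:
  "\<lbrakk>f \<in> hom_lie_homs R L L'; x \<in> carrier L; y \<in> carrier L\<rbrakk> \<Longrightarrow>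
     f (bracket L x y) = bracket L' (f x) (f y)"
  by (simp add: hom_lie_homs_def)

lemma hom_alpha:
  "\<lbrakk>f \<in> hom_lie_homs R L L'; x \<in> carrier L\<rbrakk> \<Longrightarrow> f (alpha L x) = alpha L' (f x)"
  by (simp add: hom_lie_homs_def)

lemma hom_lie_homsI:
  assumes "f \<in> linear_maps R L L'"
    and "\<And>x y. \<lbrakk>x \<in> carrier L; y \<in> carrier L\<rbrakk> \<Longrightarrow> f (bracket L x y) = bracket L' (f x) (f y)"
    and "\<And>x. x \<in> carrier L \<Longrightarrow> f (alpha L x) = alpha L' (f x)"
  shows "f \<in> hom_lie_homs R L L'"
  using assms by (simp add: hom_lie_homs_def)

lemma hom_lie_comp:
  assumes "f \<in> hom_lie_homs R L L'" "g \<in> hom_lie_homs R L' L''"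
  shows "(\<lambda>x. g (f x)) \<in> hom_lie_homs R L L''"
  using linear_map_comp[OF hom_linear[OF assms(1)] hom_linear[OF assms(2)]] hom_closed[OF assms(1)]
  by (simp add: hom_lie_homs_def hom_bracket[OF assms(1)] hom_bracket[OF assms(2)]
      hom_alpha[OF assms(1)] hom_alpha[OF assms(2)])

lemma hom_lie_id: "(\<lambda>x. x) \<in> hom_lie_homs R L L"
  by (simp add: hom_lie_homs_def linear_map_id)

lemma hom_lie_module: "hom_lie_algebra R L \<Longrightarrow> module R L"
  by (simp add: hom_lie_algebra_def)

lemma hom_zero:
  "\<lbrakk>hom_lie_algebra R L; hom_lie_algebra R L'; f \<in> hom_lie_homs R L L'\<rbrakk> \<Longrightarrow> f \<zero>\<^bsub>L\<^esub> = \<zero>\<^bsub>L'\<^esub>"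
  using linear_map_zero[OF hom_lie_module hom_lie_module hom_linear] .

text \<open>A surjective homomorphism with central kernel is a central extension in which the kernel has
  not been named.  The kernel plays no role in lifting problems, so they are phrased in these terms.\<close>

definition central_hom ::
  "'k ring \<Rightarrow> ('k, 'e) hom_lie \<Rightarrow> ('e \<Rightarrow> 'l) \<Rightarrow> ('k, 'l) hom_lie \<Rightarrow> bool" where
  "central_hom R E \<rho> L \<longleftrightarrow> hom_lie_algebra R E \<and> hom_lie_algebra R L \<and>
     \<rho> \<in> hom_lie_homs R E L \<and> \<rho> ` carrier E = carrier L \<and>
     (\<forall>x\<in>carrier E. \<forall>y\<in>carrier E. \<rho> x = \<zero>\<^bsub>L\<^esub> \<longrightarrow> bracket E x y = \<zero>\<^bsub>E\<^esub>)"

lemma central_homD: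
  assumes "central_hom R E \<rho> L"
  shows "hom_lie_algebra R E" "hom_lie_algebra R L" "\<rho> \<in> hom_lie_homs R E L"
    "\<rho> ` carrier E = carrier L"
    "\<lbrakk>x \<in> carrier E; y \<in> carrier E; \<rho> x = \<zero>\<^bsub>L\<^esub>\<rbrakk> \<Longrightarrow> bracket E x y = \<zero>\<^bsub>E\<^esub>"
  using assms by (auto simp: central_hom_def)

text \<open>A bracket in \<open>E\<close> depends only on the images of its entries.\<close>

lemma central_hom_bracket_cong:
  assumes c: "central_hom R E \<rho> L"
    and x: "x \<in> carrier E" "x' \<in> carrier E" "\<rho> x = \<rho> x'"
    and y: "y \<in> carrier E" "y' \<in> carrier E" "\<rho> y = \<rho> y'"
  shows "bracket E x y = bracket E x' y'"
proof -
  interpret E: hom_lie_algebra R E by (rule central_homD[OF c])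
  interpret L: hom_lie_algebra R L by (rule central_homD[OF c])
  have lin: "\<rho> \<in> linear_maps R E L" by (rule hom_linear[OF central_homD(3)[OF c]])
  note cl = linear_map_closed[OF lin]
  have left: "bracket E a b = bracket E a' b"
    if ab: "a \<in> carrier E" "a' \<in> carrier E" "\<rho> a = \<rho> a'" "b \<in> carrier E" for a a' b
  proof -
    have "\<rho> (a \<ominus>\<^bsub>E\<^esub> a') = \<zero>\<^bsub>L\<^esub>"
      using ab cl by (simp add: linear_map_diff[OF E.V_module L.V_module lin] L.diff_zero_iff)
    then have "bracket E (a \<ominus>\<^bsub>E\<^esub> a') b = \<zero>\<^bsub>E\<^esub>" using central_homD(5)[OF c] ab by simp
    then show ?thesis
      using ab linear_map_diff[OF E.V_module E.V_module E.bracket_linear_left]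
      by (simp add: E.diff_zero_iff)
  qed
  have "bracket E x y = bracket E x' y" using left x y by blast
  also have "\<dots> = \<ominus>\<^bsub>E\<^esub> bracket E y x'" using E.bracket_skew x y by blast
  also have "bracket E y x' = bracket E y' x'" using left x y by blast
  also have "\<ominus>\<^bsub>E\<^esub> bracket E y' x' = bracket E x' y'" using E.bracket_skew x y by metis
  finally show ?thesis .
qed

lemma hom_lie_sub:
  assumes E: "hom_lie_algebra R E" and H: "submodule H R E"
    and br: "\<And>x y. \<lbrakk>x \<in> H; y \<in> H\<rbrakk> \<Longrightarrow> bracket E x y \<in> H"
    and al: "\<And>x. x \<in> H \<Longrightarrow> alpha E x \<in> H"
  shows "hom_lie_algebra R (E\<lparr>carrier := H\<rparr>)"
proof -
  interpret E: hom_lie_algebra R E by fact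
  let ?S = "E\<lparr>carrier := H\<rparr>"
  have S: "module R ?S" by (rule submodule.submodule_is_module[OF H E.V_module])
  interpret S: module R ?S by (rule S)
  have HE: "x \<in> carrier E" if "x \<in> H" for x using that E.submoduleE(1)[OF H] by blast
  have minus: "\<ominus>\<^bsub>?S\<^esub> x = \<ominus>\<^bsub>E\<^esub> x" if "x \<in> H" for x
    using S.minus_equality[of "\<ominus>\<^bsub>E\<^esub> x" x] that E.submoduleE(3)[OF H that] HE[OF that]
    by (simp add: E.l_neg)
  show ?thesis
  proof (intro hom_lie_algebra.intro hom_lie_algebra_axioms.intro)
    show "bracket ?S x y = \<ominus>\<^bsub>?S\<^esub> bracket ?S y x" if "x \<in> carrier ?S" "y \<in> carrier ?S" for x y
      using that E.bracket_skew[OF HE HE, of x y] br by (simp add: minus)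
  next
    fix x y z assume "x \<in> carrier ?S" "y \<in> carrier ?S" "z \<in> carrier ?S"
    then show "bracket ?S (alpha ?S x) (bracket ?S y z) \<oplus>\<^bsub>?S\<^esub> bracket ?S (alpha ?S z) (bracket ?S x y)
        \<oplus>\<^bsub>?S\<^esub> bracket ?S (alpha ?S y) (bracket ?S z x) = \<zero>\<^bsub>?S\<^esub>"
      using HE E.hom_jacobi by simp
  qed (use br al HE in \<open>auto intro!: linear_mapsI E.R_field S simp: E.bracket_add_left
    E.bracket_add_right E.bracket_smult_left E.bracket_smult_right E.alpha_add E.alpha_smult
    E.alpha_bracket\<close>)
qed

lemma kernel_extension:
  assumes E: "hom_lie_algebra R E" and L: "hom_lie_algebra R L"
    and \<rho>: "\<rho> \<in> hom_lie_homs R E L" "\<rho> ` carrier E = carrier L"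
  shows "extension R (E\<lparr>carrier := {x \<in> carrier E. \<rho> x = \<zero>\<^bsub>L\<^esub>}\<rparr>) (\<lambda>x. x) E \<rho> L"
proof -
  interpret E: hom_lie_algebra R E by fact
  interpret L: hom_lie_algebra R L by fact
  let ?H = "{x \<in> carrier E. \<rho> x = \<zero>\<^bsub>L\<^esub>}"
  have H: "submodule ?H R E"
    by (rule kernel_submodule[OF E.V_module L.V_module hom_linear[OF \<rho>(1)]])
  have "hom_lie_algebra R (E\<lparr>carrier := ?H\<rparr>)"
    by (rule hom_lie_sub[OF E H])
       (auto simp: hom_bracket[OF \<rho>(1)] hom_alpha[OF \<rho>(1)] L.alpha_zero)
  moreover have "(\<lambda>x. x) \<in> hom_lie_homs R (E\<lparr>carrier := ?H\<rparr>) E"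
    by (simp add: hom_lie_homs_def linear_maps_def)
  ultimately show ?thesis
    using E L \<rho> by (simp add: extension_def a_kernel_def')
qed

lemma central_hom_extension:
  assumes "central_hom R E \<rho> L"
  shows "central_extension R (E\<lparr>carrier := {x \<in> carrier E. \<rho> x = \<zero>\<^bsub>L\<^esub>}\<rparr>) (\<lambda>x. x) E \<rho> L"
  using kernel_extension[OF central_homD(1-4)[OF assms]] central_homD(5)[OF assms]
  by (simp add: central_extension_def)

lemma central_extension_hom: "central_extension R M i K \<pi> L \<Longrightarrow> central_hom R K \<pi> L"
proof -
  assume c: "central_extension R M i K \<pi> L"
  then have "\<exists>m\<in>carrier M. x = i m" if "x \<in> carrier K" "\<pi> x = \<zero>\<^bsub>L\<^esub>" for x
    using that unfolding central_extension_def extension_def a_kernel_def' by blast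
  with c show ?thesis
    unfolding central_extension_def extension_def central_hom_def by metis
qed

lemma central_imp_alpha_central:
  "central_extension R M i K \<pi> L \<Longrightarrow> alpha_central_extension R M i K \<pi> L"
  by (auto simp: central_extension_def alpha_central_extension_def extension_def
      hom_lie_algebra.alpha_closed)

lemma universal_alpha_central_imp_central:
  "universal_alpha_central_extension T R M i K \<pi> L \<Longrightarrow> universal_central_extension T R M i K \<pi> L"
  by (auto simp: universal_alpha_central_extension_def universal_central_extension_def
      dest: central_imp_alpha_central)

lemma unique_liftI:
  assumes "h \<in> hom_lie_homs R K E" "\<And>x. x \<in> carrier K \<Longrightarrow> \<rho> (h x) = \<pi> x"
    and "\<And>g h x. \<lbrakk>g \<in> hom_lie_homs R K E; h \<in> hom_lie_homs R K E;
      \<And>x. x \<in> carrier K \<Longrightarrow> \<rho> (g x) = \<rho> (h x); x \<in> carrier K\<rbrakk> \<Longrightarrow> g x = h x"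
  shows "unique_lift R K \<pi> E \<rho>"
  unfolding unique_lift_def Let_def
proof (intro conjI ballI)
  show "{h \<in> hom_lie_homs R K E. \<forall>x\<in>carrier K. \<rho> (h x) = \<pi> x} \<noteq> {}"
    using assms(1,2) by blast
next
  fix g h x assume "g \<in> {h \<in> hom_lie_homs R K E. \<forall>x\<in>carrier K. \<rho> (h x) = \<pi> x}"
    "h \<in> {h \<in> hom_lie_homs R K E. \<forall>x\<in>carrier K. \<rho> (h x) = \<pi> x}" "x \<in> carrier K"
  then show "g x = h x" using assms(3)[of g h x] by simp
qed

lemma unique_lift_obtain:
  assumes "unique_lift R K \<pi> E \<rho>"
  obtains h where "h \<in> hom_lie_homs R K E" "\<And>x. x \<in> carrier K \<Longrightarrow> \<rho> (h x) = \<pi> x"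
  using assms unfolding unique_lift_def Let_def by blast

lemma unique_liftD:
  assumes "unique_lift R K \<pi> E \<rho>" "g \<in> hom_lie_homs R K E" "h \<in> hom_lie_homs R K E"
    "\<And>x. x \<in> carrier K \<Longrightarrow> \<rho> (g x) = \<pi> x" "\<And>x. x \<in> carrier K \<Longrightarrow> \<rho> (h x) = \<pi> x"
    "x \<in> carrier K"
  shows "g x = h x"
  using assms unfolding unique_lift_def Let_def by blast

text \<open>The derived subspace \<open>[L, L]\<close>.\<close>

definition derived :: "'k ring \<Rightarrow> ('k, 'a) hom_lie \<Rightarrow> 'a set" where
  "derived R L = lin_span R L {bracket L x y | x y. x \<in> carrier L \<and> y \<in> carrier L}"

lemma derived_submodule: "hom_lie_algebra R L \<Longrightarrow> submodule (derived R L) R L"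
  unfolding derived_def
  by (rule lin_span_submodule) (auto simp: hom_lie_module hom_lie_algebra.bracket_closed)

lemma bracket_in_derived:
  "\<lbrakk>x \<in> carrier L; y \<in> carrier L\<rbrakk> \<Longrightarrow> bracket L x y \<in> derived R L"
  unfolding derived_def by (rule subsetD[OF lin_span_superset]) blast

lemma derived_least:
  assumes "submodule H R L"
    "\<And>x y. \<lbrakk>x \<in> carrier L; y \<in> carrier L\<rbrakk> \<Longrightarrow> bracket L x y \<in> H"
  shows "derived R L \<subseteq> H"
  unfolding derived_def by (rule lin_span_least[OF assms(1)]) (auto simp: assms(2))

lemma perfectI:
  assumes "hom_lie_algebra R L" "carrier L \<subseteq> derived R L"
  shows "perfect R L"
proof -
  interpret hom_lie_algebra R L by fact
  show ?thesis
    using assms(2) derived_least[OF carrier_is_submodule] by (auto simp: perfect_def derived_def)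
qed

lemma perfect_least:
  assumes "perfect R L" "submodule H R L"
    "\<And>x y. \<lbrakk>x \<in> carrier L; y \<in> carrier L\<rbrakk> \<Longrightarrow> bracket L x y \<in> H"
  shows "carrier L \<subseteq> H"
  using derived_least[OF assms(2,3)] assms(1) by (simp add: perfect_def derived_def)

lemma perfect_image:
  assumes "hom_lie_algebra R K" "hom_lie_algebra R L" "f \<in> hom_lie_homs R K L"
    "f ` carrier K = carrier L" "perfect R K"
  shows "perfect R L"
proof (rule perfectI[OF assms(2)])
  have "submodule {x \<in> carrier K. f x \<in> derived R L} R K"
    by (rule vimage_submodule[OF hom_lie_module hom_lie_module hom_linear[OF assms(3)]
          derived_submodule]) (rule assms(1,2))+
  then have "carrier K \<subseteq> {x \<in> carrier K. f x \<in> derived R L}"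
    by (rule perfect_least[OF assms(5)])
       (simp add: hom_bracket[OF assms(3)] hom_closed[OF assms(3)] bracket_in_derived
         hom_lie_algebra.bracket_closed[OF assms(1)])
  then show "carrier L \<subseteq> derived R L" unfolding assms(4)[symmetric] by blast
qed

text \<open>Lifts along a homomorphism with central kernel are unique when the source is perfect, since
  both lifts take the same value on each bracket.\<close>

lemma perfect_lift_unique:
  assumes K: "hom_lie_algebra R K" "perfect R K" and c: "central_hom R E \<rho> L"
    and g: "g \<in> hom_lie_homs R K E" and h: "h \<in> hom_lie_homs R K E"
    and eq: "\<And>x. x \<in> carrier K \<Longrightarrow> \<rho> (g x) = \<rho> (h x)" and x: "x \<in> carrier K"
  shows "g x = h x"
proof -
  interpret K: hom_lie_algebra R K by fact
  have "submodule {x \<in> carrier K. g x = h x} R K"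
    by (rule equalizer_submodule[OF K.V_module hom_lie_module[OF central_homD(1)[OF c]]
          hom_linear[OF g] hom_linear[OF h]])
  moreover have "bracket K a b \<in> {x \<in> carrier K. g x = h x}"
    if "a \<in> carrier K" "b \<in> carrier K" for a b
    using central_hom_bracket_cong[OF c] that eq hom_closed[OF g] hom_closed[OF h]
    by (simp add: hom_bracket[OF g] hom_bracket[OF h])
  ultimately show ?thesis using perfect_least[OF K(2)] x by blast
qed

section \<open>Transport to another carrier type\<close>

lemma hom_lie_image:
  assumes E: "hom_lie_algebra R E" and E': "module R E'"
    and t: "t \<in> linear_maps R E E'" "t ` carrier E = carrier E'"
    and br: "\<And>x y. \<lbrakk>x \<in> carrier E; y \<in> carrier E\<rbrakk> \<Longrightarrow> bracket E' (t x) (t y) = t (bracket E x y)"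
    and al: "\<And>x. x \<in> carrier E \<Longrightarrow> alpha E' (t x) = t (alpha E x)"
  shows "hom_lie_algebra R E'"
proof -
  interpret E: hom_lie_algebra R E by fact
  interpret E': module R E' by fact
  have pre: "\<exists>x'\<in>carrier E. x = t x'" if "x \<in> carrier E'" for x
    using that t(2) by blast
  note cl = linear_map_closed[OF t(1)]
  note ad = linear_map_add[OF t(1), symmetric]
  note sm = linear_map_smult[OF t(1), symmetric]
  note mi = linear_map_minus[OF E.V_module E' t(1), symmetric]
  note ze = linear_map_zero[OF E.V_module E' t(1)]
  show ?thesis
  proof (intro hom_lie_algebra.intro hom_lie_algebra_axioms.intro)
    show "(\<lambda>y. bracket E' x y) \<in> linear_maps R E' E'" if "x \<in> carrier E'" for x
      by (rule linear_mapsI)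
         (use that in \<open>auto dest!: pre simp: br cl ad sm E.bracket_add_right E.bracket_smult_right\<close>)
    show "(\<lambda>x. bracket E' x y) \<in> linear_maps R E' E'" if "y \<in> carrier E'" for y
      by (rule linear_mapsI)
         (use that in \<open>auto dest!: pre simp: br cl ad sm E.bracket_add_left E.bracket_smult_left\<close>)
    show "alpha E' \<in> linear_maps R E' E'"
      by (rule linear_mapsI)
         (auto dest!: pre simp: al cl ad sm E.alpha_add E.alpha_smult)
    show "bracket E' x y = \<ominus>\<^bsub>E'\<^esub> bracket E' y x" if xy: "x \<in> carrier E'" "y \<in> carrier E'" for x y
    proof -
      obtain x' y' where "x' \<in> carrier E" "y' \<in> carrier E" "x = t x'" "y = t y'"
        using pre xy by metis
      then show ?thesis using E.bracket_skew[of x' y'] by (simp add: br mi)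
    qed
    show "alpha E' (bracket E' x y) = bracket E' (alpha E' x) (alpha E' y)"
      if "x \<in> carrier E'" "y \<in> carrier E'" for x y
      using that by (auto dest!: pre simp: br al E.alpha_bracket)
    show "bracket E' (alpha E' x) (bracket E' y z) \<oplus>\<^bsub>E'\<^esub> bracket E' (alpha E' z) (bracket E' x y)
        \<oplus>\<^bsub>E'\<^esub> bracket E' (alpha E' y) (bracket E' z x) = \<zero>\<^bsub>E'\<^esub>"
      if "x \<in> carrier E'" "y \<in> carrier E'" "z \<in> carrier E'" for x y z
      using that by (auto dest!: pre simp: br al ad E.hom_jacobi ze)
  qed (rule E.R_field E')+
qed

lemma hom_lie_transport:
  fixes E :: "('k, 'e) hom_lie" and t :: "'e \<Rightarrow> 'u"
  assumes E: "hom_lie_algebra R E" and t: "inj_on t (carrier E)"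
  obtains E' :: "('k, 'u) hom_lie" and s where
    "hom_lie_algebra R E'" "t \<in> hom_lie_homs R E E'" "s \<in> hom_lie_homs R E' E"
    "\<And>x. x \<in> carrier E \<Longrightarrow> s (t x) = x" "\<And>y. y \<in> carrier E' \<Longrightarrow> t (s y) = y"
proof -
  interpret E: hom_lie_algebra R E by fact
  define s where "s = inv_into (carrier E) t"
  define E' :: "('k, 'u) hom_lie" where "E' = \<lparr>carrier = t ` carrier E, mult = undefined,
    one = undefined, zero = t \<zero>\<^bsub>E\<^esub>, add = (\<lambda>x y. t (s x \<oplus>\<^bsub>E\<^esub> s y)),
    smult = (\<lambda>a x. t (a \<odot>\<^bsub>E\<^esub> s x)), bracket = (\<lambda>x y. t (bracket E (s x) (s y))),
    alpha = (\<lambda>x. t (alpha E (s x)))\<rparr>"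
  have st: "s (t x) = x" if "x \<in> carrier E" for x
    using that t by (simp add: s_def)
  have ts: "t (s y) = y" if "y \<in> carrier E'" for y
    using that by (auto simp: E'_def s_def intro: f_inv_into_f)
  have lin: "t \<in> linear_maps R E E'"
    by (rule linear_mapsI) (simp_all add: E'_def st)
  have mod: "module R E'"
    by (rule module_image[OF E.V_module lin]) (simp_all add: E'_def)
  have alg: "hom_lie_algebra R E'"
    by (rule hom_lie_image[OF E mod lin]) (simp_all add: E'_def st)
  have th: "t \<in> hom_lie_homs R E E'"
    by (rule hom_lie_homsI[OF lin]) (simp_all add: E'_def st)
  have sh: "s \<in> hom_lie_homs R E' E"
    by (rule hom_lie_homsI[OF linear_mapsI]) (auto simp: E'_def st)
  from that[OF alg th sh st ts] show thesis by simp
qed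

lemma unique_lift_transport:
  assumes u: "unique_lift R K \<pi> E' (\<lambda>y. \<rho> (s y))"
    and t: "t \<in> hom_lie_homs R E E'" and s: "s \<in> hom_lie_homs R E' E"
    and st: "\<And>x. x \<in> carrier E \<Longrightarrow> s (t x) = x"
  shows "unique_lift R K \<pi> E \<rho>"
proof -
  obtain h where h: "h \<in> hom_lie_homs R K E'" "\<And>x. x \<in> carrier K \<Longrightarrow> \<rho> (s (h x)) = \<pi> x"
    by (rule unique_lift_obtain[OF u]) blast
  have ex: "(\<lambda>x. s (h x)) \<in> hom_lie_homs R K E" by (rule hom_lie_comp[OF h(1) s])
  have un: "g x = k x" if g: "g \<in> hom_lie_homs R K E" "\<forall>x\<in>carrier K. \<rho> (g x) = \<pi> x"
    and k: "k \<in> hom_lie_homs R K E" "\<forall>x\<in>carrier K. \<rho> (k x) = \<pi> x" and x: "x \<in> carrier K" for g k x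
  proof -
    have "t (g x) = t (k x)"
      by (rule unique_liftD[OF u hom_lie_comp[OF g(1) t] hom_lie_comp[OF k(1) t] _ _ x])
         (use g k in \<open>simp_all add: st hom_closed[OF g(1)] hom_closed[OF k(1)]\<close>)
    then show ?thesis using st hom_closed[OF g(1) x] hom_closed[OF k(1) x] by metis
  qed
  show ?thesis unfolding unique_lift_def Let_def using ex h(2) un by blast
qed

text \<open>The universal property, tested on algebras with carriers in \<open>'u\<close>, extends to algebras that
  embed into \<open>'u\<close> as sets.\<close>

lemma universal_central_small:
  fixes M :: "('k, 'm) hom_lie" and E :: "('k, 'e) hom_lie" and t :: "'e \<Rightarrow> 'u"
  assumes u: "universal_central_extension TYPE('u) R M i K \<pi> L"
    and c: "central_hom R E \<rho> L" and inj: "inj_on t (carrier E)"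
  shows "unique_lift R K \<pi> E \<rho>"
proof -
  interpret E: hom_lie_algebra R E by (rule central_homD[OF c])
  obtain E' :: "('k, 'u) hom_lie" and s where E':
    "hom_lie_algebra R E'" "t \<in> hom_lie_homs R E E'" "s \<in> hom_lie_homs R E' E"
    "\<And>x. x \<in> carrier E \<Longrightarrow> s (t x) = x" "\<And>y. y \<in> carrier E' \<Longrightarrow> t (s y) = y"
    by (rule hom_lie_transport[OF central_homD(1)[OF c] inj]) blast
  have surj: "s ` carrier E' = carrier E"
  proof
    show "s ` carrier E' \<subseteq> carrier E" using hom_closed[OF E'(3)] by blast
    show "carrier E \<subseteq> s ` carrier E'" using E'(4) hom_closed[OF E'(2)] by (metis imageI subsetI)
  qed
  have cen: "bracket E' x y = \<zero>\<^bsub>E'\<^esub>"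
    if xy: "x \<in> carrier E'" "y \<in> carrier E'" "\<rho> (s x) = \<zero>\<^bsub>L\<^esub>" for x y
  proof -
    have "bracket E' x y = t (bracket E (s x) (s y))"
      using xy E'(5) hom_closed[OF E'(3)] by (simp add: hom_bracket[OF E'(2)])
    also have "bracket E (s x) (s y) = \<zero>\<^bsub>E\<^esub>"
      using central_homD(5)[OF c] xy hom_closed[OF E'(3)] by simp
    finally show ?thesis using hom_zero[OF E.self E'(1,2)] by simp
  qed
  have "central_hom R E' (\<lambda>y. \<rho> (s y)) L"
    unfolding central_hom_def
    using E'(1) central_homD(2)[OF c] hom_lie_comp[OF E'(3) central_homD(3)[OF c]] cen
      central_homD(4)[OF c] surj by (simp add: image_image[symmetric])
  then have "unique_lift R K \<pi> E' (\<lambda>y. \<rho> (s y))"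
    using u central_hom_extension unfolding universal_central_extension_def by blast
  then show ?thesis by (rule unique_lift_transport[OF _ E'(2,3,4)])
qed

section \<open>Injections into an infinite type\<close>

lemma infinite_pair_inj:
  assumes "infinite (UNIV :: 'u set)"
  obtains p :: "'u \<times> 'u \<Rightarrow> 'u" where "inj p"
proof -
  obtain p :: "'u \<times> 'u \<Rightarrow> 'u" where "bij_betw p (UNIV \<times> UNIV) UNIV"
    using card_of_Times_same_infinite[OF assms] unfolding card_of_ordIso[symmetric] by blast
  then show thesis by (intro that[of p]) (simp add: bij_betw_def)
qed

text \<open>A list is coded by its length and an iterated pairing; the latter alone need not determine the
  length.\<close>

lemma infinite_list_inj:
  assumes "infinite (UNIV :: 'u set)"
  obtains q :: "'u list \<Rightarrow> 'u" where "inj q"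
proof -
  obtain p :: "'u \<times> 'u \<Rightarrow> 'u" where p: "inj p" by (rule infinite_pair_inj[OF assms])
  obtain n :: "nat \<Rightarrow> 'u" where n: "inj n" using assms infinite_countable_subset by blast
  \<comment> \<open>The value on the empty list is immaterial.\<close>
  define code where "code = (\<lambda>xs. foldr (\<lambda>x c. p (x, c)) xs undefined)"
  have code: "xs = ys" if "length xs = length ys" "code xs = code ys" for xs ys :: "'u list"
    using that
    by (induction xs ys rule: list_induct2) (auto simp: code_def dest: injD[OF p])
  have "inj (\<lambda>xs. p (n (length xs), code xs))"
    by (rule injI) (auto dest!: injD[OF p] injD[OF n] intro: code)
  then show thesis by (rule that)
qed

section \<open>The source of a universal central extension is perfect\<close>

text \<open>The product of \<open>L\<close> with a vector space \<open>A\<close>, the latter with zero bracket and twisting map \<open>a\<close>.\<close>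

definition product_hom_lie ::
  "('k, 'q, 'c) module_scheme \<Rightarrow> ('q \<Rightarrow> 'q) \<Rightarrow> ('k, 'l) hom_lie \<Rightarrow> ('k, 'q \<times> 'l) hom_lie" where
  "product_hom_lie A a L = \<lparr>carrier = carrier A \<times> carrier L, mult = undefined, one = undefined,
     zero = (\<zero>\<^bsub>A\<^esub>, \<zero>\<^bsub>L\<^esub>), add = (\<lambda>p q. (fst p \<oplus>\<^bsub>A\<^esub> fst q, snd p \<oplus>\<^bsub>L\<^esub> snd q)),
     smult = (\<lambda>c p. (c \<odot>\<^bsub>A\<^esub> fst p, c \<odot>\<^bsub>L\<^esub> snd p)),
     bracket = (\<lambda>p q. (\<zero>\<^bsub>A\<^esub>, bracket L (snd p) (snd q))), alpha = (\<lambda>p. (a (fst p), alpha L (snd p)))\<rparr>"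

lemma product_hom_lie:
  assumes A: "module R A" and a: "a \<in> linear_maps R A A" and L: "hom_lie_algebra R L"
  shows "hom_lie_algebra R (product_hom_lie A a L)"
proof -
  interpret A: module R A by fact
  interpret L: hom_lie_algebra R L by fact
  let ?P = "product_hom_lie A a L"
  have ag: "abelian_group ?P"
  proof (rule abelian_groupI, goal_cases)
    case (1 x y) then show ?case by (auto simp: product_hom_lie_def)
  next
    case 2 then show ?case by (simp add: product_hom_lie_def)
  next
    case (3 x y z) then show ?case by (auto simp: product_hom_lie_def A.a_assoc L.a_assoc)
  next
    case (4 x y) then show ?case by (auto simp: product_hom_lie_def A.a_comm L.a_comm)
  next
    case (5 x) then show ?case by (auto simp: product_hom_lie_def)
  next
    case (6 x)
    then show ?case
      by (intro bexI[of _ "(\<ominus>\<^bsub>A\<^esub> fst x, \<ominus>\<^bsub>L\<^esub> snd x)"])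
         (auto simp: product_hom_lie_def A.l_neg L.l_neg)
  qed
  have P: "module R ?P"
    by (rule moduleI[OF A.R.is_cring ag])
       (auto simp: product_hom_lie_def A.smult_l_distr A.smult_r_distr A.smult_assoc1
         L.smult_l_distr L.smult_r_distr L.smult_assoc1)
  interpret P: module R ?P by (rule P)
  have minus: "\<ominus>\<^bsub>?P\<^esub> (x, y) = (\<ominus>\<^bsub>A\<^esub> x, \<ominus>\<^bsub>L\<^esub> y)" if "x \<in> carrier A" "y \<in> carrier L" for x y
    by (rule P.minus_equality) (use that in \<open>auto simp: product_hom_lie_def A.l_neg L.l_neg\<close>)
  have mz: "\<ominus>\<^bsub>A\<^esub> \<zero>\<^bsub>A\<^esub> = \<zero>\<^bsub>A\<^esub>" by (rule A.minus_equality) simp_all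
  have az: "a \<zero>\<^bsub>A\<^esub> = \<zero>\<^bsub>A\<^esub>" by (rule linear_map_zero[OF A A a])
  show ?thesis
  proof (intro hom_lie_algebra.intro hom_lie_algebra_axioms.intro)
    show "bracket ?P x y = \<ominus>\<^bsub>?P\<^esub> bracket ?P y x" if "x \<in> carrier ?P" "y \<in> carrier ?P" for x y
      using that minus[of "\<zero>\<^bsub>A\<^esub>" "bracket L (snd y) (snd x)"] L.bracket_skew[of "snd x" "snd y"]
      by (auto simp: product_hom_lie_def mz)
    show "bracket ?P (alpha ?P x) (bracket ?P y z) \<oplus>\<^bsub>?P\<^esub> bracket ?P (alpha ?P z) (bracket ?P x y)
        \<oplus>\<^bsub>?P\<^esub> bracket ?P (alpha ?P y) (bracket ?P z x) = \<zero>\<^bsub>?P\<^esub>"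
      if "x \<in> carrier ?P" "y \<in> carrier ?P" "z \<in> carrier ?P" for x y z
      using that L.hom_jacobi[of "snd x" "snd y" "snd z"] by (auto simp: product_hom_lie_def)
    show "field R" by (rule L.R_field)
    show "module R ?P" by (rule P)
  qed (auto intro!: linear_mapsI simp: product_hom_lie_def L.bracket_add_left
    L.bracket_add_right L.bracket_smult_left L.bracket_smult_right L.alpha_add L.alpha_smult
    L.alpha_bracket az linear_map_closed[OF a] linear_map_add[OF a] linear_map_smult[OF a])
qed

text \<open>The zero map and the class map \<open>K \<rightarrow> K / [K, K]\<close> give two lifts of \<open>\<pi>\<close> to the central extension
  \<open>K / [K, K] \<times> L\<close>; they agree by universality.\<close>

lemma universal_central_perfect:
  fixes K L :: "('k, 'u) hom_lie" and M :: "('k, 'm) hom_lie"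
  assumes inf: "infinite (UNIV :: 'u set)"
    and u: "universal_central_extension TYPE('u) R M i K \<pi> L"
  shows "perfect R K"
proof -
  have c: "central_hom R K \<pi> L"
    using u central_extension_hom unfolding universal_central_extension_def by blast
  note \<pi> = central_homD(3)[OF c]
  interpret K: hom_lie_algebra R K by (rule central_homD[OF c])
  interpret L: hom_lie_algebra R L by (rule central_homD[OF c])
  let ?D = "derived R K"
  let ?A = "quot_module K ?D" and ?q = "\<lambda>x. ?D +>\<^bsub>K\<^esub> x"
  have D: "submodule ?D R K" by (rule derived_submodule[OF K.self])
  note A = quot_module_module[OF K.V_module D]
  note q = quot_class_linear[OF K.V_module D]
  note qs = quot_class_surj[OF K.V_module D]
  note qz = quot_class_zero_iff[OF K.V_module D]
  interpret A: module R ?A by (rule A)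
  have "?D \<subseteq> {x \<in> carrier K. alpha K x \<in> ?D}"
    by (rule derived_least[OF vimage_submodule[OF K.V_module K.V_module K.alpha_linear D]])
       (simp add: K.alpha_bracket bracket_in_derived)
  then have ker: "?q (alpha K z) = \<zero>\<^bsub>?A\<^esub>" if "z \<in> carrier K" "?q z = \<zero>\<^bsub>?A\<^esub>" for z
    using that qz by auto
  obtain a where a: "a \<in> linear_maps R ?A ?A" "\<And>x. x \<in> carrier K \<Longrightarrow> a (?q x) = ?q (alpha K x)"
    by (rule linear_map_factor[OF K.V_module A A q qs linear_map_comp[OF K.alpha_linear q] ker])
       (assumption | rule that; assumption)+
  let ?E = "product_hom_lie ?A a L"
  have E: "hom_lie_algebra R ?E" by (rule product_hom_lie[OF A a(1) L.self])
  have cE: "central_hom R ?E snd L"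
    unfolding central_hom_def
    using E L.self A.zero_closed
    by (auto simp: product_hom_lie_def hom_lie_homs_def linear_maps_def image_iff)
  obtain p :: "'u \<times> 'u \<Rightarrow> 'u" where p: "inj p" by (rule infinite_pair_inj[OF inf])
  have "inj_on (\<lambda>e. p (inv_into (carrier K) ?q (fst e), snd e)) (carrier ?E)"
  proof (rule inj_onI)
    fix e f assume ef: "e \<in> carrier ?E" "f \<in> carrier ?E"
      and eq: "p (inv_into (carrier K) ?q (fst e), snd e) = p (inv_into (carrier K) ?q (fst f), snd f)"
    have "fst e \<in> ?q ` carrier K" "fst f \<in> ?q ` carrier K"
      using ef qs by (auto simp: product_hom_lie_def)
    then show "e = f"
      using injD[OF p eq] by (metis Pair_inject f_inv_into_f prod_eqI)
  qed
  then have lift: "unique_lift R K \<pi> ?E snd" by (rule universal_central_small[OF u cE])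
  have h0: "(\<lambda>x. (\<zero>\<^bsub>?A\<^esub>, \<pi> x)) \<in> hom_lie_homs R K ?E"
    using hom_closed[OF \<pi>] linear_map_zero[OF A A a(1)]
    by (intro hom_lie_homsI linear_mapsI)
       (simp_all add: product_hom_lie_def hom_bracket[OF \<pi>] hom_alpha[OF \<pi>]
         linear_map_add[OF hom_linear[OF \<pi>]] linear_map_smult[OF hom_linear[OF \<pi>]])
  have h1: "(\<lambda>x. (?q x, \<pi> x)) \<in> hom_lie_homs R K ?E"
    using hom_closed[OF \<pi>] linear_map_closed[OF q]
    by (intro hom_lie_homsI linear_mapsI)
       (simp_all add: product_hom_lie_def hom_bracket[OF \<pi>] hom_alpha[OF \<pi>] a(2)
         linear_map_add[OF hom_linear[OF \<pi>]] linear_map_smult[OF hom_linear[OF \<pi>]]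
         linear_map_add[OF q] linear_map_smult[OF q] qz bracket_in_derived)
  have "x \<in> ?D" if x: "x \<in> carrier K" for x
    using unique_liftD[OF lift h0 h1 _ _ x] qz[OF x] by simp
  then show ?thesis by (intro perfectI[OF K.self]) blast
qed

section \<open>The exterior cover\<close>

text \<open>The map \<open>x \<and> y \<mapsto> [x', y']\<close>, for preimages \<open>x', y'\<close> of \<open>f x, f y\<close>, is well defined since the kernel
  of \<open>\<rho>\<close> is central, and kills boundaries by the Hom-Jacobi identity in \<open>E\<close>.\<close>

lemma (in hom_lie_algebra) central_hom_lift_E2:
  assumes c: "central_hom R E \<rho> K" and f: "f \<in> hom_lie_homs R L K"
  obtains \<beta> where "\<beta> \<in> linear_maps R E2 E"
    "\<And>x y x' y'. \<lbrakk>x \<in> carrier L; y \<in> carrier L; x' \<in> carrier E; y' \<in> carrier E; \<rho> x' = f x; \<rho> y' = f y\<rbrakk>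
       \<Longrightarrow> \<beta> (w2 x y) = bracket E x' y'"
    "\<And>z. z \<in> boundaries R L 2 \<Longrightarrow> \<beta> z = \<zero>\<^bsub>E\<^esub>"
proof -
  interpret E: hom_lie_algebra R E by (rule central_homD[OF c])
  note \<rho> = central_homD(3)[OF c]
  define s where "s x = inv_into (carrier E) \<rho> (f x)" for x
  have s: "s x \<in> carrier E" "\<rho> (s x) = f x" if "x \<in> carrier L" for x
    using hom_closed[OF f that] central_homD(4)[OF c]
    by (auto simp: s_def intro: inv_into_into f_inv_into_f)
  note cong = central_hom_bracket_cong[OF c]
  have add: "bracket E (s (x \<oplus>\<^bsub>L\<^esub> x')) (s y) = bracket E (s x) (s y) \<oplus>\<^bsub>E\<^esub> bracket E (s x') (s y)"
    if "x \<in> carrier L" "x' \<in> carrier L" "y \<in> carrier L" for x x' y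
  proof -
    have "bracket E (s (x \<oplus>\<^bsub>L\<^esub> x')) (s y) = bracket E (s x \<oplus>\<^bsub>E\<^esub> s x') (s y)"
      using that by (intro cong)
        (simp_all add: s linear_map_add[OF hom_linear[OF f]] linear_map_add[OF hom_linear[OF \<rho>]])
    then show ?thesis using that s by (simp add: E.bracket_add_left)
  qed
  have smult: "bracket E (s (a \<odot>\<^bsub>L\<^esub> x)) (s y) = a \<odot>\<^bsub>E\<^esub> bracket E (s x) (s y)"
    if "a \<in> carrier R" "x \<in> carrier L" "y \<in> carrier L" for a x y
  proof -
    have "bracket E (s (a \<odot>\<^bsub>L\<^esub> x)) (s y) = bracket E (a \<odot>\<^bsub>E\<^esub> s x) (s y)"
      using that by (intro cong)
        (simp_all add: s linear_map_smult[OF hom_linear[OF f]] linear_map_smult[OF hom_linear[OF \<rho>]])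
    then show ?thesis using that s by (simp add: E.bracket_smult_left)
  qed
  obtain \<beta> where \<beta>: "\<beta> \<in> linear_maps R E2 E"
    "\<And>x y. \<lbrakk>x \<in> carrier L; y \<in> carrier L\<rbrakk> \<Longrightarrow> \<beta> (w2 x y) = bracket E (s x) (s y)"
    by (rule E2_lift[OF E.V_module, of "\<lambda>x y. bracket E (s x) (s y)"])
       (simp_all add: s add smult E.bracket_skew[symmetric] | rule that; assumption)+
  have \<beta>': "\<beta> (w2 x y) = bracket E x' y'"
    if "x \<in> carrier L" "y \<in> carrier L" "x' \<in> carrier E" "y' \<in> carrier E" "\<rho> x' = f x" "\<rho> y' = f y"
    for x y x' y'
    using that by (simp add: \<beta>(2)) (intro cong; simp add: s)
  have "jacobi_wedge x y z \<in> {z \<in> carrier E2. \<beta> z = \<zero>\<^bsub>E\<^esub>}"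
    if xyz: "x \<in> carrier L" "y \<in> carrier L" "z \<in> carrier L" for x y z
  proof -
    interpret E2: module R E2 by (rule E2_module)
    have br: "\<beta> (w2 (alpha L a) (bracket L b d)) = bracket E (alpha E (s a)) (bracket E (s b) (s d))"
      if "a \<in> carrier L" "b \<in> carrier L" "d \<in> carrier L" for a b d
      using that by (intro \<beta>')
        (simp_all add: s hom_alpha[OF f] hom_alpha[OF \<rho>] hom_bracket[OF f] hom_bracket[OF \<rho>])
    have "\<beta> (jacobi_wedge x y z) = \<zero>\<^bsub>E\<^esub>"
      using xyz E.hom_jacobi[of "s x" "s y" "s z"]
      by (simp add: jacobi_wedge_def linear_map_add[OF \<beta>(1)] br s)
    then show ?thesis using xyz by simp
  qed
  then have "boundaries R L 2 \<subseteq> {z \<in> carrier E2. \<beta> z = \<zero>\<^bsub>E\<^esub>}"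
    by (rule boundaries_least[OF kernel_submodule[OF E2_module E.V_module \<beta>(1)]])
  then have ker: "\<beta> z = \<zero>\<^bsub>E\<^esub>" if "z \<in> boundaries R L 2" for z using that by blast
  show thesis by (rule that[OF \<beta>(1)]) (rule \<beta>' ker; assumption)+
qed

text \<open>
  An exterior cover of \<open>L\<close> is \<open>\<Lambda>\<^sup>2 L\<close> modulo the boundaries of degree 2, realised on a carrier of any
  type, with class map \<open>c\<close>, with \<open>u\<close> induced by the bracket of \<open>L\<close>, and with the bracket
  \<open>[X, Y] = c (u X \<and> u Y)\<close>.
\<close>

locale exterior_cover = hom_lie_algebra R L + Q: hom_lie_algebra R Q
  for R :: "'k ring" and L :: "('k, 'l) hom_lie" and Q :: "('k, 'q) hom_lie" +
  fixes u :: "'q \<Rightarrow> 'l" and c :: "('l list \<Rightarrow> 'k) set \<Rightarrow> 'q"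
  assumes u_hom: "u \<in> hom_lie_homs R Q L"
    and c_linear: "c \<in> linear_maps R (ext_power R L 2) Q"
    and c_surj: "c ` carrier (ext_power R L 2) = carrier Q"
    and c_zero_iff: "z \<in> carrier (ext_power R L 2) \<Longrightarrow> c z = \<zero>\<^bsub>Q\<^esub> \<longleftrightarrow> z \<in> boundaries R L 2"
    and u_c: "\<lbrakk>x \<in> carrier L; y \<in> carrier L\<rbrakk> \<Longrightarrow> u (c (wedge R L [x, y])) = bracket L x y"
    and alpha_c: "\<lbrakk>x \<in> carrier L; y \<in> carrier L\<rbrakk> \<Longrightarrow>
      alpha Q (c (wedge R L [x, y])) = c (wedge R L [alpha L x, alpha L y])"
    and bracket_Q: "\<lbrakk>X \<in> carrier Q; Y \<in> carrier Q\<rbrakk> \<Longrightarrow>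
      bracket Q X Y = c (wedge R L [u X, u Y])"

lemma exterior_cover_ex:
  fixes L :: "('k, 'l) hom_lie"
  assumes L: "hom_lie_algebra R L"
  obtains Q :: "('k, ('l list \<Rightarrow> 'k) set set) hom_lie" and u c where "exterior_cover R L Q u c"
proof -
  interpret hom_lie_algebra R L by fact
  interpret E: module R E2 by (rule E2_module)
  let ?B = "boundaries R L 2"
  let ?W = "quot_module E2 ?B" and ?c = "\<lambda>z. ?B +>\<^bsub>E2\<^esub> z"
  note W = quot_module_module[OF E2_module boundaries_submodule]
  note c = quot_class_linear[OF E2_module boundaries_submodule]
  note cs = quot_class_surj[OF E2_module boundaries_submodule]
  note cz = quot_class_zero_iff[OF E2_module boundaries_submodule]
  interpret W: module R ?W by (rule W)
  obtain v where v: "v \<in> linear_maps R E2 L"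
    "\<And>x y. \<lbrakk>x \<in> carrier L; y \<in> carrier L\<rbrakk> \<Longrightarrow> v (w2 x y) = bracket L x y"
    by (rule bracket_map) (rule that; assumption)
  have "jacobi_wedge x y z \<in> {z \<in> carrier E2. v z = \<zero>\<^bsub>L\<^esub>}"
    if "x \<in> carrier L" "y \<in> carrier L" "z \<in> carrier L" for x y z
  proof -
    have "v (jacobi_wedge x y z) = \<zero>\<^bsub>L\<^esub>"
      using that hom_jacobi[of x y z]
      by (simp add: jacobi_wedge_def linear_map_add[OF v(1)] v(2))
    then show ?thesis using that by simp
  qed
  then have "?B \<subseteq> {z \<in> carrier E2. v z = \<zero>\<^bsub>L\<^esub>}"
    by (rule boundaries_least[OF kernel_submodule[OF E2_module V_module v(1)]])
  then have vker: "v z = \<zero>\<^bsub>L\<^esub>" if "z \<in> carrier E2" "?c z = \<zero>\<^bsub>?W\<^esub>" for z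
    using that cz[OF that(1)] by blast
  obtain u where u: "u \<in> linear_maps R ?W L" "\<And>z. z \<in> carrier E2 \<Longrightarrow> u (?c z) = v z"
    by (rule linear_map_factor[OF E2_module V_module W c cs v(1) vker])
       (assumption | rule that; assumption)+
  obtain a0 where a0: "a0 \<in> linear_maps R E2 E2"
    "\<And>x y. \<lbrakk>x \<in> carrier L; y \<in> carrier L\<rbrakk> \<Longrightarrow> a0 (w2 x y) = w2 (alpha L x) (alpha L y)"
    by (rule E2_lift[OF E2_module, of "\<lambda>x y. w2 (alpha L x) (alpha L y)"])
       (simp_all add: alpha_add alpha_smult w2_add_left w2_smult_left w2_skew[symmetric] |
         rule that; assumption)+
  have "jacobi_wedge x y z \<in> {z \<in> carrier E2. a0 z \<in> ?B}"
    if "x \<in> carrier L" "y \<in> carrier L" "z \<in> carrier L" for x y z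
  proof -
    have "a0 (jacobi_wedge x y z) = jacobi_wedge (alpha L x) (alpha L y) (alpha L z)"
      using that by (simp add: jacobi_wedge_def linear_map_add[OF a0(1)] a0(2) alpha_bracket)
    then show ?thesis using that by (simp add: jacobi_wedge_boundary)
  qed
  then have "?B \<subseteq> {z \<in> carrier E2. a0 z \<in> ?B}"
    by (rule boundaries_least[OF vimage_submodule[OF E2_module E2_module a0(1) boundaries_submodule]])
  then have aker: "?c (a0 z) = \<zero>\<^bsub>?W\<^esub>" if "z \<in> carrier E2" "?c z = \<zero>\<^bsub>?W\<^esub>" for z
    using that cz linear_map_closed[OF a0(1)] by blast
  obtain a where a: "a \<in> linear_maps R ?W ?W" "\<And>z. z \<in> carrier E2 \<Longrightarrow> a (?c z) = ?c (a0 z)"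
    by (rule linear_map_factor[OF E2_module W W c cs linear_map_comp[OF a0(1) c] aker])
       (assumption | rule that; assumption)+
  define Q :: "('k, ('l list \<Rightarrow> 'k) set set) hom_lie" where
    "Q = \<lparr>carrier = carrier ?W, mult = undefined, one = undefined, zero = \<zero>\<^bsub>?W\<^esub>, add = add ?W,
      smult = smult ?W, bracket = (\<lambda>X Y. ?c (w2 (u X) (u Y))), alpha = a\<rparr>"
  have carQ: "carrier Q = carrier ?W" and zeQ: "\<zero>\<^bsub>Q\<^esub> = \<zero>\<^bsub>?W\<^esub>" and adQ: "add Q = add ?W"
    and smQ: "smult Q = smult ?W" and brQ: "bracket Q X Y = ?c (w2 (u X) (u Y))"
    and alQ: "alpha Q = a" for X Y
    by (simp_all add: Q_def)
  have Q: "module R Q"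
    by (rule module_image[OF W, of "\<lambda>x. x"]) (simp_all add: linear_maps_def carQ zeQ adQ smQ)
  interpret Q: module R Q by (rule Q)
  have cQ: "?c \<in> linear_maps R E2 Q" using c unfolding linear_maps_def carQ adQ smQ .
  have uQ: "u \<in> linear_maps R Q L" using u(1) unfolding linear_maps_def carQ adQ smQ .
  have aQ: "a \<in> linear_maps R Q Q" using a(1) unfolding linear_maps_def carQ adQ smQ .
  note cl = linear_map_closed[OF cQ] linear_map_closed[OF uQ] linear_map_closed[OF aQ]
  have csQ: "?c ` carrier E2 = carrier Q" using cs carQ by simp
  have ucw: "u (?c (w2 x y)) = bracket L x y" if "x \<in> carrier L" "y \<in> carrier L" for x y
    using that by (simp add: u(2) v(2))
  have acw: "a (?c (w2 x y)) = ?c (w2 (alpha L x) (alpha L y))"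
    if "x \<in> carrier L" "y \<in> carrier L" for x y
    using that by (simp add: a(2) a0(2))
  have ua: "u (a X) = alpha L (u X)" if "X \<in> carrier Q" for X
  proof -
    have "X \<in> ?c ` carrier E2" using that csQ by simp
    then obtain z where z: "X = ?c z" "z \<in> carrier E2" by (rule imageE)
    have "v (a0 z) = alpha L (v z)"
      by (rule E2_maps_eq[OF V_module linear_map_comp[OF a0(1) v(1)]
            linear_map_comp[OF v(1) alpha_linear] _ z(2)])
         (simp add: a0(2) v(2) alpha_bracket)
    then show ?thesis using z linear_map_closed[OF a0(1)] by (simp add: a(2) u(2))
  qed
  have Qalg: "hom_lie_algebra R Q"
  proof (intro hom_lie_algebra.intro hom_lie_algebra_axioms.intro)
    show "(\<lambda>Y. bracket Q X Y) \<in> linear_maps R Q Q" if "X \<in> carrier Q" for X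
      by (rule linear_mapsI)
         (use that in \<open>simp_all add: brQ cl linear_map_add[OF uQ] linear_map_smult[OF uQ]
           w2_add_right w2_smult_right linear_map_add[OF cQ] linear_map_smult[OF cQ]\<close>)
    show "(\<lambda>X. bracket Q X Y) \<in> linear_maps R Q Q" if "Y \<in> carrier Q" for Y
      by (rule linear_mapsI)
         (use that in \<open>simp_all add: brQ cl linear_map_add[OF uQ] linear_map_smult[OF uQ]
           w2_add_left w2_smult_left linear_map_add[OF cQ] linear_map_smult[OF cQ]\<close>)
    show "alpha Q \<in> linear_maps R Q Q" using aQ by (simp add: alQ)
    show "bracket Q X Y = \<ominus>\<^bsub>Q\<^esub> bracket Q Y X" if "X \<in> carrier Q" "Y \<in> carrier Q" for X Y
      using that w2_skew[of "u X" "u Y"] linear_map_minus[OF E2_module Q cQ, of "w2 (u Y) (u X)"]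
      by (simp add: brQ cl)
    show "bracket Q (alpha Q X) (bracket Q Y Z) \<oplus>\<^bsub>Q\<^esub> bracket Q (alpha Q Z) (bracket Q X Y)
        \<oplus>\<^bsub>Q\<^esub> bracket Q (alpha Q Y) (bracket Q Z X) = \<zero>\<^bsub>Q\<^esub>"
      if XYZ: "X \<in> carrier Q" "Y \<in> carrier Q" "Z \<in> carrier Q" for X Y Z
    proof -
      have "?c (jacobi_wedge (u X) (u Y) (u Z)) = \<zero>\<^bsub>Q\<^esub>"
        using XYZ cl by (simp add: zeQ cz jacobi_wedge_boundary)
      then show ?thesis
        using XYZ cl
        by (simp add: jacobi_wedge_def brQ alQ ua ucw linear_map_add[OF cQ])
    qed
    show "alpha Q (bracket Q X Y) = bracket Q (alpha Q X) (alpha Q Y)"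
      if "X \<in> carrier Q" "Y \<in> carrier Q" for X Y
      using that cl by (simp add: brQ alQ ua acw)
  qed (rule R_field Q)+
  have "exterior_cover R L Q u ?c"
  proof (intro exterior_cover.intro exterior_cover_axioms.intro)
    show "u \<in> hom_lie_homs R Q L"
      by (rule hom_lie_homsI[OF uQ]) (simp_all add: brQ alQ ua ucw cl)
  qed (simp_all add: L Qalg cQ csQ zeQ cz ucw acw brQ alQ)
  then show thesis by (rule that)
qed

context exterior_cover
begin

lemma u_closed [simp]: "X \<in> carrier Q \<Longrightarrow> u X \<in> carrier L"
  by (rule hom_closed[OF u_hom])

lemma c_closed [simp]: "z \<in> carrier E2 \<Longrightarrow> c z \<in> carrier Q"
  by (rule linear_map_closed[OF c_linear])

text \<open>A cover may be moved along any injection of its carrier into another type.\<close>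

lemma exterior_cover_transport:
  fixes t :: "'q \<Rightarrow> 'v"
  assumes t: "inj_on t (carrier Q)"
  obtains Q' u' c' where "exterior_cover R L (Q' :: ('k, 'v) hom_lie) u' c'"
proof -
  obtain Q' :: "('k, 'v) hom_lie" and s where Q':
    "hom_lie_algebra R Q'" "t \<in> hom_lie_homs R Q Q'" "s \<in> hom_lie_homs R Q' Q"
    "\<And>x. x \<in> carrier Q \<Longrightarrow> s (t x) = x" "\<And>y. y \<in> carrier Q' \<Longrightarrow> t (s y) = y"
    by (rule hom_lie_transport[OF Q.self t]) (rule that; assumption)
  note t_cl = hom_closed[OF Q'(2)] and s_cl = hom_closed[OF Q'(3)]
  have surj: "t ` carrier Q = carrier Q'"
  proof
    show "t ` carrier Q \<subseteq> carrier Q'" using t_cl by blast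
    show "carrier Q' \<subseteq> t ` carrier Q" using Q'(5) s_cl by (metis imageI subsetI)
  qed
  have zero: "t X = \<zero>\<^bsub>Q'\<^esub> \<longleftrightarrow> X = \<zero>\<^bsub>Q\<^esub>" if "X \<in> carrier Q" for X
    using Q'(4)[OF that] hom_zero[OF Q.self Q'(1,2)] hom_zero[OF Q'(1) Q.self Q'(3)] by metis
  have br: "bracket Q' X Y = t (c (w2 (u (s X)) (u (s Y))))"
    if "X \<in> carrier Q'" "Y \<in> carrier Q'" for X Y
    using hom_bracket[OF Q'(2), of "s X" "s Y"] that s_cl Q'(5) by (simp add: bracket_Q)
  have "exterior_cover R L Q' (\<lambda>X. u (s X)) (\<lambda>z. t (c z))"
  proof (intro exterior_cover.intro exterior_cover_axioms.intro)
    show "(\<lambda>X. u (s X)) \<in> hom_lie_homs R Q' L" by (rule hom_lie_comp[OF Q'(3) u_hom])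
    show "(\<lambda>z. t (c z)) \<in> linear_maps R E2 Q'"
      by (rule linear_map_comp[OF c_linear hom_linear[OF Q'(2)]])
    show "(\<lambda>z. t (c z)) ` carrier E2 = carrier Q'"
      unfolding surj[symmetric] c_surj[symmetric] by (rule image_image[symmetric])
    show "alpha Q' (t (c (w2 x y))) = t (c (w2 (alpha L x) (alpha L y)))"
      if "x \<in> carrier L" "y \<in> carrier L" for x y
      using hom_alpha[OF Q'(2), of "c (w2 x y)"] that by (simp add: alpha_c)
  qed (simp_all add: self Q'(1,4) zero c_zero_iff u_c br)
  then show thesis by (rule that)
qed

lemma c_zero: "c \<zero>\<^bsub>E2\<^esub> = \<zero>\<^bsub>Q\<^esub>"
  by (rule linear_map_zero[OF E2_module Q.V_module c_linear])

lemma bracket_Q_zero: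
  "\<lbrakk>X \<in> carrier Q; Y \<in> carrier Q; u X = \<zero>\<^bsub>L\<^esub>\<rbrakk> \<Longrightarrow> bracket Q X Y = \<zero>\<^bsub>Q\<^esub>"
  by (simp add: bracket_Q c_zero)

lemma bracket_Q_zero_right:
  "\<lbrakk>X \<in> carrier Q; Y \<in> carrier Q; u Y = \<zero>\<^bsub>L\<^esub>\<rbrakk> \<Longrightarrow> bracket Q X Y = \<zero>\<^bsub>Q\<^esub>"
  by (simp add: bracket_Q c_zero)

lemma u_surj:
  assumes "perfect R L" shows "u ` carrier Q = carrier L"
proof
  show "u ` carrier Q \<subseteq> carrier L" by auto
  have "bracket L x y \<in> u ` carrier Q" if "x \<in> carrier L" "y \<in> carrier L" for x y
    using that u_c[OF that] by (metis c_closed imageI w2_closed)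
  then show "carrier L \<subseteq> u ` carrier Q"
    by (rule perfect_least[OF assms image_submodule[OF Q.V_module V_module hom_linear[OF u_hom]]])
qed

lemma cover_perfect:
  assumes "perfect R L" shows "perfect R Q"
proof (rule perfectI[OF Q.self])
  have "w2 x y \<in> {z \<in> carrier E2. c z \<in> derived R Q}"
    if xy: "x \<in> carrier L" "y \<in> carrier L" for x y
  proof -
    obtain X Y where X: "X \<in> carrier Q" "Y \<in> carrier Q" "x = u X" "y = u Y"
      using xy u_surj[OF assms] by blast
    then have "c (w2 x y) = bracket Q X Y" by (simp add: bracket_Q)
    then show ?thesis using xy bracket_in_derived X by simp
  qed
  then have "carrier E2 \<subseteq> {z \<in> carrier E2. c z \<in> derived R Q}"
    by (rule E2_span[OF vimage_submodule[OF E2_module Q.V_module c_linear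
            derived_submodule[OF Q.self]]])
  then show "carrier Q \<subseteq> derived R Q" unfolding c_surj[symmetric] by blast
qed

lemma central_hom_cover: "perfect R L \<Longrightarrow> central_hom R Q u L"
  unfolding central_hom_def
  by (simp add: Q.self self u_hom u_surj bracket_Q_zero)

text \<open>Homomorphisms \<open>L \<rightarrow> K\<close> lift to the cover along every central extension of \<open>K\<close>, whatever the type
  of its carrier.\<close>

lemma cover_lift:
  assumes e: "central_hom R E \<rho> K" and f: "f \<in> hom_lie_homs R L K"
  obtains h where "h \<in> hom_lie_homs R Q E" "\<And>X. X \<in> carrier Q \<Longrightarrow> \<rho> (h X) = f (u X)"
proof -
  interpret E: hom_lie_algebra R E by (rule central_homD[OF e])
  interpret K: hom_lie_algebra R K by (rule central_homD[OF e])
  note \<rho> = central_homD(3)[OF e]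
  obtain \<beta> where \<beta>: "\<beta> \<in> linear_maps R E2 E"
    "\<And>x y x' y'. \<lbrakk>x \<in> carrier L; y \<in> carrier L; x' \<in> carrier E; y' \<in> carrier E; \<rho> x' = f x; \<rho> y' = f y\<rbrakk>
       \<Longrightarrow> \<beta> (w2 x y) = bracket E x' y'"
    "\<And>z. z \<in> boundaries R L 2 \<Longrightarrow> \<beta> z = \<zero>\<^bsub>E\<^esub>"
    by (rule central_hom_lift_E2[OF e f]) (rule that; assumption)
  have ker: "\<beta> z = \<zero>\<^bsub>E\<^esub>" if "z \<in> carrier E2" "c z = \<zero>\<^bsub>Q\<^esub>" for z
    using that c_zero_iff \<beta>(3) by simp
  obtain h where h: "h \<in> linear_maps R Q E" "\<And>z. z \<in> carrier E2 \<Longrightarrow> h (c z) = \<beta> z"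
    by (rule linear_map_factor[OF E2_module E.V_module Q.V_module c_linear c_surj \<beta>(1) ker])
       (assumption | rule that; assumption)+
  have pre: "\<exists>x'\<in>carrier E. \<rho> x' = f x" if "x \<in> carrier L" for x
    using hom_closed[OF f that] central_homD(4)[OF e] by (metis imageE)
  have \<rho>h: "\<rho> (h X) = f (u X)" if X: "X \<in> carrier Q" for X
  proof -
    obtain z where z: "z \<in> carrier E2" "X = c z" using X unfolding c_surj[symmetric] by blast
    have "\<rho> (\<beta> z) = f (u (c z))"
    proof (rule E2_maps_eq[OF K.V_module linear_map_comp[OF \<beta>(1) hom_linear[OF \<rho>]]
          linear_map_comp[OF c_linear hom_linear[OF hom_lie_comp[OF u_hom f]]] _ z(1)])
      fix x y assume xy: "x \<in> carrier L" "y \<in> carrier L"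
      obtain x' y' where x': "x' \<in> carrier E" "\<rho> x' = f x" and y': "y' \<in> carrier E" "\<rho> y' = f y"
        using pre xy by metis
      show "\<rho> (\<beta> (w2 x y)) = f (u (c (w2 x y)))"
        using xy x' y' by (simp add: \<beta>(2)[OF xy x'(1) y'(1) x'(2) y'(2)] u_c hom_bracket[OF f]
            hom_bracket[OF \<rho>])
    qed
    then show ?thesis using z h(2) by simp
  qed
  have "h \<in> hom_lie_homs R Q E"
  proof (rule hom_lie_homsI[OF h(1)])
    fix X Y assume XY: "X \<in> carrier Q" "Y \<in> carrier Q"
    have "h (bracket Q X Y) = \<beta> (w2 (u X) (u Y))" using XY by (simp add: bracket_Q h(2))
    also have "\<dots> = bracket E (h X) (h Y)"
      by (rule \<beta>(2)) (use XY in \<open>simp_all add: linear_map_closed[OF h(1)] \<rho>h\<close>)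
    finally show "h (bracket Q X Y) = bracket E (h X) (h Y)" .
  next
    fix X assume X: "X \<in> carrier Q"
    obtain z where z: "z \<in> carrier E2" "X = c z" using X unfolding c_surj[symmetric] by blast
    have "h (alpha Q (c z)) = alpha E (h (c z))"
    proof (rule E2_maps_eq[OF E.V_module
          linear_map_comp[OF linear_map_comp[OF c_linear Q.alpha_linear] h(1)]
          linear_map_comp[OF linear_map_comp[OF c_linear h(1)] E.alpha_linear] _ z(1)])
      fix x y assume xy: "x \<in> carrier L" "y \<in> carrier L"
      obtain x' y' where x': "x' \<in> carrier E" "\<rho> x' = f x" and y': "y' \<in> carrier E" "\<rho> y' = f y"
        using pre xy by metis
      have "\<beta> (w2 (alpha L x) (alpha L y)) = bracket E (alpha E x') (alpha E y')"
        by (rule \<beta>(2)) (use xy x' y' in \<open>simp_all add: hom_alpha[OF f] hom_alpha[OF \<rho>]\<close>)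
      then show "h (alpha Q (c (w2 x y))) = alpha E (h (c (w2 x y)))"
        using xy x' y' by (simp add: alpha_c h(2) \<beta>(2)[OF xy x'(1) y'(1) x'(2) y'(2)] E.alpha_bracket)
    qed
    then show "h (alpha Q X) = alpha E (h X)" using z by simp
  qed
  then show thesis using \<rho>h by (rule that)
qed

lemma cover_universal:
  assumes "perfect R L" "central_hom R E \<rho> L"
  shows "unique_lift R Q u E \<rho>"
proof -
  obtain h where h: "h \<in> hom_lie_homs R Q E" "\<And>X. X \<in> carrier Q \<Longrightarrow> \<rho> (h X) = u X"
    by (rule cover_lift[OF assms(2) hom_lie_id]) (rule that; assumption)
  show ?thesis
    by (rule unique_liftI[where h = h])
       (simp_all add: h, rule perfect_lift_unique[OF Q.self cover_perfect[OF assms(1)] assms(2)])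
qed

end

text \<open>Every element of the cover is the image of a finite list of pairs from \<open>L\<close>, so a copy of the
  cover fits into the carrier type of \<open>L\<close> as soon as that type is infinite.\<close>

lemma exterior_cover_same_type:
  fixes L :: "('k, 'u) hom_lie"
  assumes inf: "infinite (UNIV :: 'u set)" and L: "hom_lie_algebra R L"
  obtains Q :: "('k, 'u) hom_lie" and u c where "exterior_cover R L Q u c"
proof -
  obtain Q0 :: "('k, ('u list \<Rightarrow> 'k) set set) hom_lie" and u0 c0
    where 0: "exterior_cover R L Q0 u0 c0"
    by (rule exterior_cover_ex[OF L]) (rule that; assumption)
  interpret exterior_cover R L Q0 u0 c0 by (rule 0)
  obtain p :: "'u \<times> 'u \<Rightarrow> 'u" where p: "inj p"
    by (rule infinite_pair_inj[OF inf]) (rule that; assumption)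
  obtain q :: "'u list \<Rightarrow> 'u" where q: "inj q"
    by (rule infinite_list_inj[OF inf]) (rule that; assumption)
  define F where "F ps = c0 (foldr (\<lambda>p s. w2 (fst p) (snd p) \<oplus>\<^bsub>E2\<^esub> s) ps \<zero>\<^bsub>E2\<^esub>)" for ps
  have "X \<in> range F" if "X \<in> carrier Q0" for X
  proof -
    have "X \<in> c0 ` carrier E2" using that c_surj by simp
    then obtain z where z: "X = c0 z" "z \<in> carrier E2" by (rule imageE)
    show ?thesis
      by (rule E2_sum_of_wedges[OF z(2)]) (simp add: z(1) F_def)
  qed
  then have inv: "inj_on (inv_into UNIV F) (carrier Q0)"
    by (intro inj_on_inv_into) blast
  have "inj_on (\<lambda>X. q (map p (inv_into UNIV F X))) (carrier Q0)"
  proof (rule inj_onI)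
    fix X Y assume XY: "X \<in> carrier Q0" "Y \<in> carrier Q0" "q (map p (inv_into UNIV F X)) = q (map p (inv_into UNIV F Y))"
    then have "inv_into UNIV F X = inv_into UNIV F Y" using injD[OF q] inj_map_eq_map[OF p] by metis
    then show "X = Y" using inj_onD[OF inv] XY(1,2) by blast
  qed
  then show thesis
    by (rule exterior_cover_transport) (rule that)
qed


section \<open>The kernel of the universal central extension\<close>

text \<open>With \<open>\<beta> (x \<and> y) = [x', y']\<close> as before one has \<open>\<pi> \<beta> = v\<close>, the bracket map of \<open>L\<close>, and \<open>g \<beta> = c\<close> for the
  homomorphism \<open>g\<close> from \<open>K\<close> to the cover.  The first identity places \<open>\<beta> z\<close> in the kernel of \<open>\<pi>\<close> exactly
  for cycles \<open>z\<close>, the second gives injectivity on homology, and perfectness of \<open>K\<close> makes \<open>\<beta>\<close> onto.\<close>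

lemma universal_central_kernel_H2:
  fixes M K L :: "('k, 'u) hom_lie"
  assumes inf: "infinite (UNIV :: 'u set)" and perf: "perfect R L"
    and univ: "universal_central_extension TYPE('u) R M i K \<pi> L"
  shows "\<exists>\<phi>. canonical_H2_iso R M i K \<pi> L \<phi>"
proof -
  have ext: "central_extension R M i K \<pi> L"
    using univ unfolding universal_central_extension_def by simp
  have ck: "central_hom R K \<pi> L" by (rule central_extension_hom[OF ext])
  note \<pi> = central_homD(3)[OF ck]
  have Kperf: "perfect R K" by (rule universal_central_perfect[OF inf univ])
  have M: "hom_lie_algebra R M" and i: "i \<in> hom_lie_homs R M K" and i_inj: "inj_on i (carrier M)"
    and i_img: "i ` carrier M = {k \<in> carrier K. \<pi> k = \<zero>\<^bsub>L\<^esub>}"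
    using ext unfolding central_extension_def extension_def a_kernel_def' by auto
  interpret M: hom_lie_algebra R M by (rule M)
  interpret K: hom_lie_algebra R K by (rule central_homD[OF ck])
  obtain Q :: "('k, 'u) hom_lie" and u c where cover: "exterior_cover R L Q u c"
    by (rule exterior_cover_same_type[OF inf central_homD(2)[OF ck]]) (rule that; assumption)
  interpret exterior_cover R L Q u c by (rule cover)
  have lift: "unique_lift R K \<pi> Q u"
    using univ central_hom_extension[OF central_hom_cover[OF perf]]
    unfolding universal_central_extension_def by simp
  obtain g where g: "g \<in> hom_lie_homs R K Q" "\<And>k. k \<in> carrier K \<Longrightarrow> u (g k) = \<pi> k"
    by (rule unique_lift_obtain[OF lift]) (rule that; assumption)
  obtain v where v: "v \<in> linear_maps R E2 L"
    "\<And>x y. \<lbrakk>x \<in> carrier L; y \<in> carrier L\<rbrakk> \<Longrightarrow> v (w2 x y) = bracket L x y"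
    by (rule bracket_map) (rule that; assumption)
  obtain \<beta> where \<beta>: "\<beta> \<in> linear_maps R E2 K"
    "\<And>x y x' y'. \<lbrakk>x \<in> carrier L; y \<in> carrier L; x' \<in> carrier K; y' \<in> carrier K; \<pi> x' = x; \<pi> y' = y\<rbrakk>
       \<Longrightarrow> \<beta> (w2 x y) = bracket K x' y'"
    "\<And>z. z \<in> boundaries R L 2 \<Longrightarrow> \<beta> z = \<zero>\<^bsub>K\<^esub>"
    by (rule central_hom_lift_E2[OF ck hom_lie_id]) (rule that; assumption)
  have pre: "\<exists>x'\<in>carrier K. \<pi> x' = x" if "x \<in> carrier L" for x
    using that central_homD(4)[OF ck] by (metis imageE)
  have \<beta>w: "\<beta> (w2 (\<pi> x) (\<pi> y)) = bracket K x y" if "x \<in> carrier K" "y \<in> carrier K" for x y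
    by (rule \<beta>(2)) (use that hom_closed[OF \<pi>] in auto)
  have \<pi>\<beta>: "\<pi> (\<beta> z) = v z" if "z \<in> carrier E2" for z
  proof (rule E2_maps_eq[OF V_module linear_map_comp[OF \<beta>(1) hom_linear[OF \<pi>]] v(1) _ that])
    fix x y assume xy: "x \<in> carrier L" "y \<in> carrier L"
    obtain x' y' where "x' \<in> carrier K" "\<pi> x' = x" "y' \<in> carrier K" "\<pi> y' = y"
      using pre xy by metis
    then show "\<pi> (\<beta> (w2 x y)) = v (w2 x y)"
      using xy \<beta>w[of x' y'] by (simp add: v(2) hom_bracket[OF \<pi>])
  qed
  have g\<beta>: "g (\<beta> z) = c z" if "z \<in> carrier E2" for z
  proof (rule E2_maps_eq[OF Q.V_module linear_map_comp[OF \<beta>(1) hom_linear[OF g(1)]] c_linear _ that])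
    fix x y assume xy: "x \<in> carrier L" "y \<in> carrier L"
    obtain x' y' where "x' \<in> carrier K" "\<pi> x' = x" "y' \<in> carrier K" "\<pi> y' = y"
      using pre xy by metis
    then show "g (\<beta> (w2 x y)) = c (w2 x y)"
      using \<beta>w[of x' y'] by (simp add: hom_bracket[OF g(1)] bracket_Q hom_closed[OF g(1)] g(2))
  qed
  \<comment> \<open>As \<open>c\<close> factors through \<open>\<beta>\<close>, the map \<open>\<beta>\<close> kills nothing but boundaries.\<close>
  have \<beta>_zero: "\<beta> z = \<zero>\<^bsub>K\<^esub> \<longleftrightarrow> z \<in> boundaries R L 2" if z: "z \<in> carrier E2" for z
    using g\<beta>[OF z] hom_zero[OF K.self Q.self g(1)] c_zero_iff[OF z] \<beta>(3) by metis
  have "bracket K x y \<in> \<beta> ` carrier E2" if "x \<in> carrier K" "y \<in> carrier K" for x y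
    using \<beta>w[OF that] hom_closed[OF \<pi>] that by (metis imageI w2_closed)
  then have \<beta>_surj: "carrier K \<subseteq> \<beta> ` carrier E2"
    by (rule perfect_least[OF Kperf image_submodule[OF E2_module K.V_module \<beta>(1)]])
  let ?C = "cycles R L 2"
  have C: "?C = {z \<in> carrier E2. v z = \<zero>\<^bsub>L\<^esub>}" by (rule cycles_2[OF v])
  let ?V = "E2\<lparr>carrier := ?C\<rparr>"
  let ?B = "boundaries R L 2"
  have V: "module R ?V"
    unfolding C by (rule submodule.submodule_is_module[OF kernel_submodule[OF E2_module V_module v(1)]
          E2_module])
  have \<beta>V: "\<beta> \<in> linear_maps R ?V K"
    using \<beta>(1) by (auto simp: linear_maps_def C)
  have \<beta>C: "\<beta> z \<in> i ` carrier M" if "z \<in> ?C" for z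
    using that \<pi>\<beta> linear_map_closed[OF \<beta>(1)] by (simp add: i_img C)
  have BC: "z \<in> ?C" if "z \<in> ?B" for z
  proof -
    have "z \<in> carrier E2"
      using that module.submoduleE(1)[OF E2_module boundaries_submodule] by blast
    then show ?thesis using \<pi>\<beta>[of z] \<beta>(3)[OF that] hom_zero[OF K.self self \<pi>] by (simp add: C)
  qed
  \<comment> \<open>Hence the boundaries are exactly the kernel of \<open>\<beta>\<close> on cycles, in particular a submodule of them.\<close>
  have B_eq: "?B = {z \<in> carrier ?V. \<beta> z = \<zero>\<^bsub>K\<^esub>}"
    using BC \<beta>_zero C by auto
  have BV: "submodule ?B R ?V"
    using kernel_submodule[OF V K.V_module \<beta>V] B_eq by simp
  have H: "homology R L 2 = quot_module ?V ?B" by (simp add: homology_def)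
  let ?cl = "\<lambda>z. ?B +>\<^bsub>?V\<^esub> z"
  have cl: "homology_class R L 2 z = ?cl z" for z
    by (simp add: homology_class_def a_r_coset_def r_coset_def)
  note Hm = quot_module_module[OF V BV]
  note cll = quot_class_linear[OF V BV]
  note cls = quot_class_surj[OF V BV]
  note clz = quot_class_zero_iff[OF V BV]
  have clz0: "?cl z = \<zero>\<^bsub>quot_module ?V ?B\<^esub>" if z: "z \<in> carrier ?V" "\<beta> z = \<zero>\<^bsub>K\<^esub>" for z
    using clz[OF z(1)] z B_eq by blast
  define \<psi> where "\<psi> z = inv_into (carrier M) i (\<beta> z)" for z
  have \<psi>: "\<psi> z \<in> carrier M" "i (\<psi> z) = \<beta> z" if "z \<in> ?C" for z
    using \<beta>C[OF that] by (auto simp: \<psi>_def intro: inv_into_into f_inv_into_f)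
  have i_eqD: "x = y" if "x \<in> carrier M" "y \<in> carrier M" "i x = i y" for x y
    using inj_onD[OF i_inj] that by blast
  have \<psi>V: "\<psi> \<in> linear_maps R ?V M"
  proof (rule linear_mapsI)
    fix x assume "x \<in> carrier ?V" then show "\<psi> x \<in> carrier M" using \<psi> by simp
  next
    interpret V: module R ?V by (rule V)
    fix x y assume xy: "x \<in> carrier ?V" "y \<in> carrier ?V"
    have sum: "x \<oplus>\<^bsub>?V\<^esub> y \<in> ?C" using V.a_closed[OF xy] by simp
    show "\<psi> (x \<oplus>\<^bsub>?V\<^esub> y) = \<psi> x \<oplus>\<^bsub>M\<^esub> \<psi> y"
      by (rule i_eqD)
         (use xy sum \<psi> linear_map_add[OF \<beta>V xy] M.a_closed in
           \<open>simp_all add: linear_map_add[OF hom_linear[OF i]]\<close>)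
  next
    interpret V: module R ?V by (rule V)
    fix a x assume ax: "a \<in> carrier R" "x \<in> carrier ?V"
    have prod: "a \<odot>\<^bsub>?V\<^esub> x \<in> ?C" using V.smult_closed[OF ax] by simp
    show "\<psi> (a \<odot>\<^bsub>?V\<^esub> x) = a \<odot>\<^bsub>M\<^esub> \<psi> x"
      by (rule i_eqD)
         (use ax prod \<psi> linear_map_smult[OF \<beta>V ax] in
           \<open>simp_all add: linear_map_smult[OF hom_linear[OF i]]\<close>)
  qed
  have ker: "\<psi> z = \<zero>\<^bsub>M\<^esub>" if z: "z \<in> carrier ?V" "?cl z = \<zero>\<^bsub>quot_module ?V ?B\<^esub>" for z
  proof -
    have "i (\<psi> z) = i \<zero>\<^bsub>M\<^esub>"
      using z clz \<beta>(3) \<psi>(2) hom_zero[OF M.self K.self i] by simp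
    then show ?thesis using i_eqD z \<psi>(1) by simp
  qed
  obtain \<phi> where \<phi>: "\<phi> \<in> linear_maps R (quot_module ?V ?B) M"
    "\<And>z. z \<in> carrier ?V \<Longrightarrow> \<phi> (?cl z) = \<psi> z"
    by (rule linear_map_factor[OF V M.V_module Hm cll cls \<psi>V ker])
       (assumption | rule that; assumption)+
  have inj: "inj_on \<phi> (carrier (quot_module ?V ?B))"
  proof (rule inj_onI)
    fix X Y assume XY: "X \<in> carrier (quot_module ?V ?B)" "Y \<in> carrier (quot_module ?V ?B)"
      and eq: "\<phi> X = \<phi> Y"
    have "X \<in> ?cl ` carrier ?V" "Y \<in> ?cl ` carrier ?V" using XY cls by simp_all
    then obtain x y where xy: "X = ?cl x" "x \<in> carrier ?V" "Y = ?cl y" "y \<in> carrier ?V"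
      by (elim imageE)
    then have "\<psi> x = \<psi> y" using eq \<phi>(2) by simp
    then have "\<beta> x = \<beta> y" using \<psi>(2)[of x] \<psi>(2)[of y] xy(2,4) by simp
    from linear_map_ker_cong[OF V Hm cll clz0 K.V_module \<beta>V xy(2,4) this]
    have "?cl x = ?cl y" by simp
    then show "X = Y" using xy by simp
  qed
  have surj: "\<phi> ` carrier (quot_module ?V ?B) = carrier M"
  proof
    show "\<phi> ` carrier (quot_module ?V ?B) \<subseteq> carrier M" using linear_map_closed[OF \<phi>(1)] by blast
    show "carrier M \<subseteq> \<phi> ` carrier (quot_module ?V ?B)"
    proof
      fix m assume m: "m \<in> carrier M"
      then have im: "i m \<in> carrier K" "\<pi> (i m) = \<zero>\<^bsub>L\<^esub>" using i_img by blast+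
      then obtain z where z: "z \<in> carrier E2" "i m = \<beta> z" using \<beta>_surj by blast
      then have zC: "z \<in> ?C" using im \<pi>\<beta>[of z] by (simp add: C)
      then have "\<psi> z = m" using i_eqD[OF \<psi>(1) m] \<psi>(2) z(2) by simp
      moreover have "\<phi> (?cl z) = \<psi> z" using \<phi>(2) zC by simp
      moreover have "?cl z \<in> carrier (quot_module ?V ?B)"
        using linear_map_closed[OF cll] zC by simp
      ultimately show "m \<in> \<phi> ` carrier (quot_module ?V ?B)" by (metis imageI)
    qed
  qed
  have "canonical_H2_iso R M i K \<pi> L \<phi>"
    unfolding canonical_H2_iso_def H bij_betw_def
  proof (intro conjI bexI[of _ \<beta>] ballI)
    show "i (\<phi> (homology_class R L 2 z)) = \<beta> z" if "z \<in> ?C" for z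
      using that \<phi>(2) \<psi>(2) by (simp add: cl)
  qed (use \<phi>(1) inj surj \<beta>(1) \<beta>w in simp_all)
  then show ?thesis by blast
qed

section \<open>Characterisation of universal central extensions\<close>

lemma universal_alpha_central_split:
  fixes M K L :: "('k, 'u) hom_lie"
  assumes inf: "infinite (UNIV :: 'u set)"
    and univ: "universal_alpha_central_extension TYPE('u) R M i K \<pi> L"
  shows "perfect R K" "every_central_extension_split TYPE('v) R K"
proof -
  note uc = universal_alpha_central_imp_central[OF univ]
  show perf: "perfect R K" by (rule universal_central_perfect[OF inf uc])
  have ck: "central_hom R K \<pi> L"
    using uc central_extension_hom unfolding universal_central_extension_def by blast
  note \<pi> = central_homD(3)[OF ck]
  interpret L: hom_lie_algebra R L by (rule central_homD[OF ck])
  obtain Q :: "('k, 'u) hom_lie" and u c where cover: "exterior_cover R K Q u c"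
    by (rule exterior_cover_same_type[OF inf central_homD(1)[OF ck]]) (rule that; assumption)
  interpret exterior_cover R K Q u c by (rule cover)
  let ?\<rho> = "\<lambda>X. \<pi> (u X)"
  have \<rho>: "?\<rho> \<in> hom_lie_homs R Q L" by (rule hom_lie_comp[OF u_hom \<pi>])
  have \<rho>_surj: "?\<rho> ` carrier Q = carrier L"
    unfolding image_image[symmetric, of \<pi> u] u_surj[OF perf] by (rule central_homD(4)[OF ck])
  \<comment> \<open>For \<open>X\<close> in the kernel of \<open>\<pi> u\<close> every bracket \<open>[X, Y]\<close> lies in the kernel of \<open>u\<close>, so two of the three
    Hom-Jacobi terms for \<open>X, Y, Z\<close> vanish.\<close>
  have alpha_central: "bracket Q (alpha Q X) Y = \<zero>\<^bsub>Q\<^esub>"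
    if X: "X \<in> carrier Q" "?\<rho> X = \<zero>\<^bsub>L\<^esub>" and Y: "Y \<in> carrier Q" for X Y
  proof -
    have ubr: "u (bracket Q X Z) = \<zero>\<^bsub>K\<^esub>" "u (bracket Q Z X) = \<zero>\<^bsub>K\<^esub>" if Z: "Z \<in> carrier Q" for Z
    proof -
      show "u (bracket Q X Z) = \<zero>\<^bsub>K\<^esub>"
        using X Z central_homD(5)[OF ck, of "u X" "u Z"] by (simp add: hom_bracket[OF u_hom])
      have "bracket K (u Z) (u X) = bracket K (u Z) \<zero>\<^bsub>K\<^esub>"
        by (rule central_hom_bracket_cong[OF ck])
           (use X Z in \<open>simp_all add: hom_zero[OF self L.self \<pi>]\<close>)
      then show "u (bracket Q Z X) = \<zero>\<^bsub>K\<^esub>" using X Z by (simp add: hom_bracket[OF u_hom])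
    qed
    have "bracket Q Z W \<in> {Y \<in> carrier Q. bracket Q (alpha Q X) Y = \<zero>\<^bsub>Q\<^esub>}"
      if "Z \<in> carrier Q" "W \<in> carrier Q" for Z W
      using Q.hom_jacobi[of X Z W] that X
      by (simp add: bracket_Q_zero_right ubr)
    then have "carrier Q \<subseteq> {Y \<in> carrier Q. bracket Q (alpha Q X) Y = \<zero>\<^bsub>Q\<^esub>}"
      using X(1) by (intro perfect_least[OF cover_perfect[OF perf]]
        kernel_submodule[OF Q.V_module Q.V_module Q.bracket_linear_right]) auto
    then show ?thesis using Y by blast
  qed
  have "alpha_central_extension R (Q\<lparr>carrier := {X \<in> carrier Q. ?\<rho> X = \<zero>\<^bsub>L\<^esub>}\<rparr>) (\<lambda>X. X) Q ?\<rho> L"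
    unfolding alpha_central_extension_def
    using kernel_extension[OF Q.self L.self \<rho> \<rho>_surj] alpha_central by simp
  then have "unique_lift R K \<pi> Q ?\<rho>"
    using univ unfolding universal_alpha_central_extension_def by blast
  then obtain h where h: "h \<in> hom_lie_homs R K Q" "\<And>x. x \<in> carrier K \<Longrightarrow> \<pi> (u (h x)) = \<pi> x"
    by (rule unique_lift_obtain) (rule that; assumption)
  have uh: "u (h x) = x" if "x \<in> carrier K" for x
    by (rule perfect_lift_unique[OF self perf ck hom_lie_comp[OF h(1) u_hom] hom_lie_id _ that])
       (rule h(2))
  show "every_central_extension_split TYPE('v) R K"
    unfolding every_central_extension_split_def
  proof (intro allI impI)
    fix M' K' :: "('k, 'v) hom_lie" and i' \<pi>'
    assume e: "central_extension R M' i' K' \<pi>' K"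
    obtain k where k: "k \<in> hom_lie_homs R Q K'" "\<And>X. X \<in> carrier Q \<Longrightarrow> \<pi>' (k X) = u X"
      by (rule cover_lift[OF central_extension_hom[OF e] hom_lie_id]) (rule that; assumption)
    have "(\<lambda>x. k (h x)) \<in> hom_lie_homs R K K'" by (rule hom_lie_comp[OF h(1) k(1)])
    moreover have "\<forall>x\<in>carrier K. \<pi>' (k (h x)) = x"
      using k(2) uh hom_closed[OF h(1)] by simp
    ultimately show "split_extension R M' i' K' \<pi>' K"
      using e unfolding split_extension_def central_extension_def
      by (intro conjI bexI[of _ "\<lambda>x. k (h x)"]) simp_all
  qed
qed

text \<open>The splitting of the exterior cover \<open>Q \<rightarrow> K\<close> turns lifts from \<open>Q\<close> into lifts from \<open>K\<close>, which makes the
  pullback of a test extension along \<open>\<pi>\<close> unnecessary.\<close>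

lemma split_imp_universal_central:
  fixes M K L :: "('k, 'u) hom_lie"
  assumes inf: "infinite (UNIV :: 'u set)"
    and ext: "central_extension R M i K \<pi> L" and perf: "perfect R K"
    and split: "every_central_extension_split TYPE('u) R K"
  shows "universal_central_extension TYPE('v) R M i K \<pi> L"
proof -
  have ck: "central_hom R K \<pi> L" by (rule central_extension_hom[OF ext])
  note \<pi> = central_homD(3)[OF ck]
  obtain Q :: "('k, 'u) hom_lie" and u c where cover: "exterior_cover R K Q u c"
    by (rule exterior_cover_same_type[OF inf central_homD(1)[OF ck]]) (rule that; assumption)
  interpret exterior_cover R K Q u c by (rule cover)
  obtain \<sigma> where \<sigma>: "\<sigma> \<in> hom_lie_homs R K Q" "\<And>x. x \<in> carrier K \<Longrightarrow> u (\<sigma> x) = x"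
    using split central_hom_extension[OF central_hom_cover[OF perf]]
    unfolding every_central_extension_split_def split_extension_def by blast
  show ?thesis unfolding universal_central_extension_def
  proof (intro conjI allI impI)
    fix M' K' :: "('k, 'v) hom_lie" and i' \<pi>'
    assume e: "central_extension R M' i' K' \<pi>' L"
    have e': "central_hom R K' \<pi>' L" by (rule central_extension_hom[OF e])
    obtain k where k: "k \<in> hom_lie_homs R Q K'" "\<And>X. X \<in> carrier Q \<Longrightarrow> \<pi>' (k X) = \<pi> (u X)"
      by (rule cover_lift[OF e' \<pi>]) (rule that; assumption)
    show "unique_lift R K \<pi> K' \<pi>'"
    proof (rule unique_liftI)
      show "(\<lambda>x. k (\<sigma> x)) \<in> hom_lie_homs R K K'" by (rule hom_lie_comp[OF \<sigma>(1) k(1)])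
      show "\<pi>' (k (\<sigma> x)) = \<pi> x" if "x \<in> carrier K" for x
        using that k(2) \<sigma>(2) hom_closed[OF \<sigma>(1)] by simp
    qed (rule perfect_lift_unique[OF self perf e'])
  qed (rule ext)
qed

lemma perfect_imp_universal_central_ex:
  fixes L :: "('k, 'u) hom_lie"
  assumes inf: "infinite (UNIV :: 'u set)" and L: "hom_lie_algebra R L" and perf: "perfect R L"
  shows "\<exists>(M :: ('k, 'u) hom_lie) i (K :: ('k, 'u) hom_lie) \<pi>.
    universal_central_extension TYPE('v) R M i K \<pi> L"
proof -
  obtain Q :: "('k, 'u) hom_lie" and u c where cover: "exterior_cover R L Q u c"
    by (rule exterior_cover_same_type[OF inf L]) (rule that; assumption)
  interpret exterior_cover R L Q u c by (rule cover)
  have "universal_central_extension TYPE('v) R (Q\<lparr>carrier := {X \<in> carrier Q. u X = \<zero>\<^bsub>L\<^esub>}\<rparr>)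
    (\<lambda>X. X) Q u L"
    unfolding universal_central_extension_def
    using central_hom_extension[OF central_hom_cover[OF perf]]
    by (auto intro: cover_universal[OF perf] central_extension_hom)
  then show ?thesis by blast
qed

lemma universal_central_base_perfect:
  fixes M K L :: "('k, 'u) hom_lie"
  assumes inf: "infinite (UNIV :: 'u set)"
    and univ: "universal_central_extension TYPE('u) R M i K \<pi> L"
  shows "perfect R L"
proof -
  have ck: "central_hom R K \<pi> L"
    using univ central_extension_hom unfolding universal_central_extension_def by blast
  show ?thesis
    by (rule perfect_image[OF central_homD(1-4)[OF ck] universal_central_perfect[OF inf univ]])
qed

text \<open>Universality does not depend on the type in which the test extensions live: \<open>K\<close> maps to the cover
  of \<open>L\<close>, and the cover maps to every central extension of \<open>L\<close>.\<close>

lemma universal_central_any_type: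
  fixes M K L :: "('k, 'u) hom_lie"
  assumes inf: "infinite (UNIV :: 'u set)"
    and univ: "universal_central_extension TYPE('u) R M i K \<pi> L"
  shows "universal_central_extension TYPE('v) R M i K \<pi> L"
proof -
  have ext: "central_extension R M i K \<pi> L"
    using univ unfolding universal_central_extension_def by simp
  have ck: "central_hom R K \<pi> L" by (rule central_extension_hom[OF ext])
  have perfK: "perfect R K" by (rule universal_central_perfect[OF inf univ])
  have perf: "perfect R L" by (rule universal_central_base_perfect[OF inf univ])
  obtain Q :: "('k, 'u) hom_lie" and u c where cover: "exterior_cover R L Q u c"
    by (rule exterior_cover_same_type[OF inf central_homD(2)[OF ck]]) (rule that; assumption)
  interpret exterior_cover R L Q u c by (rule cover)
  have lift: "unique_lift R K \<pi> Q u"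
    using univ central_hom_extension[OF central_hom_cover[OF perf]]
    unfolding universal_central_extension_def by simp
  obtain g where g: "g \<in> hom_lie_homs R K Q" "\<And>k. k \<in> carrier K \<Longrightarrow> u (g k) = \<pi> k"
    by (rule unique_lift_obtain[OF lift]) (rule that; assumption)
  show ?thesis unfolding universal_central_extension_def
  proof (intro conjI allI impI)
    fix M' K' :: "('k, 'v) hom_lie" and i' \<pi>'
    assume e: "central_extension R M' i' K' \<pi>' L"
    have e': "central_hom R K' \<pi>' L" by (rule central_extension_hom[OF e])
    obtain k where k: "k \<in> hom_lie_homs R Q K'" "\<And>X. X \<in> carrier Q \<Longrightarrow> \<pi>' (k X) = u X"
      by (rule cover_lift[OF e' hom_lie_id]) (rule that; assumption)
    show "unique_lift R K \<pi> K' \<pi>'"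
    proof (rule unique_liftI)
      show "(\<lambda>x. k (g x)) \<in> hom_lie_homs R K K'" by (rule hom_lie_comp[OF g(1) k(1)])
      show "\<pi>' (k (g x)) = \<pi> x" if "x \<in> carrier K" for x
        using that k(2) g(2) hom_closed[OF g(1)] by simp
    qed (rule perfect_lift_unique[OF central_homD(1)[OF ck] perfK e'])
  qed (rule ext)
qed

theorem theorem4p11:
  fixes R :: "'k ring"
  assumes "field R"
    and "infinite (UNIV :: 'u set)"
  shows
    "(\<forall>(M :: ('k, 'u) hom_lie) i (K :: ('k, 'u) hom_lie) \<pi> (L :: ('k, 'u) hom_lie).
        universal_alpha_central_extension TYPE('u) R M i K \<pi> L \<longrightarrow>
        perfect R K \<and> every_central_extension_split TYPE('v) R K) \<and>
     (\<forall>(M :: ('k, 'u) hom_lie) i (K :: ('k, 'u) hom_lie) \<pi> (L :: ('k, 'u) hom_lie).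
        central_extension R M i K \<pi> L \<longrightarrow>
        perfect R K \<longrightarrow> every_central_extension_split TYPE('u) R K \<longrightarrow>
        universal_central_extension TYPE('v) R M i K \<pi> L) \<and>
     (\<forall>L :: ('k, 'u) hom_lie. hom_lie_algebra R L \<longrightarrow>
        ((\<exists>(M :: ('k, 'u) hom_lie) i (K :: ('k, 'u) hom_lie) \<pi>.
            universal_central_extension TYPE('u) R M i K \<pi> L) \<longleftrightarrow> perfect R L) \<and>
        (\<forall>(M :: ('k, 'u) hom_lie) i (K :: ('k, 'u) hom_lie) \<pi>.
            universal_central_extension TYPE('u) R M i K \<pi> L \<longrightarrow>
            universal_central_extension TYPE('v) R M i K \<pi> L)) \<and>
     (\<forall>L :: ('k, 'u) hom_lie. hom_lie_algebra R L \<longrightarrow> perfect R L \<longrightarrow>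
        (\<forall>(M :: ('k, 'u) hom_lie) i (K :: ('k, 'u) hom_lie) \<pi>.
            universal_central_extension TYPE('u) R M i K \<pi> L \<longrightarrow>
            (\<exists>\<phi>. canonical_H2_iso R M i K \<pi> L \<phi>)))"
proof -
  note inf = assms(2)
  show ?thesis
  proof (intro conjI allI impI, goal_cases)
    case (1 M i K \<pi> L) then show ?case by (rule universal_alpha_central_split(1)[OF inf])
  next
    case (2 M i K \<pi> L) then show ?case by (rule universal_alpha_central_split(2)[OF inf])
  next
    case (3 M i K \<pi> L) then show ?case by (rule split_imp_universal_central[OF inf])
  next
    case (4 L) then show ?case
      using perfect_imp_universal_central_ex[OF inf 4] universal_central_base_perfect[OF inf] by blast
  next
    case (5 L M i K \<pi>) show ?case by (rule universal_central_any_type[OF inf 5(2)])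
  next
    case (6 L M i K \<pi>) show ?case by (rule universal_central_kernel_H2[OF inf 6(2,3)])
  qed
qed

end
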